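(* Let $\alpha$ be an action of a compact quantum group $\mathcal{G}=(A,\Delta)$ on a compact Hausdorff space $X$. The following are equivalent: (1) The action $\alpha$ is ergodic. (2) ${\rm Orb}_x=X$ for every $x\in X$. (3) There exists $x_0\in X$ such that ${\rm Orb}_{x_0}=X$.
   Context: Compact Hausdorff spaces are nonempty. $\otimes$ denotes the minimal tensor product of $C^*$-algebras. A compact quantum group $\mathcal{G}$ is a pair $(A,\Delta)$ with $A$ a unital $C^*$-algebra and $\Delta:A\to A\otimes A$ a unital $*$-homomorphism such that $(id\otimes\Delta)\Delta=(\Delta\otimes id)\Delta$ and the linear spans of $\Delta(A)(1\otimes A)$ and of $\Delta(A)(A\otimes 1)$ are dense in $A\otimes A$. Its Haar measure is the unique state $h$ on $A$ with $(h\otimes id)\Delta(a)=(id\otimes h)\Delta(a)=h(a)1_A$ for all $a\in A$. An action of $\mathcal{G}$ on a compact Hausdorff space $X$ is a unital $*$-homomorphism $\alpha:B\to B\otimes A$, where $B=C(X)$, with $(\alpha\otimes id)\alpha=(id\otimes\Delta)\alpha$ and such that the linear span of $\alpha(B)(1\otimes A)$ is dense in $B\otimes A$. The action is ergodic if $\{b\in B:\alpha(b)=b\otimes 1\}=\mathbb{C}1_B$. For $x\in X$, $ev_x:B\to\mathbb{C}$ is evaluation at $x$, and the orbit of $x$ is ${\rm Orb}_x=\{x'\in X:(ev_x\otimes h)\alpha=(ev_{x'}\otimes h)\alpha\}$. *)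

theory Defs
  imports "HOL-Analysis.Analysis"
begin

section \<open>Unital C*-algebras\<close>

class scaleC =
  fixes scaleC :: "complex \<Rightarrow> 'a \<Rightarrow> 'a"  (infixr \<open>*\<^sub>C\<close> 75)

class star =
  fixes star :: "'a \<Rightarrow> 'a"

class star_algebra = ring + monoid_mult + scaleC + star +
  assumes scaleC_add_right: "c *\<^sub>C (x + y) = c *\<^sub>C x + c *\<^sub>C y"
    and scaleC_add_left: "(c + d) *\<^sub>C x = c *\<^sub>C x + d *\<^sub>C x"
    and scaleC_scaleC: "c *\<^sub>C d *\<^sub>C x = (c * d) *\<^sub>C x"
    and scaleC_one: "1 *\<^sub>C x = x"
    and mult_scaleC_left: "(c *\<^sub>C x) * y = c *\<^sub>C (x * y)"
    and mult_scaleC_right: "x * (c *\<^sub>C y) = c *\<^sub>C (x * y)"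
    and star_add: "star (x + y) = star x + star y"
    and star_scaleC: "star (c *\<^sub>C x) = cnj c *\<^sub>C star x"
    and star_mult: "star (x * y) = star y * star x"
    and star_star: "star (star x) = x"

text \<open>The axiom \<open>0 \<noteq> 1\<close> is not imposed, so the zero algebra is allowed here.
  An algebra carrying a state is automatically nonzero.\<close>

class cstar_algebra = star_algebra + real_normed_algebra + banach +
  assumes scaleR_scaleC: "r *\<^sub>R x = complex_of_real r *\<^sub>C x"
    and norm_scaleC: "norm (c *\<^sub>C x) = cmod c * norm x"
    and cstar_identity: "norm (star x * x) = (norm x)\<^sup>2"

global_interpretation complex_vector: vector_space "scaleC :: complex \<Rightarrow> 'a \<Rightarrow> 'a :: star_algebra"
  by unfold_locales (simp_all add: scaleC_add_right scaleC_add_left scaleC_scaleC scaleC_one)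

abbreviation clinear :: "('a::star_algebra \<Rightarrow> 'b::star_algebra) \<Rightarrow> bool"
  where "clinear \<equiv> Vector_Spaces.linear scaleC scaleC"

definition cbilinear :: "('a::star_algebra \<Rightarrow> 'b::star_algebra \<Rightarrow> 'c::star_algebra) \<Rightarrow> bool"
  where "cbilinear \<beta> \<longleftrightarrow> (\<forall>a. clinear (\<beta> a)) \<and> (\<forall>b. clinear (\<lambda>a. \<beta> a b))"

definition unital_star_hom :: "('a::star_algebra \<Rightarrow> 'b::star_algebra) \<Rightarrow> bool"
  where "unital_star_hom f \<longleftrightarrow> clinear f \<and> (\<forall>x y. f (x * y) = f x * f y)
    \<and> (\<forall>x. f (star x) = star (f x)) \<and> f 1 = 1"

instantiation complex :: cstar_algebra
begin

definition scaleC_complex :: "complex \<Rightarrow> complex \<Rightarrow> complex" where "scaleC_complex = (*)"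
definition star_complex :: "complex \<Rightarrow> complex" where "star_complex = cnj"

instance
  by standard
    (simp_all add: scaleC_complex_def star_complex_def algebra_simps norm_mult power2_eq_square scaleR_conv_of_real)

end

text \<open>The library declares completeness of \<open>'x \<Rightarrow>\<^sub>C 'b\<close> only for metric domains; its proof
  works for every topological space.\<close>

instance bcontfun :: (topological_space, complete_space) complete_space
proof
  fix f :: "nat \<Rightarrow> ('a, 'b) bcontfun"
  assume "Cauchy f"
  then obtain g where "uniform_limit UNIV f g sequentially"
    using uniformly_convergent_eq_cauchy[of "\<lambda>_. True" f]
    unfolding Cauchy_def uniform_limit_sequentially_iff
    by (metis dist_fun_lt_imp_dist_val_lt)
  from uniform_limit_bcontfunE[OF this sequentially_bot]
  obtain l' where "g = apply_bcontfun l'" "(f \<longlonglongrightarrow> l')" by metis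
  then show "convergent f"
    by (intro convergentI)
qed

instance bcontfun :: (topological_space, banach) banach ..

lemma star_zero [simp]: "star (0::'a::star_algebra) = 0"
  using star_add[of "0::'a" 0] by simp

lemma star_one [simp]: "star (1::'a::star_algebra) = 1"
  by (metis mult_1 mult.right_neutral star_mult star_star)

lemma star_minus [simp]: "star (- x) = - star (x::'a::star_algebra)"
  by (metis add_eq_0_iff star_add star_zero)

lemma star_diff: "star (x - y) = star x - star (y::'a::star_algebra)"
  using star_add[of x "- y"] by simp

lemma norm_star [simp]: "norm (star x) = norm (x::'a::cstar_algebra)"
proof -
  have le: "norm y \<le> norm (star y)" for y :: 'a
  proof (cases "norm y = 0")
    case False
    have "norm y * norm y \<le> norm (star y) * norm y"
      using norm_mult_ineq[of "star y" y] by (simp add: cstar_identity power2_eq_square)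
    then show ?thesis using False by simp
  qed simp
  show ?thesis using le[of x] le[of "star x"] by (simp add: star_star)
qed

lemma bounded_linear_scaleC: "bounded_linear (\<lambda>x::'a::cstar_algebra. c *\<^sub>C x)"
  by (rule bounded_linear_intro[of _ "cmod c"])
     (simp_all add: scaleC_add_right scaleR_scaleC scaleC_scaleC norm_scaleC mult.commute)

lemma bounded_linear_star: "bounded_linear (star :: 'a::cstar_algebra \<Rightarrow> 'a)"
  by (rule bounded_linear_intro[of _ 1]) (simp_all add: star_add scaleR_scaleC star_scaleC)

lemma bcontfun_bounded_linear:
  assumes "bounded_linear T" "f \<in> bcontfun"
  shows "(\<lambda>x. T (f x)) \<in> bcontfun"
proof -
  have "continuous_on UNIV (\<lambda>x. T (f x))"
    using assms by (intro bounded_linear.continuous_on[OF assms(1)]) (simp add: bcontfun_def)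
  moreover have "bounded (T ` range f)"
    using assms by (intro bounded_linear_image) (simp_all add: bcontfun_def)
  ultimately show ?thesis by (simp add: bcontfun_def image_image)
qed

unbundle bcontfun.lifting

instantiation bcontfun :: (topological_space, cstar_algebra) cstar_algebra
begin

lift_definition one_bcontfun :: "'a \<Rightarrow>\<^sub>C 'b" is "\<lambda>_. 1"
  by (rule const_bcontfun)

lift_definition times_bcontfun :: "('a \<Rightarrow>\<^sub>C 'b) \<Rightarrow> ('a \<Rightarrow>\<^sub>C 'b) \<Rightarrow> 'a \<Rightarrow>\<^sub>C 'b"
  is "\<lambda>f g x. f x * g x"
proof -
  fix f g :: "'a \<Rightarrow> 'b"
  assume "f \<in> bcontfun" "g \<in> bcontfun"
  then obtain B C where "continuous_on UNIV f" "continuous_on UNIV g"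
    "\<And>x. norm (f x) \<le> B" "\<And>x. norm (g x) \<le> C"
    by (auto simp: bcontfun_def bounded_iff)
  then show "(\<lambda>x. f x * g x) \<in> bcontfun"
    by (intro bcontfun_normI[where b = "B * C"] continuous_intros)
       (auto intro!: order_trans[OF norm_mult_ineq] mult_mono intro: order_trans[OF norm_ge_zero])
qed

lift_definition scaleC_bcontfun :: "complex \<Rightarrow> ('a \<Rightarrow>\<^sub>C 'b) \<Rightarrow> 'a \<Rightarrow>\<^sub>C 'b"
  is "\<lambda>c f x. c *\<^sub>C f x"
  by (rule bcontfun_bounded_linear[OF bounded_linear_scaleC])

lift_definition star_bcontfun :: "('a \<Rightarrow>\<^sub>C 'b) \<Rightarrow> 'a \<Rightarrow>\<^sub>C 'b" is "\<lambda>f x. star (f x)"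
  by (rule bcontfun_bounded_linear[OF bounded_linear_star])

lemmas [simp] = one_bcontfun.rep_eq times_bcontfun.rep_eq scaleC_bcontfun.rep_eq star_bcontfun.rep_eq

instance
proof
  fix f g h :: "'a \<Rightarrow>\<^sub>C 'b" and c d :: complex and r :: real
  show "norm (f * g) \<le> norm f * norm g"
    by (rule norm_bound) (auto intro!: order_trans[OF norm_mult_ineq] mult_mono norm_bounded)
  show "norm (c *\<^sub>C f) = cmod c * norm f"
  proof (cases "c = 0")
    case False
    have le: "norm (c *\<^sub>C f) \<le> cmod c * norm f" for c and f :: "'a \<Rightarrow>\<^sub>C 'b"
      by (rule norm_bound) (simp add: norm_scaleC mult_left_mono norm_bounded)
    have "inverse c *\<^sub>C c *\<^sub>C f = f"
      using False by (auto intro!: bcontfun_eqI simp: scaleC_scaleC scaleC_one)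
    then have "norm f \<le> cmod (inverse c) * norm (c *\<^sub>C f)"
      using le[of "inverse c" "c *\<^sub>C f"] by simp
    with False have "cmod c * norm f \<le> norm (c *\<^sub>C f)"
      by (simp add: norm_divide field_simps)
    with le[of c f] show ?thesis by simp
  next
    case True
    then have "c *\<^sub>C f = 0" by (auto intro!: bcontfun_eqI)
    then show ?thesis using True by simp
  qed
  show "norm (star f * f) = (norm f)\<^sup>2"
  proof (rule antisym)
    show "norm (star f * f) \<le> (norm f)\<^sup>2"
      by (rule norm_bound) (simp add: cstar_identity norm_bounded power_mono)
    have "norm f \<le> sqrt (norm (star f * f))"
    proof (rule norm_bound)
      fix x
      have "(norm (apply_bcontfun f x))\<^sup>2 \<le> norm (star f * f)"
        using norm_bounded[of "star f * f" x] by (simp add: cstar_identity)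
      then show "norm (apply_bcontfun f x) \<le> sqrt (norm (star f * f))"
        by (simp add: real_le_rsqrt)
    qed
    then show "(norm f)\<^sup>2 \<le> norm (star f * f)"
      by (metis norm_ge_zero power_mono real_sqrt_pow2)
  qed
qed (auto intro!: bcontfun_eqI simp: algebra_simps mult_scaleC_left mult_scaleC_right
    scaleC_add_right scaleC_add_left scaleC_scaleC scaleC_one star_add star_scaleC star_mult star_star scaleR_scaleC)

end

lifting_update bcontfun.lifting
lifting_forget bcontfun.lifting

section \<open>Positive functionals\<close>

definition positive_functional :: "('a::star_algebra \<Rightarrow> complex) \<Rightarrow> bool"
  where "positive_functional \<phi> \<longleftrightarrow> clinear \<phi> \<and> (\<forall>a. \<phi> (star a * a) \<in> \<real>\<^sub>\<ge>\<^sub>0)"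

definition state :: "('a::cstar_algebra \<Rightarrow> complex) \<Rightarrow> bool"
  where "state \<phi> \<longleftrightarrow> positive_functional \<phi> \<and> (\<forall>a. cmod (\<phi> a) \<le> norm a) \<and> \<phi> 1 = 1"

lemma clinearI:
  assumes "\<And>x y. f (x + y) = f x + f y" "\<And>c x. f (c *\<^sub>C x) = c *\<^sub>C f x"
  shows "clinear (f :: 'a::star_algebra \<Rightarrow> 'b::star_algebra)"
  using assms by unfold_locales auto

lemma
  assumes "clinear (f :: 'a::star_algebra \<Rightarrow> 'b::star_algebra)"
  shows clinear_add: "f (x + y) = f x + f y"
    and clinear_scaleC: "f (c *\<^sub>C x) = c *\<^sub>C f x"
    and clinear_zero: "f 0 = 0"
    and clinear_minus: "f (- x) = - f x"
    and clinear_diff: "f (x - y) = f x - f y"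
proof -
  interpret Vector_Spaces.linear scaleC scaleC f by fact
  show "f (x + y) = f x + f y" "f (c *\<^sub>C x) = c *\<^sub>C f x" "f 0 = 0" "f (- x) = - f x" "f (x - y) = f x - f y"
    by (simp_all add: add scale neg diff)
qed

lemmas clinear_simps = clinear_add clinear_scaleC clinear_zero clinear_minus clinear_diff
lemmas star_simps = star_add star_scaleC star_mult star_star star_diff
lemmas scaleC_simps = scaleC_add_right scaleC_add_left scaleC_scaleC mult_scaleC_left mult_scaleC_right

text \<open>\<open>fnorm \<omega> x\<close> is the norm of the class of \<open>x\<close> in the GNS space of \<open>\<omega>\<close>.\<close>

definition fnorm :: "('a::star_algebra \<Rightarrow> complex) \<Rightarrow> 'a \<Rightarrow> real"
  where "fnorm \<omega> x = sqrt (Re (\<omega> (star x * x)))"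

context
  fixes \<omega> :: "'a::star_algebra \<Rightarrow> complex"
  assumes pos: "positive_functional \<omega>"
begin

lemma pos_clinear: "clinear \<omega>"
  using pos by (simp add: positive_functional_def)

lemma pos_real: "Im (\<omega> (star x * x)) = 0" "0 \<le> Re (\<omega> (star x * x))"
  using pos by (auto simp: positive_functional_def complex_nonneg_Reals_iff)

lemma pos_herm: "\<omega> (star y * x) = cnj (\<omega> (star x * y))"
proof -
  note lin = clinear_simps[OF pos_clinear]
  have 1: "Im (\<omega> (star x * y)) + Im (\<omega> (star y * x)) = 0"
    using pos_real(1)[of "x + y"] pos_real(1)[of x] pos_real(1)[of y]
    by (simp add: star_simps algebra_simps lin)
  have 2: "Re (\<omega> (star x * y)) - Re (\<omega> (star y * x)) = 0"
    using pos_real(1)[of "x + \<i> *\<^sub>C y"] pos_real(1)[of x] pos_real(1)[of y]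
    by (simp add: star_simps algebra_simps scaleC_simps lin scaleC_complex_def)
  show ?thesis using 1 2 by (simp add: complex_eq_iff)
qed

lemma fnorm_nonneg [simp]: "0 \<le> fnorm \<omega> x"
  using pos_real by (simp add: fnorm_def)

lemma fnorm_sq: "(fnorm \<omega> x)\<^sup>2 = Re (\<omega> (star x * x))"
  using pos_real by (simp add: fnorm_def)

lemma fnorm_sq_complex: "complex_of_real ((fnorm \<omega> x)\<^sup>2) = \<omega> (star x * x)"
  using pos_real by (simp add: fnorm_sq complex_eq_iff)

lemma fnorm_scaleC: "fnorm \<omega> (c *\<^sub>C x) = cmod c * fnorm \<omega> x"
proof -
  have "\<omega> (star (c *\<^sub>C x) * (c *\<^sub>C x)) = complex_of_real ((cmod c)\<^sup>2) * \<omega> (star x * x)"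
    by (simp add: star_simps scaleC_simps clinear_simps[OF pos_clinear] scaleC_complex_def
        complex_norm_square mult.commute del: of_real_power)
  then have "(fnorm \<omega> (c *\<^sub>C x))\<^sup>2 = (cmod c * fnorm \<omega> x)\<^sup>2"
    by (simp add: fnorm_sq power_mult_distrib del: of_real_power)
  then show ?thesis by (simp add: power2_eq_iff_nonneg)
qed

lemma Cauchy_Schwarz: "cmod (\<omega> (star x * y)) \<le> fnorm \<omega> x * fnorm \<omega> y"
proof -
  note lin = clinear_simps[OF pos_clinear]
  define z where "z = \<omega> (star x * y)"
  have expand: "0 \<le> (fnorm \<omega> y)\<^sup>2 - 2 * t * (cmod z)\<^sup>2 + t\<^sup>2 * (cmod z)\<^sup>2 * (fnorm \<omega> x)\<^sup>2" for t :: real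
  proof -
    define k where "k = complex_of_real t * z"
    have zz: "\<omega> (star y * x) = cnj z" by (simp add: z_def pos_herm[of y x])
    have "\<omega> (star (y - k *\<^sub>C x) * (y - k *\<^sub>C x))
        = \<omega> (star y * y) - k * cnj z - cnj k * z + cnj k * k * \<omega> (star x * x)"
      by (simp add: star_simps left_diff_distrib right_diff_distrib scaleC_simps lin scaleC_complex_def zz
          complex_vector.scale_right_diff_distrib)
         (simp add: z_def)
    then have "Re (\<omega> (star (y - k *\<^sub>C x) * (y - k *\<^sub>C x))) = Re (complex_of_real ((fnorm \<omega> y)\<^sup>2) - k * cnj z - cnj k * z + cnj k * k * complex_of_real ((fnorm \<omega> x)\<^sup>2))"
      by (simp only: fnorm_sq_complex)
    also have "\<dots> = (fnorm \<omega> y)\<^sup>2 - 2 * t * (cmod z)\<^sup>2 + t\<^sup>2 * (cmod z)\<^sup>2 * (fnorm \<omega> x)\<^sup>2"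
      unfolding cmod_power2 k_def by (simp add: power2_eq_square algebra_simps)
    finally show ?thesis by (metis fnorm_sq zero_le_power2)
  qed
  have "(cmod z)\<^sup>2 \<le> (fnorm \<omega> x)\<^sup>2 * (fnorm \<omega> y)\<^sup>2"
  proof (cases "cmod z = 0")
    case False
    define a where "a = (fnorm \<omega> x)\<^sup>2"
    define m where "m = (cmod z)\<^sup>2"
    define b where "b = (fnorm \<omega> y)\<^sup>2"
    have m: "m > 0" and ab: "a \<ge> 0" "b \<ge> 0" using False by (auto simp: m_def a_def b_def)
    have e: "0 \<le> b - 2 * t * m + t\<^sup>2 * m * a" for t
      using expand[of t] by (simp add: m_def a_def b_def)
    have "a \<noteq> 0"
    proof
      assume "a = 0"
      then have "0 \<le> b - 2 * ((b + 1) / (2 * m)) * m" using e[of "(b+1) / (2*m)"] by simp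
      then show False using m by simp
    qed
    then have a: "a > 0" using ab by simp
    have "0 \<le> b - 2 * (1 / a) * m + (1/a)\<^sup>2 * m * a" by (rule e)
    then have "0 \<le> b - m / a" using a by (simp add: power2_eq_square)
    then have "m \<le> a * b" using a by (simp add: field_simps)
    then show ?thesis by (simp add: m_def a_def b_def)
  qed simp
  then have "(cmod z)\<^sup>2 \<le> (fnorm \<omega> x * fnorm \<omega> y)\<^sup>2" by (simp add: power_mult_distrib)
  then show ?thesis unfolding z_def by (rule power2_le_imp_le) simp
qed

lemma fnorm_triangle: "fnorm \<omega> (x + y) \<le> fnorm \<omega> x + fnorm \<omega> y"
proof -
  have "Re (\<omega> (star x * y)) \<le> fnorm \<omega> x * fnorm \<omega> y"
    "Re (\<omega> (star y * x)) \<le> fnorm \<omega> x * fnorm \<omega> y"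
    using Cauchy_Schwarz[of x y] Cauchy_Schwarz[of y x] complex_Re_le_cmod order_trans
    by (fastforce simp: mult.commute)+
  then have "(fnorm \<omega> (x + y))\<^sup>2 \<le> (fnorm \<omega> x + fnorm \<omega> y)\<^sup>2"
    by (simp add: fnorm_sq star_simps algebra_simps clinear_simps[OF pos_clinear] power2_sum)
  then show ?thesis by (rule power2_le_imp_le) simp
qed

end

section \<open>The algebraic tensor product\<close>

text \<open>A list \<open>[(a\<^sub>1,b\<^sub>1), \<dots>, (a\<^sub>n,b\<^sub>n)]\<close> stands for \<open>a\<^sub>1 \<otimes> b\<^sub>1 + \<dots> + a\<^sub>n \<otimes> b\<^sub>n\<close>;
  two lists represent the same element of the algebraic tensor product iff no bilinear form separates them.\<close>

definition lsum :: "('a \<Rightarrow> 'b \<Rightarrow> 'c::monoid_add) \<Rightarrow> ('a \<times> 'b) list \<Rightarrow> 'c"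
  where "lsum \<beta> xs = (\<Sum>(a, b)\<leftarrow>xs. \<beta> a b)"

definition alg_eq :: "('a::star_algebra \<times> 'b::star_algebra) list \<Rightarrow> ('a \<times> 'b) list \<Rightarrow> bool"
  where "alg_eq xs ys \<longleftrightarrow> (\<forall>\<beta> :: 'a \<Rightarrow> 'b \<Rightarrow> complex. cbilinear \<beta> \<longrightarrow> lsum \<beta> xs = lsum \<beta> ys)"

definition lmul :: "('a::star_algebra \<times> 'b::star_algebra) list \<Rightarrow> ('a \<times> 'b) list \<Rightarrow> ('a \<times> 'b) list"
  where "lmul xs ys = concat (map (\<lambda>(a, b). map (\<lambda>(c, d). (a * c, b * d)) ys) xs)"

lemma lsum_simps [simp]:
  "lsum \<beta> [] = 0"
  "lsum \<beta> ((a, b) # xs) = \<beta> a b + lsum \<beta> xs"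
  "lsum \<beta> (xs @ ys) = lsum \<beta> xs + lsum \<beta> ys"
  by (simp_all add: lsum_def)

lemma lsum_map: "lsum \<beta> (map (\<lambda>(a, b). (f a, g b)) xs) = lsum (\<lambda>a b. \<beta> (f a) (g b)) xs"
  by (induction xs) auto

lemma lsum_lmul: "lsum \<beta> (lmul xs ys) = lsum (\<lambda>a b. lsum (\<lambda>c d. \<beta> (a * c) (b * d)) ys) xs"
  by (induction xs) (auto simp: lmul_def lsum_map)

lemma lsum_zero [simp]: "lsum (\<lambda>a b. 0) xs = 0"
  by (induction xs) auto

lemma lsum_add: "lsum (\<lambda>a b. f a b + g a b) xs = lsum f xs + (lsum g xs :: 'c::comm_monoid_add)"
  by (induction xs) (auto simp: algebra_simps)

lemma lsum_uminus: "lsum (\<lambda>a b. - f a b) xs = - (lsum f xs :: 'c::ab_group_add)"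
  by (induction xs) auto

lemma lsum_scaleC: "lsum (\<lambda>a b. c *\<^sub>C f a b) xs = c *\<^sub>C (lsum f xs :: 'c::star_algebra)"
  by (induction xs) (auto simp: scaleC_add_right)

lemma lsum_mult: "lsum (\<lambda>a b. c * f a b) xs = (c::'c::ring) * lsum f xs"
  by (induction xs) (auto simp: distrib_left)

lemma lsum_cnj: "lsum (\<lambda>a b. cnj (f a b)) xs = cnj (lsum f xs)"
  by (induction xs) auto

lemma lsum_swap: "lsum (\<lambda>a b. lsum (f a b) ys) xs = lsum (\<lambda>c d. lsum (\<lambda>a b. f a b c d) xs) ys"
  for f :: "'a \<Rightarrow> 'b \<Rightarrow> 'c \<Rightarrow> 'd \<Rightarrow> 'e::comm_monoid_add"
proof (induction xs)
  case (Cons x xs)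
  then show ?case by (cases x) (simp add: lsum_add)
qed simp

lemma cbilinearI:
  assumes "\<And>a b c. \<beta> (a + b) c = \<beta> a c + \<beta> b c" "\<And>k a c. \<beta> (k *\<^sub>C a) c = k *\<^sub>C \<beta> a c"
    "\<And>a b c. \<beta> a (b + c) = \<beta> a b + \<beta> a c" "\<And>k a c. \<beta> a (k *\<^sub>C c) = k *\<^sub>C \<beta> a c"
  shows "cbilinear \<beta>"
  using assms by (auto simp: cbilinear_def intro!: clinearI)

lemma
  assumes "cbilinear \<beta>"
  shows cbilinear_add_left: "\<beta> (a + a') c = \<beta> a c + \<beta> a' c"
    and cbilinear_scaleC_left: "\<beta> (k *\<^sub>C a) c = k *\<^sub>C \<beta> a c"
    and cbilinear_add_right: "\<beta> a (c + c') = \<beta> a c + \<beta> a c'"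
    and cbilinear_scaleC_right: "\<beta> a (k *\<^sub>C c) = k *\<^sub>C \<beta> a c"
    and cbilinear_minus_left: "\<beta> (- a) c = - \<beta> a c"
  using assms clinear_simps[of "\<beta> a"] clinear_simps[of "\<lambda>a. \<beta> a c"]
  by (auto simp: cbilinear_def)

lemmas cbilinear_simps = cbilinear_add_left cbilinear_add_right cbilinear_scaleC_left cbilinear_scaleC_right
  cbilinear_minus_left

quotient_type (overloaded) ('a, 'b) alg_tensor = "('a::star_algebra \<times> 'b::star_algebra) list" / alg_eq
  by (rule equivpI) (auto simp: reflp_def symp_def transp_def alg_eq_def)

lemma alg_eq_lmul:
  assumes "alg_eq xs xs'" "alg_eq ys ys'"
  shows "alg_eq (lmul xs ys) (lmul xs' ys')"
  unfolding alg_eq_def lsum_lmul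
proof safe
  fix \<beta> :: "'a \<Rightarrow> 'b \<Rightarrow> complex"
  assume \<beta>: "cbilinear \<beta>"
  have "cbilinear (\<lambda>c d. \<beta> (a * c) (b * d))" for a b
    by (rule cbilinearI) (simp_all add: distrib_left mult_scaleC_right cbilinear_simps[OF \<beta>])
  then have "lsum (\<lambda>a b. lsum (\<lambda>c d. \<beta> (a * c) (b * d)) ys) xs
      = lsum (\<lambda>a b. lsum (\<lambda>c d. \<beta> (a * c) (b * d)) ys') xs"
    using assms(2) by (simp add: alg_eq_def)
  also have "cbilinear (\<lambda>a b. lsum (\<lambda>c d. \<beta> (a * c) (b * d)) ys')"
    by (rule cbilinearI)
       (simp_all add: distrib_right mult_scaleC_left cbilinear_simps[OF \<beta>] lsum_add lsum_scaleC)
  then have "lsum (\<lambda>a b. lsum (\<lambda>c d. \<beta> (a * c) (b * d)) ys') xs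
      = lsum (\<lambda>a b. lsum (\<lambda>c d. \<beta> (a * c) (b * d)) ys') xs'"
    using assms(1) by (simp add: alg_eq_def)
  finally show "lsum (\<lambda>a b. lsum (\<lambda>c d. \<beta> (a * c) (b * d)) ys) xs
      = lsum (\<lambda>a b. lsum (\<lambda>c d. \<beta> (a * c) (b * d)) ys') xs'" .
qed

lemma alg_eq_star:
  assumes "alg_eq xs ys"
  shows "alg_eq (map (\<lambda>(a, b). (star a, star b)) xs) (map (\<lambda>(a, b). (star a, star b)) ys)"
  unfolding alg_eq_def lsum_map
proof safe
  fix \<beta> :: "'a \<Rightarrow> 'b \<Rightarrow> complex"
  assume \<beta>: "cbilinear \<beta>"
  have "cbilinear (\<lambda>a b. cnj (\<beta> (star a) (star b)))"
    by (rule cbilinearI) (simp_all add: star_simps cbilinear_simps[OF \<beta>] scaleC_complex_def)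
  then have "lsum (\<lambda>a b. cnj (\<beta> (star a) (star b))) xs = lsum (\<lambda>a b. cnj (\<beta> (star a) (star b))) ys"
    using assms by (simp add: alg_eq_def)
  then show "lsum (\<lambda>a b. \<beta> (star a) (star b)) xs = lsum (\<lambda>a b. \<beta> (star a) (star b)) ys"
    by (simp add: lsum_cnj)
qed

lemma alg_eq_lin:
  assumes "alg_eq xs ys" "clinear f"
  shows "alg_eq (map (\<lambda>(a, b). (f a, id b)) xs) (map (\<lambda>(a, b). (f a, id b)) ys)"
  unfolding alg_eq_def lsum_map
proof safe
  fix \<beta> :: "'c \<Rightarrow> 'b \<Rightarrow> complex"
  assume \<beta>: "cbilinear \<beta>"
  have "cbilinear (\<lambda>a b. \<beta> (f a) (id b))"
    by (rule cbilinearI) (simp_all add: clinear_simps[OF assms(2)] cbilinear_simps[OF \<beta>])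
  then show "lsum (\<lambda>a b. \<beta> (f a) (id b)) xs = lsum (\<lambda>a b. \<beta> (f a) (id b)) ys"
    using assms(1) by (simp add: alg_eq_def)
qed

instantiation alg_tensor :: (star_algebra, star_algebra) star_algebra
begin

lift_definition zero_alg_tensor :: "('a, 'b) alg_tensor" is "[]" .

lift_definition one_alg_tensor :: "('a, 'b) alg_tensor" is "[(1, 1)]" .

lift_definition plus_alg_tensor :: "('a, 'b) alg_tensor \<Rightarrow> ('a, 'b) alg_tensor \<Rightarrow> ('a, 'b) alg_tensor"
  is append by (simp add: alg_eq_def)

lift_definition scaleC_alg_tensor :: "complex \<Rightarrow> ('a, 'b) alg_tensor \<Rightarrow> ('a, 'b) alg_tensor"
  is "\<lambda>k. map (\<lambda>(a, b). (k *\<^sub>C a, id b))"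
  by (rule alg_eq_lin) (auto intro!: clinearI simp: scaleC_simps mult.commute)

lift_definition uminus_alg_tensor :: "('a, 'b) alg_tensor \<Rightarrow> ('a, 'b) alg_tensor"
  is "map (\<lambda>(a, b). (- a, id b))"
  by (rule alg_eq_lin) (auto intro!: clinearI)

definition minus_alg_tensor :: "('a, 'b) alg_tensor \<Rightarrow> ('a, 'b) alg_tensor \<Rightarrow> ('a, 'b) alg_tensor"
  where "minus_alg_tensor x y = x + (- y)"

lift_definition times_alg_tensor :: "('a, 'b) alg_tensor \<Rightarrow> ('a, 'b) alg_tensor \<Rightarrow> ('a, 'b) alg_tensor"
  is lmul by (rule alg_eq_lmul)

lift_definition star_alg_tensor :: "('a, 'b) alg_tensor \<Rightarrow> ('a, 'b) alg_tensor"
  is "map (\<lambda>(a, b). (star a, star b))" by (rule alg_eq_star)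

instance
proof
  fix x y z :: "('a, 'b) alg_tensor" and c d :: complex
  show "x + y + z = x + (y + z)" by transfer (simp add: alg_eq_def)
  show "x + y = y + x" by transfer (simp add: alg_eq_def)
  show "0 + x = x" by transfer (simp add: alg_eq_def)
  show "- x + x = 0" by transfer (simp add: alg_eq_def lsum_map cbilinear_simps lsum_uminus)
  show "x - y = x + - y" by (simp add: minus_alg_tensor_def)
  show "x * y * z = x * (y * z)" by transfer (simp add: alg_eq_def lsum_lmul mult.assoc)
  show "1 * x = x" by transfer (simp add: alg_eq_def lsum_lmul)
  show "x * 1 = x" by transfer (simp add: alg_eq_def lsum_lmul)
  show "(x + y) * z = x * z + y * z" by transfer (simp add: alg_eq_def lsum_lmul)
  show "x * (y + z) = x * y + x * z" by transfer (simp add: alg_eq_def lsum_lmul lsum_add)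
  show "c *\<^sub>C (x + y) = c *\<^sub>C x + c *\<^sub>C y" by transfer (simp add: alg_eq_def)
  show "(c + d) *\<^sub>C x = c *\<^sub>C x + d *\<^sub>C x"
    by transfer (simp add: alg_eq_def lsum_map scaleC_add_left cbilinear_simps lsum_add)
  show "c *\<^sub>C d *\<^sub>C x = (c * d) *\<^sub>C x"
    by transfer (simp add: alg_eq_def lsum_map scaleC_scaleC del: map_map)
  show "1 *\<^sub>C x = x" by transfer (simp add: alg_eq_def lsum_map scaleC_one)
  show "(c *\<^sub>C x) * y = c *\<^sub>C (x * y)"
    by transfer (simp add: alg_eq_def lsum_lmul lsum_map mult_scaleC_left)
  show "x * (c *\<^sub>C y) = c *\<^sub>C (x * y)"
    by transfer (simp add: alg_eq_def lsum_lmul lsum_map mult_scaleC_right)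
  show "star (x + y) = star x + star y" by transfer (simp add: alg_eq_def)
  show "star (c *\<^sub>C x) = cnj c *\<^sub>C star x"
    by transfer (simp add: alg_eq_def lsum_map star_scaleC del: map_map)
  show "star (x * y) = star y * star x"
    by transfer (auto simp add: alg_eq_def lsum_lmul lsum_map star_mult intro: lsum_swap)
  show "star (star x) = x" by transfer (simp add: alg_eq_def lsum_map star_star del: map_map)
qed

end

lift_definition simple_tensor :: "'a::star_algebra \<Rightarrow> 'b::star_algebra \<Rightarrow> ('a, 'b) alg_tensor"
  is "\<lambda>a b. [(a, b)]" .

lift_definition alg_lift :: "('a::star_algebra \<Rightarrow> 'b::star_algebra \<Rightarrow> complex) \<Rightarrow> ('a, 'b) alg_tensor \<Rightarrow> complex"
  is "\<lambda>\<beta> xs. if cbilinear \<beta> then lsum \<beta> xs else 0"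
  by (simp add: alg_eq_def)

text \<open>The functional \<open>\<phi> \<odot> \<psi>\<close> on the algebraic tensor product.\<close>

definition prod_functional ::
  "('a::star_algebra \<Rightarrow> complex) \<Rightarrow> ('b::star_algebra \<Rightarrow> complex) \<Rightarrow> ('a, 'b) alg_tensor \<Rightarrow> complex"
  where "prod_functional \<phi> \<psi> = alg_lift (\<lambda>a b. \<phi> a * \<psi> b)"

lemma simple_tensor_sum: "\<exists>xs. t = lsum simple_tensor xs"
proof -
  have "abs_alg_tensor xs = lsum simple_tensor xs" for xs :: "('a \<times> 'b) list"
  proof (induction xs)
    case Nil
    show ?case by (simp add: zero_alg_tensor_def)
  next
    case (Cons x xs)
    obtain a b where x: "x = (a, b)" by fastforce
    have "abs_alg_tensor (x # xs) = abs_alg_tensor [x] + abs_alg_tensor xs"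
      by (simp add: plus_alg_tensor.abs_eq)
    then show ?case by (simp add: x Cons simple_tensor.abs_eq)
  qed
  then show ?thesis by (metis Quotient_abs_rep[OF Quotient_alg_tensor])
qed

lemma alg_tensor_induct [case_names zero add]:
  assumes "P 0" "\<And>a b t. P t \<Longrightarrow> P (simple_tensor a b + t)"
  shows "P t"
proof -
  obtain xs where "t = lsum simple_tensor xs" using simple_tensor_sum by blast
  moreover have "P (lsum simple_tensor xs)"
    by (induction xs) (use assms in auto)
  ultimately show ?thesis by simp
qed

lemma alg_eqI:
  assumes "\<And>\<beta>. cbilinear \<beta> \<Longrightarrow> alg_lift \<beta> s = alg_lift \<beta> t"
  shows "s = t"
  using assms by transfer (auto simp: alg_eq_def)

lemma simple_tensor_simps:
  "simple_tensor a b * simple_tensor c d = simple_tensor (a * c) (b * d)"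
  "star (simple_tensor a b) = simple_tensor (star a) (star b)"
  "k *\<^sub>C simple_tensor a b = simple_tensor (k *\<^sub>C a) b"
  "simple_tensor (a + a') b = simple_tensor a b + simple_tensor a' b"
  "simple_tensor a (b + b') = simple_tensor a b + simple_tensor a b'"
  "simple_tensor a (k *\<^sub>C b) = simple_tensor (k *\<^sub>C a) b"
  "1 = simple_tensor 1 1"
proof -
  show "simple_tensor a b * simple_tensor c d = simple_tensor (a * c) (b * d)"
    by transfer (simp add: alg_eq_def lsum_lmul)
  show "star (simple_tensor a b) = simple_tensor (star a) (star b)"
    by transfer (simp add: alg_eq_def)
  show "k *\<^sub>C simple_tensor a b = simple_tensor (k *\<^sub>C a) b"
    by transfer (simp add: alg_eq_def)
  show "simple_tensor (a + a') b = simple_tensor a b + simple_tensor a' b"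
    by transfer (simp add: alg_eq_def cbilinear_simps)
  show "simple_tensor a (b + b') = simple_tensor a b + simple_tensor a b'"
    by transfer (simp add: alg_eq_def cbilinear_simps)
  show "simple_tensor a (k *\<^sub>C b) = simple_tensor (k *\<^sub>C a) b"
    by transfer (simp add: alg_eq_def cbilinear_simps)
  show "1 = simple_tensor 1 1"
    by transfer (simp add: alg_eq_def)
qed

lemma cbilinear_simple_tensor: "cbilinear simple_tensor"
  by (rule cbilinearI) (simp_all add: simple_tensor_simps)

lemma clinear_alg_lift: "clinear (alg_lift \<beta>)"
proof (rule clinearI)
  show "alg_lift \<beta> (x + y) = alg_lift \<beta> x + alg_lift \<beta> y" for x y
    by transfer simp
  show "alg_lift \<beta> (c *\<^sub>C x) = c *\<^sub>C alg_lift \<beta> x" for c x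
    by transfer (simp add: lsum_map cbilinear_simps lsum_scaleC)
qed

lemma alg_lift_simple [simp]: "cbilinear \<beta> \<Longrightarrow> alg_lift \<beta> (simple_tensor a b) = \<beta> a b"
  by transfer simp

lemma cbilinear_prod: "clinear \<phi> \<Longrightarrow> clinear \<psi> \<Longrightarrow> cbilinear (\<lambda>a b. \<phi> a * \<psi> b :: complex)"
  by (rule cbilinearI) (simp_all add: clinear_simps algebra_simps scaleC_complex_def)

lemma clinear_prod_functional: "clinear (prod_functional \<phi> \<psi>)"
  by (simp add: prod_functional_def clinear_alg_lift)

lemma prod_functional_simple:
  "clinear \<phi> \<Longrightarrow> clinear \<psi> \<Longrightarrow> prod_functional \<phi> \<psi> (simple_tensor a b) = \<phi> a * \<psi> b"
  by (simp add: prod_functional_def cbilinear_prod)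

lemma clinear_lsum: "clinear f \<Longrightarrow> f (lsum \<beta> xs) = lsum (\<lambda>a b. f (\<beta> a b)) xs"
  by (induction xs) (auto simp: clinear_simps)

text \<open>Positivity of \<open>\<phi> \<odot> \<psi>\<close>: orthogonalise the second legs with respect to \<open>\<psi>\<close>.\<close>

lemma positive_prod_functional:
  assumes "positive_functional \<phi>" "positive_functional \<psi>"
  shows "positive_functional (prod_functional \<phi> \<psi>)"
proof -
  define \<omega> where "\<omega> = prod_functional \<phi> \<psi>"
  have lin: "clinear \<phi>" "clinear \<psi>" using assms by (auto simp: positive_functional_def)
  have \<omega>: "clinear \<omega>" by (simp add: \<omega>_def clinear_prod_functional)
  have \<omega>_simple: "\<omega> (simple_tensor a b) = \<phi> a * \<psi> b" for a b
    by (simp add: \<omega>_def prod_functional_simple lin)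
  have "\<omega> (star t * t) \<in> \<real>\<^sub>\<ge>\<^sub>0" if "t = lsum simple_tensor xs" "length xs = n" for t n xs
    using that
  proof (induction n arbitrary: t xs)
    case 0
    then show ?case by (simp add: clinear_simps[OF \<omega>])
  next
    case (Suc n)
    then obtain a b xs' where xs: "xs = (a, b) # xs'" "length xs' = n"
      by (cases xs) auto
    define l where "l d = \<psi> (star b * d) / \<psi> (star b * b)" for d
    define u where "u = a + lsum (\<lambda>c d. l d *\<^sub>C c) xs'"
    define s where "s = lsum simple_tensor (map (\<lambda>(c, d). (id c, d - l d *\<^sub>C b)) xs')"
    have orth: "\<psi> (star b * (d - l d *\<^sub>C b)) = 0" for d
    proof (cases "\<psi> (star b * b) = 0")
      case True
      then have "fnorm \<psi> b = 0" by (simp add: fnorm_def)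
      then have "\<psi> (star b * d) = 0" using Cauchy_Schwarz[OF assms(2), of b d] by simp
      then show ?thesis by (simp add: l_def)
    next
      case False
      then show ?thesis
        by (simp add: l_def right_diff_distrib mult_scaleC_right clinear_simps[OF lin(2)] scaleC_complex_def)
    qed
    have "simple_tensor a b + lsum simple_tensor ys =
        simple_tensor (a + lsum (\<lambda>c d. l d *\<^sub>C c) ys) b
        + lsum simple_tensor (map (\<lambda>(c, d). (id c, d - l d *\<^sub>C b)) ys)" for ys :: "('a \<times> 'b) list"
    proof (induction ys)
      case (Cons y ys)
      obtain c d where y: "y = (c, d)" by fastforce
      have "simple_tensor c (d - l d *\<^sub>C b) + simple_tensor (l d *\<^sub>C c) b
          = simple_tensor c (d - l d *\<^sub>C b + l d *\<^sub>C b)"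
        by (simp only: simple_tensor_simps)
      then have "simple_tensor c d = simple_tensor c (d - l d *\<^sub>C b) + simple_tensor (l d *\<^sub>C c) b"
        by simp
      then show ?case using Cons by (simp add: y simple_tensor_simps algebra_simps)
    qed simp
    then have t: "t = simple_tensor u b + s"
      using Suc.prems xs by (simp add: u_def s_def)
    have us: "\<omega> (star (simple_tensor u b) * s) = 0"
      unfolding s_def lsum_map
      by (induction xs')
         (auto simp: simple_tensor_simps distrib_left clinear_simps[OF \<omega>] \<omega>_simple orth)
    have orth': "\<psi> (star (d - l d *\<^sub>C b) * b) = 0" for d
      using orth[of d] pos_herm[OF assms(2), of "d - l d *\<^sub>C b" b] by simp
    have "star s = lsum (\<lambda>c d. star (simple_tensor c (d - l d *\<^sub>C b))) xs'"
      unfolding s_def lsum_map by (induction xs') (auto simp: star_add)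
    moreover have "\<omega> (lsum (\<lambda>c d. star (simple_tensor c (d - l d *\<^sub>C b))) ys * simple_tensor u b) = 0" for ys
      by (induction ys)
         (auto simp: simple_tensor_simps distrib_right clinear_simps[OF \<omega>] \<omega>_simple orth')
    ultimately have su: "\<omega> (star s * simple_tensor u b) = 0" by simp
    have "\<omega> (star (simple_tensor u b) * simple_tensor u b) = \<phi> (star u * u) * \<psi> (star b * b)"
      by (simp add: simple_tensor_simps \<omega>_simple)
    moreover have "\<omega> (star s * s) \<in> \<real>\<^sub>\<ge>\<^sub>0"
      by (rule Suc.IH[OF s_def]) (simp add: xs)
    ultimately show ?case
      using assms unfolding t
      by (simp add: star_add distrib_left distrib_right clinear_simps[OF \<omega>] us su positive_functional_def
          nonneg_Reals_add_I nonneg_Reals_mult_I)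
  qed
  then show ?thesis
    using \<omega> simple_tensor_sum unfolding positive_functional_def \<omega>_def by metis
qed

section \<open>The spatial norm\<close>

text \<open>For states \<open>\<phi>\<close>, \<open>\<psi>\<close> with GNS representations \<open>\<pi>\<^sub>\<phi>\<close>, \<open>\<pi>\<^sub>\<psi>\<close> the supremum over all
  \<open>y\<close> of \<open>fnorm (prod_functional \<phi> \<psi>) (t * y)\<close> below is the operator norm of \<open>(\<pi>\<^sub>\<phi> \<otimes> \<pi>\<^sub>\<psi>)(t)\<close>.
  Hence \<open>spatial_norm t\<close> is the norm of \<open>t\<close> on the tensor product of the Hilbert spaces of the universal
  representations, i.e. the minimal C*-norm. (\<open>insert 0\<close> only matters if one of the algebras
  is zero and has no states.)\<close>

definition spatial_norm :: "('a::cstar_algebra, 'b::cstar_algebra) alg_tensor \<Rightarrow> real"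
  where "spatial_norm t = Sup (insert 0 {fnorm (prod_functional \<phi> \<psi>) (t * y) | \<phi> \<psi> y.
    state \<phi> \<and> state \<psi> \<and> fnorm (prod_functional \<phi> \<psi>) y \<le> 1})"

lemma positive_power_bound:
  fixes \<omega> :: "'a::star_algebra \<Rightarrow> complex"
  assumes pos: "positive_functional \<omega>" and u: "star u = u" and K: "0 \<le> K"
    and bnd: "\<And>n. cmod (\<omega> (star y * (u ^ n * y))) \<le> C * K ^ n"
  shows "cmod (\<omega> (star y * (u * y))) \<le> K * (fnorm \<omega> y)\<^sup>2"
proof -
  define g where "g n = cmod (\<omega> (star y * (u ^ n * y)))" for n
  define p where "p = (fnorm \<omega> y)\<^sup>2"
  have star_pow: "star (u ^ n) = u ^ n" for n
    by (induction n) (simp_all add: star_mult u power_commutes)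
  have sq: "(g n)\<^sup>2 \<le> p * g (2 * n)" for n
  proof -
    have "g n \<le> fnorm \<omega> y * fnorm \<omega> (u ^ n * y)"
      unfolding g_def by (rule Cauchy_Schwarz[OF pos])
    then have "(g n)\<^sup>2 \<le> (fnorm \<omega> y * fnorm \<omega> (u ^ n * y))\<^sup>2"
      by (rule power_mono) (simp add: g_def)
    also have "\<dots> = p * Re (\<omega> (star y * (u ^ (2 * n) * y)))"
      by (simp add: p_def power_mult_distrib fnorm_sq[OF pos, of "u ^ n * y"] star_mult star_pow
          mult.assoc mult_2 power_add)
    also have "\<dots> \<le> p * g (2 * n)"
      by (intro mult_left_mono) (simp_all add: g_def p_def complex_Re_le_cmod)
    finally show ?thesis .
  qed
  have "g 1 \<le> K * p"
  proof (cases "p = 0 \<or> K = 0")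
    case True
    then have "(g 1)\<^sup>2 \<le> 0"
      using sq[of 1] bnd[of 2] by (auto simp: g_def)
    then show ?thesis using K by (simp add: p_def)
  next
    case False
    then have pK: "0 < p" "0 < K" using K by (auto simp: p_def)
    define r where "r n = g (2 ^ n) / (p * K ^ (2 ^ n))" for n :: nat
    have r_nn: "0 \<le> r n" for n using pK by (simp add: r_def g_def)
    have r_sq: "(r n)\<^sup>2 \<le> r (Suc n)" for n
    proof -
      have "(r n)\<^sup>2 = (g (2 ^ n))\<^sup>2 / (p\<^sup>2 * K ^ (2 ^ Suc n))"
        by (simp add: r_def power_divide power_mult_distrib mult.commute flip: power_mult)
      also have "\<dots> \<le> (p * g (2 * 2 ^ n)) / (p\<^sup>2 * K ^ (2 ^ Suc n))"
        using pK by (intro divide_right_mono sq) auto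
      also have "\<dots> = r (Suc n)"
        using pK by (simp add: r_def power2_eq_square)
      finally show ?thesis .
    qed
    have r_pow: "r 0 ^ (2 ^ n) \<le> r n" for n
    proof (induction n)
      case (Suc n)
      have "r 0 ^ (2 ^ Suc n) = (r 0 ^ (2 ^ n))\<^sup>2"
        by (simp add: mult.commute flip: power_mult)
      also have "\<dots> \<le> (r n)\<^sup>2" using Suc r_nn by (intro power_mono) auto
      also have "\<dots> \<le> r (Suc n)" by (rule r_sq)
      finally show ?case .
    qed simp
    have r_bnd: "r n \<le> C / p" for n
    proof -
      have "r n \<le> (C * K ^ (2 ^ n)) / (p * K ^ (2 ^ n))"
        unfolding r_def g_def using pK by (intro divide_right_mono bnd) auto
      then show ?thesis using pK by simp
    qed
    have "r 0 \<le> 1"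
    proof (rule ccontr)
      assume "\<not> r 0 \<le> 1"
      then have r0: "1 < r 0" by simp
      then obtain n where "C / p < r 0 ^ n" using real_arch_pow by blast
      also have "r 0 ^ n \<le> r 0 ^ (2 ^ n)"
        using r0 by (intro power_increasing) (simp_all add: less_imp_le)
      also have "\<dots> \<le> C / p" using r_pow r_bnd order_trans by blast
      finally show False by simp
    qed
    then show ?thesis using pK by (simp add: r_def field_simps)
  qed
  then show ?thesis by (simp add: g_def p_def)
qed

lemma norm_one_le: "norm (1::'a::cstar_algebra) \<le> 1"
proof -
  have "norm (1::'a) = norm (1::'a) * norm (1::'a)"
    using cstar_identity[of "1::'a"] by (simp add: power2_eq_square)
  then show ?thesis by (metis mult_cancel_right1 norm_ge_zero order.refl zero_le_one)
qed

lemma norm_pow_le: "norm ((x::'a::cstar_algebra) ^ n) \<le> norm x ^ n"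
proof (induction n)
  case (Suc n)
  have "norm (x * x ^ n) \<le> norm x * norm (x ^ n)" by (rule norm_mult_ineq)
  also have "\<dots> \<le> norm x * norm x ^ n" using Suc by (rule mult_left_mono) simp
  finally show ?case by simp
qed (simp add: norm_one_le)

lemma state_positive: "state \<phi> \<Longrightarrow> positive_functional \<phi>"
  and state_bound: "state \<phi> \<Longrightarrow> cmod (\<phi> a) \<le> norm a"
  by (auto simp: state_def)

lemma state_clinear: "state \<phi> \<Longrightarrow> clinear \<phi>"
  by (simp add: state_def positive_functional_def)

lemma positive_prod_state: "state \<phi> \<Longrightarrow> state \<psi> \<Longrightarrow> positive_functional (prod_functional \<phi> \<psi>)"
  by (simp add: positive_prod_functional state_positive)

lemma prod_state_bound:
  assumes "state \<phi>" "state \<psi>"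
  shows "\<exists>C\<ge>0. \<forall>c d. cmod (prod_functional \<phi> \<psi> (z * (simple_tensor c d * y))) \<le> C * (norm c * norm d)"
proof (induction z rule: alg_tensor_induct)
  case zero
  show ?case by (rule exI[of _ 0]) (simp add: clinear_simps[OF clinear_prod_functional])
next
  case (add z1 z2 z)
  then obtain C where C: "C \<ge> 0"
    "\<And>c d. cmod (prod_functional \<phi> \<psi> (z * (simple_tensor c d * y))) \<le> C * (norm c * norm d)" by blast
  have "\<exists>D\<ge>0. \<forall>c d. cmod (prod_functional \<phi> \<psi> (simple_tensor z1 z2 * (simple_tensor c d * y))) \<le> D * (norm c * norm d)"
  proof (induction y rule: alg_tensor_induct)
    case zero
    show ?case by (rule exI[of _ 0]) (simp add: clinear_simps[OF clinear_prod_functional])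
  next
    case (add y1 y2 y)
    then obtain D where D: "D \<ge> 0"
      "\<And>c d. cmod (prod_functional \<phi> \<psi> (simple_tensor z1 z2 * (simple_tensor c d * y))) \<le> D * (norm c * norm d)" by blast
    define E where "E = (norm z1 * norm y1) * (norm z2 * norm y2)"
    have "cmod (prod_functional \<phi> \<psi> (simple_tensor z1 z2 * (simple_tensor c d * (simple_tensor y1 y2 + y))))
        \<le> (E + D) * (norm c * norm d)" for c d
    proof -
      have *: "norm (p * (q * r)) \<le> norm p * (norm q * norm r)" for p q r :: "'x::cstar_algebra"
        by (meson mult_left_mono norm_ge_zero norm_mult_ineq order_trans)
      have "cmod (\<phi> (z1 * (c * y1))) \<le> norm z1 * (norm c * norm y1)"
        using state_bound[OF assms(1)] * order_trans by blast
      moreover have "cmod (\<psi> (z2 * (d * y2))) \<le> norm z2 * (norm d * norm y2)"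
        using state_bound[OF assms(2)] * order_trans by blast
      ultimately have "cmod (\<phi> (z1 * (c * y1)) * \<psi> (z2 * (d * y2)))
          \<le> (norm z1 * (norm c * norm y1)) * (norm z2 * (norm d * norm y2))"
        unfolding norm_mult by (intro mult_mono) auto
      also have "\<dots> = E * (norm c * norm d)" by (simp add: E_def)
      finally have "cmod (\<phi> (z1 * (c * y1)) * \<psi> (z2 * (d * y2))) \<le> E * (norm c * norm d)" .
      with D(2)[of c d] show ?thesis
        by (simp add: distrib_left distrib_right clinear_simps[OF clinear_prod_functional] simple_tensor_simps
            prod_functional_simple state_clinear assms norm_triangle_le)
    qed
    moreover have "E + D \<ge> 0" using D by (simp add: E_def)
    ultimately show ?case by blast
  qed
  then obtain D where D: "D \<ge> 0"
    "\<And>c d. cmod (prod_functional \<phi> \<psi> (simple_tensor z1 z2 * (simple_tensor c d * y))) \<le> D * (norm c * norm d)" by blast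
  have "cmod (prod_functional \<phi> \<psi> ((simple_tensor z1 z2 + z) * (simple_tensor c d * y)))
      \<le> (D + C) * (norm c * norm d)" for c d
    using D(2)[of c d] C(2)[of c d]
    by (simp add: distrib_right clinear_simps[OF clinear_prod_functional] norm_triangle_le)
  then show ?case using C(1) D(1) by (intro exI[of _ "D + C"]) simp
qed

lemma fnorm_simple_tensor_mult:
  assumes "state \<phi>" "state \<psi>"
  shows "fnorm (prod_functional \<phi> \<psi>) (simple_tensor a b * y) \<le> norm a * norm b * fnorm (prod_functional \<phi> \<psi>) y"
proof -
  define \<omega> where "\<omega> = prod_functional \<phi> \<psi>"
  have pos: "positive_functional \<omega>" using assms by (simp add: \<omega>_def positive_prod_state)
  define u where "u = simple_tensor (star a * a) (star b * b)"
  have pow: "u ^ n = simple_tensor ((star a * a) ^ n) ((star b * b) ^ n)" for n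
    by (induction n) (simp_all add: u_def simple_tensor_simps)
  have "\<exists>C\<ge>0. \<forall>c d. cmod (\<omega> (star y * (simple_tensor c d * y))) \<le> C * (norm c * norm d)"
    unfolding \<omega>_def by (rule prod_state_bound[OF assms])
  then obtain C where C: "C \<ge> 0"
    "\<And>c d. cmod (\<omega> (star y * (simple_tensor c d * y))) \<le> C * (norm c * norm d)" by blast
  define K where "K = (norm a * norm b)\<^sup>2"
  have "cmod (\<omega> (star y * (u ^ n * y))) \<le> C * K ^ n" for n
  proof -
    have "cmod (\<omega> (star y * (u ^ n * y))) \<le> C * (norm ((star a * a) ^ n) * norm ((star b * b) ^ n))"
      unfolding pow by (rule C)
    also have "\<dots> \<le> C * (norm (star a * a) ^ n * norm (star b * b) ^ n)"
      by (intro mult_left_mono mult_mono norm_pow_le C) auto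
    also have "\<dots> = C * K ^ n"
      by (simp add: cstar_identity K_def power_mult_distrib)
    finally show ?thesis .
  qed
  then have "cmod (\<omega> (star y * (u * y))) \<le> K * (fnorm \<omega> y)\<^sup>2"
    by (intro positive_power_bound[OF pos]) (auto simp: u_def simple_tensor_simps star_mult star_star K_def)
  moreover have "(fnorm \<omega> (simple_tensor a b * y))\<^sup>2 = Re (\<omega> (star y * (u * y)))"
  proof -
    have "star (simple_tensor a b) * simple_tensor a b = u" by (simp add: u_def simple_tensor_simps)
    moreover have "star (simple_tensor a b * y) * (simple_tensor a b * y)
        = star y * ((star (simple_tensor a b) * simple_tensor a b) * y)"
      by (simp add: star_mult mult.assoc)
    ultimately show ?thesis by (simp add: fnorm_sq[OF pos])
  qed
  ultimately have "(fnorm \<omega> (simple_tensor a b * y))\<^sup>2 \<le> K * (fnorm \<omega> y)\<^sup>2"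
    using complex_Re_le_cmod order_trans by metis
  then have "(fnorm \<omega> (simple_tensor a b * y))\<^sup>2 \<le> (norm a * norm b * fnorm \<omega> y)\<^sup>2"
    by (simp add: K_def power_mult_distrib)
  then show ?thesis
    unfolding \<omega>_def[symmetric] by (rule power2_le_imp_le) (simp add: fnorm_nonneg[OF pos])
qed

lemma spatial_bounded:
  "\<exists>K\<ge>0. \<forall>\<phi> \<psi> y. state \<phi> \<longrightarrow> state \<psi> \<longrightarrow>
     fnorm (prod_functional \<phi> \<psi>) (t * y) \<le> K * fnorm (prod_functional \<phi> \<psi>) y"
proof (induction t rule: alg_tensor_induct)
  case zero
  show ?case
    by (rule exI[of _ 0]) (simp add: fnorm_def clinear_simps[OF clinear_prod_functional])
next
  case (add a b t)
  then obtain K where K: "K \<ge> 0" "\<And>\<phi> \<psi> y. state \<phi> \<Longrightarrow> state \<psi> \<Longrightarrow>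
     fnorm (prod_functional \<phi> \<psi>) (t * y) \<le> K * fnorm (prod_functional \<phi> \<psi>) y" by blast
  have "fnorm (prod_functional \<phi> \<psi>) ((simple_tensor a b + t) * y)
      \<le> (norm a * norm b + K) * fnorm (prod_functional \<phi> \<psi>) y" if "state \<phi>" "state \<psi>" for \<phi> \<psi> y
    using fnorm_triangle[OF positive_prod_state[OF that], of "simple_tensor a b * y" "t * y"]
      fnorm_simple_tensor_mult[OF that, of a b y] K(2)[OF that, of y]
    by (simp add: distrib_right)
  then show ?case using K(1) by (intro exI[of _ "norm a * norm b + K"]) auto
qed

lemma spatial_norm_bdd:
  "bdd_above (insert 0 {fnorm (prod_functional \<phi> \<psi>) (t * y) | \<phi> \<psi> y.
    state \<phi> \<and> state \<psi> \<and> fnorm (prod_functional \<phi> \<psi>) y \<le> 1})"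
proof -
  obtain K where K: "K \<ge> 0" "\<And>\<phi> \<psi> y. state \<phi> \<Longrightarrow> state \<psi> \<Longrightarrow>
     fnorm (prod_functional \<phi> \<psi>) (t * y) \<le> K * fnorm (prod_functional \<phi> \<psi>) y"
    using spatial_bounded[of t] by blast
  show ?thesis
  proof (rule bdd_aboveI[of _ K])
    fix r assume "r \<in> insert 0 {fnorm (prod_functional \<phi> \<psi>) (t * y) | \<phi> \<psi> y.
      state \<phi> \<and> state \<psi> \<and> fnorm (prod_functional \<phi> \<psi>) y \<le> 1}"
    then show "r \<le> K"
    proof
      assume "r \<in> {fnorm (prod_functional \<phi> \<psi>) (t * y) | \<phi> \<psi> y.
        state \<phi> \<and> state \<psi> \<and> fnorm (prod_functional \<phi> \<psi>) y \<le> 1}"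
      then obtain \<phi> \<psi> y where *: "r = fnorm (prod_functional \<phi> \<psi>) (t * y)" "state \<phi>" "state \<psi>"
        "fnorm (prod_functional \<phi> \<psi>) y \<le> 1" by blast
      have "r \<le> K * fnorm (prod_functional \<phi> \<psi>) y" using K(2)[OF *(2,3)] *(1) by simp
      also have "\<dots> \<le> K * 1" using K(1) *(4) by (rule mult_left_mono[rotated])
      finally show "r \<le> K" by simp
    qed (use K in simp)
  qed
qed

lemma spatial_norm_nonneg [simp]: "0 \<le> spatial_norm t"
  unfolding spatial_norm_def by (rule cSup_upper[OF _ spatial_norm_bdd]) simp

lemma spatial_norm_mult:
  assumes "state \<phi>" "state \<psi>"
  shows "fnorm (prod_functional \<phi> \<psi>) (t * y) \<le> spatial_norm t * fnorm (prod_functional \<phi> \<psi>) y"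
proof -
  note pos = positive_prod_state[OF assms]
  let ?p = "fnorm (prod_functional \<phi> \<psi>)"
  obtain K where K: "K \<ge> 0" "\<And>y. ?p (t * y) \<le> K * ?p y"
    using spatial_bounded[of t] assms by blast
  show ?thesis
  proof (cases "?p y = 0")
    case True
    then show ?thesis using K(2)[of y] by simp
  next
    case False
    then have y: "0 < ?p y" using fnorm_nonneg[OF pos, of y] by linarith
    let ?k = "complex_of_real (inverse (?p y))"
    have "?p (t * (?k *\<^sub>C y)) \<le> spatial_norm t"
      unfolding spatial_norm_def
    proof (rule cSup_upper[OF _ spatial_norm_bdd])
      have "?p (?k *\<^sub>C y) \<le> 1" using y by (simp add: fnorm_scaleC[OF pos] norm_inverse)
      then show "?p (t * (?k *\<^sub>C y)) \<in> insert 0 {fnorm (prod_functional \<phi> \<psi>) (t * y) | \<phi> \<psi> y.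
        state \<phi> \<and> state \<psi> \<and> fnorm (prod_functional \<phi> \<psi>) y \<le> 1}"
        using assms by blast
    qed
    then have "?p (t * y) / ?p y \<le> spatial_norm t"
      using y by (simp add: mult_scaleC_right fnorm_scaleC[OF pos] norm_inverse divide_inverse mult.commute)
    then show ?thesis using y by (simp add: field_simps)
  qed
qed

lemma spatial_norm_le:
  assumes "0 \<le> K" "\<And>\<phi> \<psi> y. state \<phi> \<Longrightarrow> state \<psi> \<Longrightarrow>
    fnorm (prod_functional \<phi> \<psi>) (t * y) \<le> K * fnorm (prod_functional \<phi> \<psi>) y"
  shows "spatial_norm t \<le> K"
  unfolding spatial_norm_def
proof (rule cSup_least)
  fix r assume "r \<in> insert 0 {fnorm (prod_functional \<phi> \<psi>) (t * y) | \<phi> \<psi> y.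
    state \<phi> \<and> state \<psi> \<and> fnorm (prod_functional \<phi> \<psi>) y \<le> 1}"
  then show "r \<le> K"
  proof
    assume "r \<in> {fnorm (prod_functional \<phi> \<psi>) (t * y) | \<phi> \<psi> y.
      state \<phi> \<and> state \<psi> \<and> fnorm (prod_functional \<phi> \<psi>) y \<le> 1}"
    then obtain \<phi> \<psi> y where *: "r = fnorm (prod_functional \<phi> \<psi>) (t * y)" "state \<phi>" "state \<psi>"
      "fnorm (prod_functional \<phi> \<psi>) y \<le> 1" by blast
    have "r \<le> K * fnorm (prod_functional \<phi> \<psi>) y" using assms(2)[OF *(2,3)] *(1) by simp
    also have "\<dots> \<le> K * 1" using assms(1) *(4) by (rule mult_left_mono[rotated])
    finally show "r \<le> K" by simp
  qed (use assms in simp)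
qed simp

lemma spatial_norm_simple: "spatial_norm (simple_tensor a b) \<le> norm a * norm b"
  by (rule spatial_norm_le) (simp_all add: fnorm_simple_tensor_mult)

lemma spatial_norm_zero [simp]: "spatial_norm 0 = 0"
  by (rule antisym[OF spatial_norm_le])
     (simp_all add: fnorm_def clinear_simps[OF clinear_prod_functional])

lemma spatial_norm_triangle: "spatial_norm (s + t) \<le> spatial_norm s + spatial_norm t"
proof (rule spatial_norm_le)
  fix \<phi> :: "'a \<Rightarrow> complex" and \<psi> :: "'b \<Rightarrow> complex" and y assume st: "state \<phi>" "state \<psi>"
  show "fnorm (prod_functional \<phi> \<psi>) ((s + t) * y)
      \<le> (spatial_norm s + spatial_norm t) * fnorm (prod_functional \<phi> \<psi>) y"
    using fnorm_triangle[OF positive_prod_state[OF st], of "s * y" "t * y"]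
      spatial_norm_mult[OF st, of s y] spatial_norm_mult[OF st, of t y]
    by (simp add: distrib_right)
qed simp

lemma spatial_norm_mult_le: "spatial_norm (s * t) \<le> spatial_norm s * spatial_norm t"
proof (rule spatial_norm_le)
  fix \<phi> :: "'a \<Rightarrow> complex" and \<psi> :: "'b \<Rightarrow> complex" and y assume st: "state \<phi>" "state \<psi>"
  have "fnorm (prod_functional \<phi> \<psi>) (s * (t * y)) \<le> spatial_norm s * fnorm (prod_functional \<phi> \<psi>) (t * y)"
    by (rule spatial_norm_mult[OF st])
  also have "\<dots> \<le> spatial_norm s * (spatial_norm t * fnorm (prod_functional \<phi> \<psi>) y)"
    by (intro mult_left_mono spatial_norm_mult[OF st]) simp
  finally show "fnorm (prod_functional \<phi> \<psi>) (s * t * y)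
      \<le> spatial_norm s * spatial_norm t * fnorm (prod_functional \<phi> \<psi>) y"
    by (simp add: mult.assoc)
qed simp

lemma spatial_norm_scaleC: "spatial_norm (c *\<^sub>C t) = cmod c * spatial_norm t"
proof -
  have le: "spatial_norm (c *\<^sub>C t) \<le> cmod c * spatial_norm t" for c and t :: "('a, 'b) alg_tensor"
  proof (rule spatial_norm_le)
    fix \<phi> :: "'a \<Rightarrow> complex" and \<psi> :: "'b \<Rightarrow> complex" and y assume st: "state \<phi>" "state \<psi>"
    show "fnorm (prod_functional \<phi> \<psi>) ((c *\<^sub>C t) * y)
        \<le> cmod c * spatial_norm t * fnorm (prod_functional \<phi> \<psi>) y"
      using mult_left_mono[OF spatial_norm_mult[OF st, of t y], of "cmod c"]
      by (simp add: mult_scaleC_left fnorm_scaleC[OF positive_prod_state[OF st]])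
  qed simp
  show ?thesis
  proof (cases "c = 0")
    case False
    have "inverse c *\<^sub>C c *\<^sub>C t = t" using False by (simp add: scaleC_scaleC scaleC_one)
    then have "spatial_norm t \<le> inverse (cmod c) * spatial_norm (c *\<^sub>C t)"
      using le[of "inverse c" "c *\<^sub>C t"] by (simp only: norm_inverse)
    then have "cmod c * spatial_norm t \<le> spatial_norm (c *\<^sub>C t)"
      using False by (simp add: field_simps)
    with le[of c t] show ?thesis by simp
  qed simp
qed

lemma spatial_norm_minus [simp]: "spatial_norm (- t) = spatial_norm t"
  using spatial_norm_scaleC[of "-1" t] by (simp add: scaleC_one)

lemma spatial_norm_minus_commute: "spatial_norm (s - t) = spatial_norm (t - s)"
  using spatial_norm_minus[of "s - t"] by simp

lemma spatial_norm_cstar_le: "(spatial_norm t)\<^sup>2 \<le> spatial_norm (star t * t)"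
proof -
  have "spatial_norm t \<le> sqrt (spatial_norm (star t * t))"
  proof (rule spatial_norm_le)
    fix \<phi> :: "'a \<Rightarrow> complex" and \<psi> :: "'b \<Rightarrow> complex" and y assume st: "state \<phi>" "state \<psi>"
    note pos = positive_prod_state[OF st]
    let ?p = "fnorm (prod_functional \<phi> \<psi>)"
    have "(?p (t * y))\<^sup>2 = Re (prod_functional \<phi> \<psi> (star y * ((star t * t) * y)))"
      by (simp add: fnorm_sq[OF pos] star_mult mult.assoc)
    also have "\<dots> \<le> ?p y * ?p ((star t * t) * y)"
      using Cauchy_Schwarz[OF pos] complex_Re_le_cmod order_trans by blast
    also have "\<dots> \<le> ?p y * (spatial_norm (star t * t) * ?p y)"
      by (intro mult_left_mono spatial_norm_mult[OF st]) (simp add: fnorm_nonneg[OF pos])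
    also have "\<dots> = (sqrt (spatial_norm (star t * t)) * ?p y)\<^sup>2"
      by (simp add: power_mult_distrib power2_eq_square)
    finally show "?p (t * y) \<le> sqrt (spatial_norm (star t * t)) * ?p y"
      by (rule power2_le_imp_le) (simp add: fnorm_nonneg[OF pos])
  qed simp
  then show ?thesis by (metis power_mono real_sqrt_pow2 spatial_norm_nonneg)
qed

lemma spatial_norm_star [simp]: "spatial_norm (star t) = spatial_norm t"
proof -
  have le: "spatial_norm t \<le> spatial_norm (star t)" for t :: "('a, 'b) alg_tensor"
  proof (cases "spatial_norm t = 0")
    case False
    have "spatial_norm t * spatial_norm t \<le> spatial_norm (star t) * spatial_norm t"
      using spatial_norm_cstar_le[of t] spatial_norm_mult_le[of "star t" t] by (simp add: power2_eq_square)
    then show ?thesis using False spatial_norm_nonneg[of t] by simp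
  qed simp
  show ?thesis using le[of t] le[of "star t"] by (simp add: star_star)
qed

lemma spatial_norm_cstar: "spatial_norm (star t * t) = (spatial_norm t)\<^sup>2"
  using spatial_norm_cstar_le[of t] spatial_norm_mult_le[of "star t" t] by (simp add: power2_eq_square)

lemma spatial_norm_triangle_diff:
  "spatial_norm (a + b - (c + d)) \<le> spatial_norm (a - c) + spatial_norm (b - d)"
  using spatial_norm_triangle[of "a - c" "b - d"] by (simp add: algebra_simps)

lemma spatial_norm_diff_trans: "spatial_norm (a - c) \<le> spatial_norm (a - b) + spatial_norm (b - c)"
  using spatial_norm_triangle[of "a - b" "b - c"] by simp

lemma spatial_norm_abs_diff: "\<bar>spatial_norm a - spatial_norm b\<bar> \<le> spatial_norm (a - b)"
  using spatial_norm_triangle[of "a - b" b] spatial_norm_triangle[of "b - a" a]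
  by (simp add: spatial_norm_minus_commute[of b a] abs_le_iff)

section \<open>The minimal tensor product\<close>

text \<open>The completion of the algebraic tensor product in the spatial norm, as Cauchy sequences
  modulo null sequences.\<close>

definition spatial_Cauchy :: "(nat \<Rightarrow> ('a::cstar_algebra, 'b::cstar_algebra) alg_tensor) \<Rightarrow> bool"
  where "spatial_Cauchy X \<longleftrightarrow> (\<forall>e>0. \<exists>M. \<forall>m\<ge>M. \<forall>n\<ge>M. spatial_norm (X m - X n) < e)"

definition tensor_eq ::
  "(nat \<Rightarrow> ('a::cstar_algebra, 'b::cstar_algebra) alg_tensor) \<Rightarrow> (nat \<Rightarrow> ('a, 'b) alg_tensor) \<Rightarrow> bool"
  where "tensor_eq X Y \<longleftrightarrow> spatial_Cauchy X \<and> spatial_Cauchy Y \<and> (\<lambda>n. spatial_norm (X n - Y n)) \<longlonglongrightarrow> 0"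

lemma spatial_Cauchy_const [simp]: "spatial_Cauchy (\<lambda>_. t)"
  by (auto simp: spatial_Cauchy_def)

lemma spatial_Cauchy_lipschitz:
  assumes "spatial_Cauchy X" "\<And>m n. spatial_norm (F m - F n) \<le> K * spatial_norm (X m - X n)"
  shows "spatial_Cauchy F"
  unfolding spatial_Cauchy_def
proof safe
  fix e :: real assume e: "0 < e"
  have "0 < e / (\<bar>K\<bar> + 1)" using e by simp
  then obtain M where M: "\<And>m n. m \<ge> M \<Longrightarrow> n \<ge> M \<Longrightarrow> spatial_norm (X m - X n) < e / (\<bar>K\<bar> + 1)"
    using assms(1) unfolding spatial_Cauchy_def by blast
  have "spatial_norm (F m - F n) < e" if "m \<ge> M" "n \<ge> M" for m n
  proof -
    have "spatial_norm (F m - F n) \<le> K * spatial_norm (X m - X n)" by (rule assms)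
    also have "\<dots> \<le> (\<bar>K\<bar> + 1) * spatial_norm (X m - X n)" by (intro mult_right_mono) auto
    also have "\<dots> < (\<bar>K\<bar> + 1) * (e / (\<bar>K\<bar> + 1))"
      using M[OF that] by (intro mult_strict_left_mono) auto
    finally show ?thesis by simp
  qed
  then show "\<exists>M. \<forall>m\<ge>M. \<forall>n\<ge>M. spatial_norm (F m - F n) < e" by blast
qed

lemma spatial_Cauchy_add:
  assumes "spatial_Cauchy X" "spatial_Cauchy Y"
  shows "spatial_Cauchy (\<lambda>n. X n + Y n)"
  unfolding spatial_Cauchy_def
proof safe
  fix e :: real assume e: "0 < e"
  obtain M where M: "\<And>m n. m \<ge> M \<Longrightarrow> n \<ge> M \<Longrightarrow> spatial_norm (X m - X n) < e / 2"
    using assms(1) e unfolding spatial_Cauchy_def by (meson half_gt_zero)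
  obtain N where N: "\<And>m n. m \<ge> N \<Longrightarrow> n \<ge> N \<Longrightarrow> spatial_norm (Y m - Y n) < e / 2"
    using assms(2) e unfolding spatial_Cauchy_def by (meson half_gt_zero)
  have "spatial_norm (X m + Y m - (X n + Y n)) < e" if "m \<ge> max M N" "n \<ge> max M N" for m n
    using M[of m n] N[of m n] that spatial_norm_triangle_diff[of "X m" "Y m" "X n" "Y n"] by simp
  then show "\<exists>M. \<forall>m\<ge>M. \<forall>n\<ge>M. spatial_norm (X m + Y m - (X n + Y n)) < e" by blast
qed

lemma spatial_Cauchy_norm_Cauchy: "spatial_Cauchy X \<Longrightarrow> Cauchy (\<lambda>n. spatial_norm (X n))"
  unfolding spatial_Cauchy_def Cauchy_def dist_real_def
  by (meson le_less_trans spatial_norm_abs_diff)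

lemma spatial_Cauchy_norm_lim:
  "spatial_Cauchy X \<Longrightarrow> (\<lambda>n. spatial_norm (X n)) \<longlonglongrightarrow> lim (\<lambda>n. spatial_norm (X n))"
  using spatial_Cauchy_norm_Cauchy Cauchy_convergent convergent_LIMSEQ_iff by blast

lemma spatial_Cauchy_bounded:
  assumes "spatial_Cauchy X"
  obtains B where "0 < B" "\<And>n. spatial_norm (X n) \<le> B"
proof -
  have "Bseq (\<lambda>n. spatial_norm (X n))"
    using spatial_Cauchy_norm_Cauchy[OF assms] by (simp add: Cauchy_Bseq)
  then obtain B where "0 < B" "\<forall>n. norm (spatial_norm (X n)) \<le> B" by (auto simp: Bseq_def)
  then show ?thesis by (intro that[of B]) (simp_all add: abs_le_iff)
qed

lemma spatial_norm_mult_diff: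
  "spatial_norm (a * b - c * d) \<le> spatial_norm (a - c) * spatial_norm b + spatial_norm c * spatial_norm (b - d)"
proof -
  have "a * b - c * d = (a - c) * b + c * (b - d)" by (simp add: algebra_simps)
  then show ?thesis
    using spatial_norm_triangle[of "(a - c) * b" "c * (b - d)"]
      spatial_norm_mult_le[of "a - c" b] spatial_norm_mult_le[of c "b - d"] by simp
qed

lemma spatial_Cauchy_mult:
  assumes "spatial_Cauchy X" "spatial_Cauchy Y"
  shows "spatial_Cauchy (\<lambda>n. X n * Y n)"
  unfolding spatial_Cauchy_def
proof safe
  fix e :: real assume e: "0 < e"
  obtain A where A: "0 < A" "\<And>n. spatial_norm (X n) \<le> A" using spatial_Cauchy_bounded[OF assms(1)] by blast
  obtain B where B: "0 < B" "\<And>n. spatial_norm (Y n) \<le> B" using spatial_Cauchy_bounded[OF assms(2)] by blast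
  obtain M where M: "\<And>m n. m \<ge> M \<Longrightarrow> n \<ge> M \<Longrightarrow> spatial_norm (X m - X n) < e / (2 * B)"
    using assms(1) e B(1) unfolding spatial_Cauchy_def
    by (metis divide_pos_pos mult_pos_pos zero_less_numeral)
  obtain N where N: "\<And>m n. m \<ge> N \<Longrightarrow> n \<ge> N \<Longrightarrow> spatial_norm (Y m - Y n) < e / (2 * A)"
    using assms(2) e A(1) unfolding spatial_Cauchy_def
    by (metis divide_pos_pos mult_pos_pos zero_less_numeral)
  have "spatial_norm (X m * Y m - X n * Y n) < e" if "m \<ge> max M N" "n \<ge> max M N" for m n
  proof -
    have "spatial_norm (X m * Y m - X n * Y n)
        \<le> spatial_norm (X m - X n) * spatial_norm (Y m) + spatial_norm (X n) * spatial_norm (Y m - Y n)"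
      by (rule spatial_norm_mult_diff)
    also have "\<dots> \<le> spatial_norm (X m - X n) * B + A * spatial_norm (Y m - Y n)"
      by (intro add_mono mult_left_mono mult_right_mono A B) auto
    also have "\<dots> < (e / (2 * B)) * B + A * (e / (2 * A))"
      using M[of m n] N[of m n] that A(1) B(1)
      by (intro add_strict_mono mult_strict_left_mono mult_strict_right_mono) auto
    also have "\<dots> = e" using A(1) B(1) by simp
    finally show ?thesis .
  qed
  then show "\<exists>M. \<forall>m\<ge>M. \<forall>n\<ge>M. spatial_norm (X m * Y m - X n * Y n) < e" by blast
qed

lemma spatial_Cauchy_scaleC: "spatial_Cauchy X \<Longrightarrow> spatial_Cauchy (\<lambda>n. c *\<^sub>C X n)"
  by (erule spatial_Cauchy_lipschitz[where K = "cmod c"])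
     (simp add: spatial_norm_scaleC flip: complex_vector.scale_right_diff_distrib)

lemma spatial_Cauchy_minus: "spatial_Cauchy X \<Longrightarrow> spatial_Cauchy (\<lambda>n. - X n)"
  by (erule spatial_Cauchy_lipschitz[where K = 1])
     (metis minus_diff_minus mult_1 order_refl spatial_norm_minus)

lemma spatial_Cauchy_star: "spatial_Cauchy X \<Longrightarrow> spatial_Cauchy (\<lambda>n. star (X n))"
  by (erule spatial_Cauchy_lipschitz[where K = 1]) (simp flip: star_diff)

lemma tensor_eq_refl: "spatial_Cauchy X \<Longrightarrow> tensor_eq X X"
  by (simp add: tensor_eq_def)

lemma tensor_eqI:
  assumes "spatial_Cauchy X" "spatial_Cauchy Y" "Z \<longlonglongrightarrow> 0" "\<And>n. spatial_norm (X n - Y n) \<le> Z n"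
  shows "tensor_eq X Y"
  unfolding tensor_eq_def using assms
  by (auto intro: tendsto_sandwich[of "\<lambda>_. 0" _ _ Z])

quotient_type (overloaded) ('a, 'b) tensor = "nat \<Rightarrow> ('a::cstar_algebra, 'b::cstar_algebra) alg_tensor"
  / partial: tensor_eq
proof (rule part_equivpI)
  show "\<exists>X :: nat \<Rightarrow> ('a, 'b) alg_tensor. tensor_eq X X"
    by (rule exI[of _ "\<lambda>_. 0"]) (simp add: tensor_eq_refl)
  show "symp (tensor_eq :: (nat \<Rightarrow> ('a, 'b) alg_tensor) \<Rightarrow> _)"
    by (auto simp: symp_def tensor_eq_def spatial_norm_minus_commute)
  show "transp (tensor_eq :: (nat \<Rightarrow> ('a, 'b) alg_tensor) \<Rightarrow> _)"
  proof (rule transpI)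
    fix X Y Z :: "nat \<Rightarrow> ('a, 'b) alg_tensor"
    assume XY: "tensor_eq X Y" and YZ: "tensor_eq Y Z"
    show "tensor_eq X Z"
    proof (rule tensor_eqI)
      show "(\<lambda>n. spatial_norm (X n - Y n) + spatial_norm (Y n - Z n)) \<longlonglongrightarrow> 0"
        using XY YZ tendsto_add[of _ 0 _ _ 0] by (fastforce simp: tensor_eq_def)
    qed (use XY YZ in \<open>auto simp: tensor_eq_def spatial_norm_diff_trans\<close>)
  qed
qed

lemma tensor_eq_norm_lim:
  assumes "tensor_eq X Y"
  shows "lim (\<lambda>n. spatial_norm (X n)) = lim (\<lambda>n. spatial_norm (Y n))"
proof -
  have X: "(\<lambda>n. spatial_norm (X n)) \<longlonglongrightarrow> lim (\<lambda>n. spatial_norm (X n))"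
    and Y: "(\<lambda>n. spatial_norm (Y n)) \<longlonglongrightarrow> lim (\<lambda>n. spatial_norm (Y n))"
    using assms by (auto simp: tensor_eq_def intro: spatial_Cauchy_norm_lim)
  have "(\<lambda>n. spatial_norm (X n) - spatial_norm (Y n)) \<longlonglongrightarrow> 0"
    using assms unfolding tensor_eq_def
  proof (elim conjE)
    assume "(\<lambda>n. spatial_norm (X n - Y n)) \<longlonglongrightarrow> 0"
    then show ?thesis
      by (rule Lim_null_comparison[rotated]) (simp add: spatial_norm_abs_diff)
  qed
  moreover have "(\<lambda>n. spatial_norm (X n) - spatial_norm (Y n)) \<longlonglongrightarrow>
      lim (\<lambda>n. spatial_norm (X n)) - lim (\<lambda>n. spatial_norm (Y n))"
    using X Y by (rule tendsto_diff)
  ultimately have "lim (\<lambda>n. spatial_norm (X n)) - lim (\<lambda>n. spatial_norm (Y n)) = 0"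
    by (rule LIMSEQ_unique[rotated])
  then show ?thesis by simp
qed

lemma tensor_eq_add:
  assumes "tensor_eq X X'" "tensor_eq Y Y'"
  shows "tensor_eq (\<lambda>n. X n + Y n) (\<lambda>n. X' n + Y' n)"
proof (rule tensor_eqI)
  show "(\<lambda>n. spatial_norm (X n - X' n) + spatial_norm (Y n - Y' n)) \<longlonglongrightarrow> 0"
    using assms tendsto_add[of _ 0 _ _ 0] by (fastforce simp: tensor_eq_def)
qed (use assms in \<open>auto simp: tensor_eq_def spatial_norm_triangle_diff intro: spatial_Cauchy_add\<close>)

lemma tensor_eq_mult:
  assumes "tensor_eq X X'" "tensor_eq Y Y'"
  shows "tensor_eq (\<lambda>n. X n * Y n) (\<lambda>n. X' n * Y' n)"
proof -
  have C: "spatial_Cauchy X" "spatial_Cauchy X'" "spatial_Cauchy Y" "spatial_Cauchy Y'"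
    using assms by (auto simp: tensor_eq_def)
  show ?thesis
  proof (rule tensor_eqI)
    have "(\<lambda>n. spatial_norm (X n - X' n) * spatial_norm (Y n) + spatial_norm (X' n) * spatial_norm (Y n - Y' n))
        \<longlonglongrightarrow> 0 * lim (\<lambda>n. spatial_norm (Y n)) + lim (\<lambda>n. spatial_norm (X' n)) * 0"
      using assms C by (intro tendsto_intros spatial_Cauchy_norm_lim) (auto simp: tensor_eq_def)
    then show "(\<lambda>n. spatial_norm (X n - X' n) * spatial_norm (Y n) + spatial_norm (X' n) * spatial_norm (Y n - Y' n))
        \<longlonglongrightarrow> 0" by simp
  qed (auto intro: C spatial_Cauchy_mult spatial_norm_mult_diff)
qed

lemma tensor_eq_lipschitz:
  assumes "tensor_eq X Y" "\<And>X. spatial_Cauchy X \<Longrightarrow> spatial_Cauchy (\<lambda>n. F (X n))"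
    "\<And>s t. spatial_norm (F s - F t) = K * spatial_norm (s - t)"
  shows "tensor_eq (\<lambda>n. F (X n)) (\<lambda>n. F (Y n))"
proof (rule tensor_eqI)
  show "(\<lambda>n. K * spatial_norm (X n - Y n)) \<longlonglongrightarrow> 0"
    using assms(1) tendsto_mult_left[of _ 0 _ K] by (fastforce simp: tensor_eq_def)
qed (use assms in \<open>auto simp: tensor_eq_def\<close>)

lemma tensor_eq_scaleC: "tensor_eq X Y \<Longrightarrow> tensor_eq (\<lambda>n. c *\<^sub>C X n) (\<lambda>n. c *\<^sub>C Y n)"
  by (rule tensor_eq_lipschitz[where K = "cmod c"])
     (simp_all add: spatial_Cauchy_scaleC spatial_norm_scaleC flip: complex_vector.scale_right_diff_distrib)

lemma tensor_eq_minus: "tensor_eq X Y \<Longrightarrow> tensor_eq (\<lambda>n. - X n) (\<lambda>n. - Y n)"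
  using tensor_eq_scaleC[of X Y "-1"] by (simp add: scaleC_one)

lemma tensor_eq_star: "tensor_eq X Y \<Longrightarrow> tensor_eq (\<lambda>n. star (X n)) (\<lambda>n. star (Y n))"
  by (rule tensor_eq_lipschitz[where K = 1]) (simp_all add: spatial_Cauchy_star flip: star_diff)

instantiation tensor :: (cstar_algebra, cstar_algebra) star_algebra
begin

lift_definition zero_tensor :: "('a, 'b) tensor" is "\<lambda>_. 0" by (simp add: tensor_eq_refl)

lift_definition one_tensor :: "('a, 'b) tensor" is "\<lambda>_. 1" by (simp add: tensor_eq_refl)

lift_definition plus_tensor :: "('a, 'b) tensor \<Rightarrow> ('a, 'b) tensor \<Rightarrow> ('a, 'b) tensor"
  is "\<lambda>X Y n. X n + Y n" by (rule tensor_eq_add)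

lift_definition times_tensor :: "('a, 'b) tensor \<Rightarrow> ('a, 'b) tensor \<Rightarrow> ('a, 'b) tensor"
  is "\<lambda>X Y n. X n * Y n" by (rule tensor_eq_mult)

lift_definition scaleC_tensor :: "complex \<Rightarrow> ('a, 'b) tensor \<Rightarrow> ('a, 'b) tensor"
  is "\<lambda>c X n. c *\<^sub>C X n" by (rule tensor_eq_scaleC)

lift_definition uminus_tensor :: "('a, 'b) tensor \<Rightarrow> ('a, 'b) tensor"
  is "\<lambda>X n. - X n" by (rule tensor_eq_minus)

lift_definition star_tensor :: "('a, 'b) tensor \<Rightarrow> ('a, 'b) tensor"
  is "\<lambda>X n. star (X n)" by (rule tensor_eq_star)

definition minus_tensor :: "('a, 'b) tensor \<Rightarrow> ('a, 'b) tensor \<Rightarrow> ('a, 'b) tensor"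
  where "minus_tensor x y = x + (- y)"

instance
proof
  fix x y z :: "('a, 'b) tensor" and c d :: complex
  show "x - y = x + - y" by (simp add: minus_tensor_def)
  show "x + y + z = x + (y + z)" "x + y = y + x" "0 + x = x" "- x + x = 0"
    "x * y * z = x * (y * z)" "1 * x = x" "x * 1 = x"
    "(x + y) * z = x * z + y * z" "x * (y + z) = x * y + x * z"
    "c *\<^sub>C (x + y) = c *\<^sub>C x + c *\<^sub>C y" "(c + d) *\<^sub>C x = c *\<^sub>C x + d *\<^sub>C x"
    "c *\<^sub>C d *\<^sub>C x = (c * d) *\<^sub>C x" "1 *\<^sub>C x = x"
    "(c *\<^sub>C x) * y = c *\<^sub>C (x * y)" "x * (c *\<^sub>C y) = c *\<^sub>C (x * y)"
    "star (x + y) = star x + star y" "star (c *\<^sub>C x) = cnj c *\<^sub>C star x"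
    "star (x * y) = star y * star x" "star (star x) = x"
    by (transfer; simp add: tensor_eq_def algebra_simps scaleC_simps scaleC_one star_simps
        spatial_Cauchy_add spatial_Cauchy_mult spatial_Cauchy_scaleC spatial_Cauchy_star spatial_Cauchy_minus)+
qed

end

instantiation tensor :: (cstar_algebra, cstar_algebra) real_vector
begin

definition scaleR_tensor :: "real \<Rightarrow> ('a, 'b) tensor \<Rightarrow> ('a, 'b) tensor"
  where "scaleR_tensor r x = complex_of_real r *\<^sub>C x"

instance
  by standard (simp_all add: scaleR_tensor_def scaleC_simps scaleC_one)

end

lemma rep_tensor_Cauchy: "spatial_Cauchy (rep_tensor x)"
  using Quotient_rep_reflp[OF Quotient_tensor, of x] by (simp add: tensor_eq_def)

lemma abs_rep_tensor: "abs_tensor (rep_tensor x) = x"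
  by (rule Quotient_abs_rep[OF Quotient_tensor])

lemma rep_tensor_eqs:
  "x + y = abs_tensor (\<lambda>n. rep_tensor x n + rep_tensor y n)"
  "x * y = abs_tensor (\<lambda>n. rep_tensor x n * rep_tensor y n)"
  "star x * x = abs_tensor (\<lambda>n. star (rep_tensor x n) * rep_tensor x n)"
  "c *\<^sub>C x = abs_tensor (\<lambda>n. c *\<^sub>C rep_tensor x n)"
  using plus_tensor.abs_eq[OF tensor_eq_refl tensor_eq_refl, of "rep_tensor x" "rep_tensor y"]
    times_tensor.abs_eq[OF tensor_eq_refl tensor_eq_refl, of "rep_tensor x" "rep_tensor y"]
    times_tensor.abs_eq[OF tensor_eq_refl tensor_eq_refl, of "\<lambda>n. star (rep_tensor x n)" "rep_tensor x"]
    star_tensor.abs_eq[OF tensor_eq_refl, of "rep_tensor x"]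
    scaleC_tensor.abs_eq[OF tensor_eq_refl, of "rep_tensor x" c]
  by (simp_all add: abs_rep_tensor rep_tensor_Cauchy spatial_Cauchy_star)

instantiation tensor :: (cstar_algebra, cstar_algebra) real_normed_vector
begin

lift_definition norm_tensor :: "('a, 'b) tensor \<Rightarrow> real"
  is "\<lambda>X. lim (\<lambda>n. spatial_norm (X n))" by (rule tensor_eq_norm_lim)

definition dist_tensor :: "('a, 'b) tensor \<Rightarrow> ('a, 'b) tensor \<Rightarrow> real"
  where "dist_tensor x y = norm (x - y)"

definition sgn_tensor :: "('a, 'b) tensor \<Rightarrow> ('a, 'b) tensor"
  where "sgn_tensor x = x /\<^sub>R norm x"

definition uniformity_tensor :: "(('a, 'b) tensor \<times> ('a, 'b) tensor) filter"
  where "uniformity_tensor = (INF e\<in>{0 <..}. principal {(x, y). dist x y < e})"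

definition open_tensor :: "('a, 'b) tensor set \<Rightarrow> bool"
  where "open_tensor S = (\<forall>x\<in>S. \<forall>\<^sub>F (x', y) in uniformity. x' = x \<longrightarrow> y \<in> S)"

lemma norm_abs_tensor: "spatial_Cauchy X \<Longrightarrow> (\<lambda>n. spatial_norm (X n)) \<longlonglongrightarrow> norm (abs_tensor X)"
  by (simp add: norm_tensor.abs_eq tensor_eq_refl spatial_Cauchy_norm_lim)

lemma norm_rep_tensor: "(\<lambda>n. spatial_norm (rep_tensor x n)) \<longlonglongrightarrow> norm x"
  using norm_abs_tensor[OF rep_tensor_Cauchy[of x]] by (simp add: abs_rep_tensor)

lemma norm_tensor_scaleC: "norm (c *\<^sub>C x) = cmod c * norm (x :: ('a, 'b) tensor)"
proof -
  have "(\<lambda>n. spatial_norm (c *\<^sub>C rep_tensor x n)) \<longlonglongrightarrow> norm (c *\<^sub>C x)"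
    unfolding rep_tensor_eqs by (intro norm_abs_tensor spatial_Cauchy_scaleC rep_tensor_Cauchy)
  moreover have "(\<lambda>n. spatial_norm (c *\<^sub>C rep_tensor x n)) \<longlonglongrightarrow> cmod c * norm x"
    unfolding spatial_norm_scaleC by (intro tendsto_mult_left norm_rep_tensor)
  ultimately show ?thesis by (rule LIMSEQ_unique)
qed

instance
proof
  fix x y :: "('a, 'b) tensor" and r :: real
  note C = rep_tensor_Cauchy
  show "norm x = 0 \<longleftrightarrow> x = 0"
  proof
    assume "norm x = 0"
    then have "tensor_eq (rep_tensor x) (\<lambda>_. 0)"
      using norm_rep_tensor[of x] by (simp add: tensor_eq_def C)
    then show "x = 0"
      unfolding zero_tensor_def by (metis Quotient_rel_abs[OF Quotient_tensor] abs_rep_tensor)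
  next
    assume "x = 0"
    then show "norm x = 0" by (simp add: zero_tensor_def norm_tensor.abs_eq tensor_eq_refl)
  qed
  show "norm (x + y) \<le> norm x + norm y"
    unfolding rep_tensor_eqs
    by (rule LIMSEQ_le[OF norm_abs_tensor tendsto_add[OF norm_rep_tensor norm_rep_tensor]])
       (auto intro: C spatial_Cauchy_add spatial_norm_triangle)
  show "norm (r *\<^sub>R x) = \<bar>r\<bar> * norm x"
    by (simp add: scaleR_tensor_def norm_tensor_scaleC)
qed (simp_all add: dist_tensor_def sgn_tensor_def uniformity_tensor_def open_tensor_def)

end

definition embed_tensor :: "('a::cstar_algebra, 'b::cstar_algebra) alg_tensor \<Rightarrow> ('a, 'b) tensor"
  where "embed_tensor t = abs_tensor (\<lambda>_. t)"

lemma norm_embed_tensor [simp]: "norm (embed_tensor t) = spatial_norm t"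
  using norm_abs_tensor[of "\<lambda>_. t"] by (simp add: embed_tensor_def LIMSEQ_const_iff)

lemma norm_diff_embed:
  assumes "spatial_Cauchy X" "\<And>n. n \<ge> m \<Longrightarrow> spatial_norm (X n - t) \<le> e"
  shows "norm (abs_tensor X - embed_tensor t) \<le> e"
proof -
  have C: "spatial_Cauchy (\<lambda>n. X n - t)"
    using spatial_Cauchy_add[OF assms(1) spatial_Cauchy_const[of "- t"]] by simp
  have "abs_tensor X - embed_tensor t = abs_tensor (\<lambda>n. X n - t)"
    using assms(1) by (simp add: minus_tensor_def embed_tensor_def uminus_tensor.abs_eq plus_tensor.abs_eq tensor_eq_refl)
  then have "(\<lambda>n. spatial_norm (X n - t)) \<longlonglongrightarrow> norm (abs_tensor X - embed_tensor t)"
    using norm_abs_tensor[OF C] by simp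
  then show ?thesis by (rule LIMSEQ_le_const2) (use assms(2) in blast)
qed

lemma embed_tensor_dense:
  assumes "0 < e"
  shows "\<exists>t. norm (x - embed_tensor t) \<le> e"
proof -
  obtain M where "\<And>m n. m \<ge> M \<Longrightarrow> n \<ge> M \<Longrightarrow> spatial_norm (rep_tensor x m - rep_tensor x n) < e"
    using rep_tensor_Cauchy[of x] assms unfolding spatial_Cauchy_def by blast
  then have "norm (abs_tensor (rep_tensor x) - embed_tensor (rep_tensor x M)) \<le> e"
    by (intro norm_diff_embed[OF rep_tensor_Cauchy, of M]) (auto intro: less_imp_le)
  then show ?thesis by (auto simp: abs_rep_tensor)
qed

lemma embed_tensor_diff: "embed_tensor (s - t) = embed_tensor s - embed_tensor t"
  by (simp add: minus_tensor_def embed_tensor_def uminus_tensor.abs_eq plus_tensor.abs_eq tensor_eq_refl)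

instance tensor :: (cstar_algebra, cstar_algebra) cstar_algebra
proof
  fix x y :: "('a, 'b) tensor" and c :: complex and r :: real
  note C = rep_tensor_Cauchy
  show "r *\<^sub>R x = complex_of_real r *\<^sub>C x" by (simp add: scaleR_tensor_def)
  show "(r *\<^sub>R x) * y = r *\<^sub>R (x * y)" "x * (r *\<^sub>R y) = r *\<^sub>R (x * y)"
    by (simp_all add: scaleR_tensor_def scaleC_simps)
  show "norm (c *\<^sub>C x) = cmod c * norm x" by (rule norm_tensor_scaleC)
  show "norm (x * y) \<le> norm x * norm y"
    unfolding rep_tensor_eqs
    by (rule LIMSEQ_le[OF norm_abs_tensor tendsto_mult[OF norm_rep_tensor norm_rep_tensor]])
       (auto intro: C spatial_Cauchy_mult spatial_norm_mult_le)
  have "(\<lambda>n. spatial_norm (star (rep_tensor x n) * rep_tensor x n)) \<longlonglongrightarrow> norm (star x * x)"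
    unfolding rep_tensor_eqs(3) by (intro norm_abs_tensor spatial_Cauchy_mult spatial_Cauchy_star C)
  moreover have "(\<lambda>n. spatial_norm (star (rep_tensor x n) * rep_tensor x n)) \<longlonglongrightarrow> (norm x)\<^sup>2"
    unfolding spatial_norm_cstar by (intro tendsto_power norm_rep_tensor)
  ultimately show "norm (star x * x) = (norm x)\<^sup>2" by (rule LIMSEQ_unique)
next
  fix S :: "nat \<Rightarrow> ('a, 'b) tensor"
  assume S: "Cauchy S"
  have "\<exists>t. norm (S n - embed_tensor t) \<le> inverse (real (Suc n))" for n
    by (rule embed_tensor_dense) simp
  then obtain T where T: "\<And>n. norm (S n - embed_tensor (T n)) \<le> inverse (real (Suc n))" by metis
  have null: "(\<lambda>n. S n - embed_tensor (T n)) \<longlonglongrightarrow> 0"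
    by (rule Lim_null_comparison[OF always_eventually LIMSEQ_inverse_real_of_nat]) (use T in auto)
  have CT: "spatial_Cauchy T"
    unfolding spatial_Cauchy_def
  proof safe
    fix e :: real assume e: "0 < e"
    obtain M where M: "\<And>m n. m \<ge> M \<Longrightarrow> n \<ge> M \<Longrightarrow> norm (S m - S n) < e / 3"
      using S e unfolding Cauchy_def dist_norm by (meson divide_pos_pos zero_less_numeral)
    obtain N where N: "\<And>n. n \<ge> N \<Longrightarrow> norm (S n - embed_tensor (T n)) < e / 3"
      using LIMSEQ_D[OF null, of "e / 3"] e by auto
    have "spatial_norm (T m - T n) < e" if "m \<ge> max M N" "n \<ge> max M N" for m n
    proof -
      have eq: "embed_tensor (T m - T n)
          = (S m - S n) - (S m - embed_tensor (T m)) + (S n - embed_tensor (T n))"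
        by (simp add: embed_tensor_diff)
      have "norm (embed_tensor (T m - T n)) \<le> norm (S m - S n)
          + norm (S m - embed_tensor (T m)) + norm (S n - embed_tensor (T n))"
        unfolding eq
        using norm_triangle_ineq[of "(S m - S n) - (S m - embed_tensor (T m))" "S n - embed_tensor (T n)"]
          norm_triangle_ineq4[of "S m - S n" "S m - embed_tensor (T m)"] by linarith
      then show ?thesis using M[of m n] N[of m] N[of n] that by simp
    qed
    then show "\<exists>M. \<forall>m\<ge>M. \<forall>n\<ge>M. spatial_norm (T m - T n) < e" by blast
  qed
  have "(\<lambda>n. embed_tensor (T n)) \<longlonglongrightarrow> abs_tensor T"
  proof (rule LIMSEQ_I)
    fix e :: real assume e: "0 < e"
    then obtain M where M: "\<And>m n. m \<ge> M \<Longrightarrow> n \<ge> M \<Longrightarrow> spatial_norm (T m - T n) < e / 2"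
      using CT unfolding spatial_Cauchy_def by (meson half_gt_zero)
    have "norm (embed_tensor (T n) - abs_tensor T) < e" if "n \<ge> M" for n
    proof -
      have "norm (abs_tensor T - embed_tensor (T n)) \<le> e / 2"
        using M that by (intro norm_diff_embed[OF CT, of M]) (auto intro: less_imp_le)
      then show ?thesis using e by (simp add: norm_minus_commute)
    qed
    then show "\<exists>M. \<forall>n\<ge>M. norm (embed_tensor (T n) - abs_tensor T) < e" by blast
  qed
  then have "(\<lambda>n. (S n - embed_tensor (T n)) + embed_tensor (T n)) \<longlonglongrightarrow> 0 + abs_tensor T"
    by (intro tendsto_add null)
  then show "convergent S" by (auto simp: convergent_def)
qed

definition tensor_prod :: "'a::cstar_algebra \<Rightarrow> 'b::cstar_algebra \<Rightarrow> ('a, 'b) tensor"  (infix \<open>\<otimes>\<close> 72)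
  where "a \<otimes> b = embed_tensor (simple_tensor a b)"

lemma embed_tensor_simps:
  "embed_tensor (s + t) = embed_tensor s + embed_tensor t"
  "embed_tensor (s * t) = embed_tensor s * embed_tensor t"
  "embed_tensor (star t) = star (embed_tensor t)"
  "embed_tensor (c *\<^sub>C t) = c *\<^sub>C embed_tensor t"
  "embed_tensor 1 = 1"
  "embed_tensor 0 = 0"
  by (simp_all add: embed_tensor_def plus_tensor.abs_eq times_tensor.abs_eq star_tensor.abs_eq
      scaleC_tensor.abs_eq one_tensor_def zero_tensor_def tensor_eq_refl)

lemma tensor_prod_mult: "(a \<otimes> b) * (c \<otimes> d) = (a * c) \<otimes> (b * d)"
  and tensor_prod_star: "star (a \<otimes> b) = star a \<otimes> star b"
  and tensor_prod_one: "1 \<otimes> 1 = 1"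
  by (simp_all add: tensor_prod_def simple_tensor_simps flip: embed_tensor_simps)

lemma cbilinear_tensor_prod: "cbilinear (\<otimes>)"
  by (rule cbilinearI) (simp_all add: tensor_prod_def simple_tensor_simps flip: embed_tensor_simps)

lemma norm_tensor_prod_le: "norm (a \<otimes> b) \<le> norm a * norm b"
  by (simp add: tensor_prod_def spatial_norm_simple)

lemma tensor_prod_dense: "closure (complex_vector.span {a \<otimes> b | a b. True}) = UNIV"
proof -
  have mem: "embed_tensor t \<in> complex_vector.span {a \<otimes> b | a b. True}" for t :: "('a, 'b) alg_tensor"
  proof (induction t rule: alg_tensor_induct)
    case (add a b t)
    have "a \<otimes> b \<in> complex_vector.span {a \<otimes> b | a b. True}"
      by (rule complex_vector.span_base) blast
    then show ?case
      unfolding embed_tensor_simps tensor_prod_def[symmetric]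
      using add by (rule complex_vector.span_add)
  qed (simp add: embed_tensor_simps complex_vector.span_zero)
  have "\<exists>y \<in> complex_vector.span {a \<otimes> b | a b. True}. dist y x < e" if e: "0 < e"
    for e :: real and x :: "('a, 'b) tensor"
  proof -
    obtain t where "norm (x - embed_tensor t) \<le> e / 2" using embed_tensor_dense[of "e / 2" x] e by auto
    then show ?thesis using e mem[of t]
      by (intro bexI[of _ "embed_tensor t"]) (auto simp: dist_norm norm_minus_commute)
  qed
  then show ?thesis by (auto simp: closure_approachable)
qed

section \<open>Maps on tensor products\<close>

definition bounded_clinear :: "('a::cstar_algebra \<Rightarrow> 'b::cstar_algebra) \<Rightarrow> bool"
  where "bounded_clinear f \<longleftrightarrow> clinear f \<and> (\<exists>K. \<forall>x. norm (f x) \<le> K * norm x)"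

text \<open>There is at most one such \<open>F\<close>, see \<open>tensor_lift_eq\<close> below. It exists in all uses made
  below: for products of states, for slice maps of states and for tensor products of
  *-homomorphisms.\<close>

definition tensor_lift ::
  "('a::cstar_algebra \<Rightarrow> 'b::cstar_algebra \<Rightarrow> 'c::cstar_algebra) \<Rightarrow> ('a, 'b) tensor \<Rightarrow> 'c"
  where "tensor_lift \<beta> = (THE F. bounded_clinear F \<and> (\<forall>a b. F (a \<otimes> b) = \<beta> a b))"

lemma bounded_clinear_bounded_linear:
  assumes "bounded_clinear f"
  shows "bounded_linear f"
proof -
  obtain K where "clinear f" "\<And>x. norm (f x) \<le> K * norm x"
    using assms by (auto simp: bounded_clinear_def)
  then show ?thesis
    by (intro bounded_linear_intro[of f K]) (simp_all add: clinear_simps scaleR_scaleC mult.commute)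
qed

lemma bounded_clinear_unique:
  assumes F: "bounded_clinear F" and G: "bounded_clinear G"
    and eq: "\<And>a b. F (a \<otimes> b) = G (a \<otimes> b)"
  shows "F = G"
proof
  fix x
  have lin: "clinear F" "clinear G" using F G by (auto simp: bounded_clinear_def)
  have "F y = G y" if "y \<in> complex_vector.span {a \<otimes> b | a b. True}" for y
    using that by (induction rule: complex_vector.span_induct_alt) (auto simp: clinear_simps[OF lin(1)] clinear_simps[OF lin(2)] eq)
  moreover have "closed {y. F y = G y}"
    using F G by (intro closed_Collect_eq) (simp_all add: bounded_clinear_bounded_linear linear_continuous_on)
  ultimately have "closure (complex_vector.span {a \<otimes> b | a b. True}) \<subseteq> {y. F y = G y}"
    by (intro closure_minimal) auto
  then show "F x = G x" unfolding tensor_prod_dense by blast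
qed

lemma tensor_lift_eq:
  assumes "bounded_clinear F" "\<And>a b. F (a \<otimes> b) = \<beta> a b"
  shows "tensor_lift \<beta> = F"
  unfolding tensor_lift_def using assms
  by (intro the_equality) (auto intro: bounded_clinear_unique)

definition tensor_map :: "('a::cstar_algebra \<Rightarrow> 'c::cstar_algebra) \<Rightarrow> ('b::cstar_algebra \<Rightarrow> 'd::cstar_algebra)
    \<Rightarrow> ('a, 'b) tensor \<Rightarrow> ('c, 'd) tensor"
  where "tensor_map f g = tensor_lift (\<lambda>a b. f a \<otimes> g b)"

definition tensor_functional :: "('a::cstar_algebra \<Rightarrow> complex) \<Rightarrow> ('b::cstar_algebra \<Rightarrow> complex)
    \<Rightarrow> ('a, 'b) tensor \<Rightarrow> complex"
  where "tensor_functional \<phi> \<psi> = tensor_lift (\<lambda>a b. \<phi> a * \<psi> b)"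

text \<open>\<open>slice_left \<phi>\<close> is \<open>\<phi> \<otimes> id\<close> and \<open>slice_right \<psi>\<close> is \<open>id \<otimes> \<psi>\<close>.\<close>

definition slice_left :: "('a::cstar_algebra \<Rightarrow> complex) \<Rightarrow> ('a, 'b::cstar_algebra) tensor \<Rightarrow> 'b"
  where "slice_left \<phi> = tensor_lift (\<lambda>a b. \<phi> a *\<^sub>C b)"

definition slice_right :: "('b::cstar_algebra \<Rightarrow> complex) \<Rightarrow> ('a::cstar_algebra, 'b) tensor \<Rightarrow> 'a"
  where "slice_right \<psi> = tensor_lift (\<lambda>a b. \<psi> b *\<^sub>C a)"

text \<open>\<open>s\<close> and \<open>t\<close> are identified under the canonical isomorphism
  \<open>(A \<otimes> B) \<otimes> C \<cong> A \<otimes> (B \<otimes> C)\<close>. This isomorphism is isometric, so its graph is the closure of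
  the graph of its restriction to the algebraic tensor products. The real span used here is also the
  complex span, since complex scalars can be absorbed into \<open>a\<close>.\<close>

definition assoc_eq :: "(('a::cstar_algebra, 'b::cstar_algebra) tensor, 'c::cstar_algebra) tensor
    \<Rightarrow> ('a, ('b, 'c) tensor) tensor \<Rightarrow> bool"
  where "assoc_eq s t \<longleftrightarrow>
    (s, t) \<in> closure (span {((a \<otimes> b) \<otimes> c, a \<otimes> (b \<otimes> c)) | a b c. True})"

section \<open>Compact quantum groups and their actions\<close>

definition compact_quantum_group :: "('a::cstar_algebra \<Rightarrow> ('a, 'a) tensor) \<Rightarrow> bool"
  where "compact_quantum_group \<Delta> \<longleftrightarrow> unital_star_hom \<Delta>
    \<and> (\<forall>a. assoc_eq (tensor_map \<Delta> id (\<Delta> a)) (tensor_map id \<Delta> (\<Delta> a)))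
    \<and> closure (complex_vector.span {\<Delta> a * (1 \<otimes> b) | a b. True}) = UNIV
    \<and> closure (complex_vector.span {\<Delta> a * (b \<otimes> 1) | a b. True}) = UNIV"

text \<open>There is at most one such state \<open>h\<close>: for a second one \<open>h'\<close>, both \<open>h a\<close> and \<open>h' a\<close>
  equal \<open>(h \<otimes> h')(\<Delta> a)\<close>.\<close>

definition haar_state :: "('a::cstar_algebra \<Rightarrow> ('a, 'a) tensor) \<Rightarrow> ('a \<Rightarrow> complex) \<Rightarrow> bool"
  where "haar_state \<Delta> h \<longleftrightarrow> state h
    \<and> (\<forall>a. slice_left h (\<Delta> a) = h a *\<^sub>C 1 \<and> slice_right h (\<Delta> a) = h a *\<^sub>C 1)"

text \<open>The algebra \<open>C(X)\<close> of a compact space \<open>X\<close> is the type \<open>'x \<Rightarrow>\<^sub>C complex\<close>, boundedness being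
  automatic.\<close>

definition cqg_action :: "('a::cstar_algebra \<Rightarrow> ('a, 'a) tensor)
    \<Rightarrow> (('x::topological_space \<Rightarrow>\<^sub>C complex) \<Rightarrow> ('x \<Rightarrow>\<^sub>C complex, 'a) tensor) \<Rightarrow> bool"
  where "cqg_action \<Delta> \<alpha> \<longleftrightarrow> unital_star_hom \<alpha>
    \<and> (\<forall>b. assoc_eq (tensor_map \<alpha> id (\<alpha> b)) (tensor_map id \<Delta> (\<alpha> b)))
    \<and> closure (complex_vector.span {\<alpha> b * (1 \<otimes> a) | b a. True}) = UNIV"

definition ergodic :: "(('x::topological_space \<Rightarrow>\<^sub>C complex) \<Rightarrow> ('x \<Rightarrow>\<^sub>C complex, 'a::cstar_algebra) tensor) \<Rightarrow> bool"
  where "ergodic \<alpha> \<longleftrightarrow> {b. \<alpha> b = b \<otimes> 1} = {c *\<^sub>C 1 | c. True}"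

definition ev :: "'x::topological_space \<Rightarrow> ('x \<Rightarrow>\<^sub>C complex) \<Rightarrow> complex"
  where "ev x b = apply_bcontfun b x"

definition orbit :: "('a::cstar_algebra \<Rightarrow> complex)
    \<Rightarrow> (('x::topological_space \<Rightarrow>\<^sub>C complex) \<Rightarrow> ('x \<Rightarrow>\<^sub>C complex, 'a) tensor) \<Rightarrow> 'x \<Rightarrow> 'x set"
  where "orbit h \<alpha> x = {x'. tensor_functional (ev x) h \<circ> \<alpha> = tensor_functional (ev x') h \<circ> \<alpha>}"

end

theory Submission
  imports Defs
begin

text \<open>Let \<open>E = (id \<otimes> h) \<circ> \<alpha>\<close>, so that \<open>x'\<close> lies in the orbit of \<open>x\<close> iff \<open>E b x = E b x'\<close> for all \<open>b\<close>.
  Coassociativity and invariance of \<open>h\<close> give \<open>\<alpha> (E b) = E b \<otimes> 1\<close>, and \<open>E b = b\<close> whenever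
  \<open>\<alpha> b = b \<otimes> 1\<close>. Hence \<open>E\<close> projects onto the fixed points, and ergodicity means that every \<open>E b\<close> is
  constant.

  The slice maps and tensor products of homomorphisms in this argument are defined by \<open>THE\<close>, so they
  carry no information before they are shown to exist as bounded maps for the spatial norm. Homomorphisms
  are handled by polarisation: \<open>u \<mapsto> (\<phi> \<otimes> \<psi>)(z (f \<otimes> g)(u) y)\<close> is a combination of product states, and a
  bound by any multiple of the spatial norm improves to a contraction on powers of \<open>t\<^sup>* t\<close>. Slice maps
  need a state \<open>\<phi>\<close> with \<open>(norm a)\<^sup>2 \<le> 4 \<phi>(a\<^sup>* a)\<close>. It comes from the Hahn-Banach theorem for the sublinear
  function \<open>inf\<^sub>r (norm (r + x) - r)\<close>, whose linear minorants are positive because that function is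
  at most 0 at every \<open>- a\<^sup>* a\<close>.\<close>

section \<open>Positivity in C*-algebras\<close>

lemma star_scaleR: "star (r *\<^sub>R x) = r *\<^sub>R star (x::'a::cstar_algebra)"
  by (simp add: scaleR_scaleC star_scaleC)

lemma norm_one_cstar: "(1::'a::cstar_algebra) \<noteq> 0 \<Longrightarrow> norm (1::'a) = 1"
  using cstar_identity[of "1::'a"] by (simp add: power2_eq_square)

lemma norm_square_selfadjoint:
  fixes x :: "'a::cstar_algebra"
  assumes "star x = x"
  shows "norm (x * x) = (norm x)\<^sup>2"
  using cstar_identity[of x] assms by simp

lemma norm_power_two_power_selfadjoint:
  fixes x :: "'a::cstar_algebra"
  assumes "star x = x"
  shows "norm (x ^ (2 ^ k)) = norm x ^ (2 ^ k)"
proof (induction k)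
  case (Suc k)
  have "star (x ^ n) = x ^ n" for n
    by (induction n) (simp_all add: star_mult assms power_commutes)
  then have "norm (x ^ (2 ^ k) * x ^ (2 ^ k)) = (norm (x ^ (2 ^ k)))\<^sup>2"
    by (rule norm_square_selfadjoint)
  then show ?case
    by (simp add: Suc mult_2 power_add power2_eq_square)
qed simp

text \<open>The root is \<open>1 - s\<close> for a fixed point \<open>s\<close> of
  \<open>f s = (c + s * s) / 2\<close>, since then \<open>s * s - 2 *\<^sub>R s = - c\<close>.
  Banach's theorem runs in a closed set of self-adjoint elements commuting with \<open>x\<close>, so
  the root inherits these properties without any functional calculus.\<close>

lemma cstar_sqrt:
  fixes c :: "'a::cstar_algebra"
  assumes c: "star c = c" "norm c < 1" "c * x = x * c"
  obtains w where "star w = w" "w * x = x * w" "w * w = 1 - c"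
proof -
  \<comment> \<open>With \<open>\<sigma> * \<sigma> = norm c\<close> the map \<open>f\<close> sends
    the ball of radius \<sigma> into the ball of radius \<open>norm c \<le> \<sigma>\<close>, and
    \<sigma> < 1 is also its Lipschitz constant there.\<close>
  define \<sigma> where "\<sigma> = sqrt (norm c)"
  have \<sigma>: "0 \<le> \<sigma>" "\<sigma> < 1" "\<sigma> * \<sigma> = norm c" "norm c \<le> \<sigma>"
    using c(2) by (simp_all add: \<sigma>_def real_less_lsqrt sqrt_le_D real_le_rsqrt power2_eq_square mult_left_le)
  define S where "S = {s. norm s \<le> \<sigma> \<and> star s = s \<and> s * x = x * s}"
  define f where "f s = (1/2) *\<^sub>R (c + s * s)" for s
  have "closed S"
    unfolding S_def
    by (intro closed_Collect_conj closed_Collect_le closed_Collect_eq continuous_intros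
        linear_continuous_on[OF bounded_linear_star])
  then have "\<exists>!s\<in>S. f s = s"
  proof (intro Banach_fix[OF _ _ \<sigma>(1,2)])
    show "complete S" using \<open>closed S\<close> by (simp add: complete_eq_closed)
    show "S \<noteq> {}" using \<sigma> by (auto simp: S_def intro!: exI[of _ 0])
    show "f ` S \<subseteq> S"
    proof
      fix t assume "t \<in> f ` S"
      then obtain s where s: "norm s \<le> \<sigma>" "star s = s" "s * x = x * s" and t: "t = f s"
        by (auto simp: S_def)
      have "norm (c + s * s) \<le> norm c + norm s * norm s"
        using norm_triangle_ineq norm_mult_ineq by (smt (verit))
      also have "\<dots> \<le> 2 * norm c"
        using s(1) \<sigma> mult_mono[of "norm s" \<sigma> "norm s" \<sigma>] by simp
      finally have "norm t \<le> \<sigma>" using \<sigma> by (simp add: t f_def)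
      moreover have "t * x = x * t"
        by (simp add: t f_def distrib_left distrib_right c(3)) (metis s(3) mult.assoc)
      ultimately show "t \<in> S"
        by (simp add: S_def t f_def star_scaleR star_add star_mult s c)
    qed
    fix s t assume st: "s \<in> S" "t \<in> S"
    have "f s - f t = (1/2) *\<^sub>R (s * (s - t) + (s - t) * t)"
      by (simp add: f_def algebra_simps)
    then have "norm (f s - f t) \<le> (norm (s * (s - t)) + norm ((s - t) * t)) / 2"
      using norm_triangle_ineq[of "s * (s - t)" "(s - t) * t"] by simp
    also have "\<dots> \<le> (\<sigma> * norm (s - t) + norm (s - t) * \<sigma>) / 2"
      using st by (intro divide_right_mono add_mono order_trans[OF norm_mult_ineq] mult_mono)
        (auto simp: S_def \<sigma>)
    finally show "dist (f s) (f t) \<le> \<sigma> * dist s t" by (simp add: dist_norm)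
  qed
  then obtain s where s: "star s = s" "s * x = x * s" "f s = s" by (auto simp: S_def)
  have "c + s * s = 2 *\<^sub>R s" using s(3) by (metis f_def scaleR_half_double scaleR_2 scaleR_scaleR
        scaleR_one nonzero_mult_div_cancel_left zero_neq_numeral times_divide_eq_right mult.right_neutral)
  then have "(1 - s) * (1 - s) = 1 - c" by (simp add: algebra_simps scaleR_2)
  then show thesis using s that[of "1 - s"] by (simp add: star_diff algebra_simps)
qed

text \<open>For self-adjoint \<open>x\<close> this is the largest point of the spectrum; it is sublinear without any
  spectral theory. In the zero algebra it is a junk value.\<close>

definition spec_top :: "'a::cstar_algebra \<Rightarrow> real"
  where "spec_top x = (INF r\<in>{0..}. norm (r *\<^sub>R 1 + x) - r)"

section \<open>Subadditivity of \<open>spec_top\<close> and its values on squares\<close>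

context
  assumes nz: "(1::'a::cstar_algebra) \<noteq> 0"
begin

lemma spec_top_bdd: "bdd_below ((\<lambda>r. norm (r *\<^sub>R 1 + x) - r) ` {0..})" for x :: 'a
proof (rule bdd_belowI2)
  fix r :: real assume "r \<in> {0..}"
  then have "norm (r *\<^sub>R (1::'a)) = r" by (simp add: norm_one_cstar nz)
  moreover have "norm (r *\<^sub>R (1::'a)) \<le> norm (r *\<^sub>R 1 + x) + norm x"
    using norm_triangle_ineq4[of "r *\<^sub>R 1 + x" x] by simp
  ultimately show "- norm x \<le> norm (r *\<^sub>R 1 + x) - r" by simp
qed

lemma spec_top_le: "0 \<le> r \<Longrightarrow> norm (r *\<^sub>R 1 + x) \<le> r + e \<Longrightarrow> spec_top x \<le> e" for x :: 'a
  unfolding spec_top_def by (rule cINF_lower2[OF spec_top_bdd, of r]) auto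

lemma spec_top_less:
  fixes x :: 'a
  assumes "spec_top x < e"
  obtains r where "0 \<le> r" "norm (r *\<^sub>R 1 + x) < r + e"
  using assms cINF_less_iff[OF _ spec_top_bdd, of x e] unfolding spec_top_def by force

lemma spec_top_le_norm: "spec_top x \<le> norm x" for x :: 'a
  by (rule spec_top_le[of 0]) simp_all

lemma spec_top_add: "spec_top (x + y) \<le> spec_top x + spec_top y" for x y :: 'a
proof (rule field_le_epsilon)
  fix e :: real assume e: "0 < e"
  obtain r where r: "0 \<le> r" "norm (r *\<^sub>R 1 + x) < r + (spec_top x + e / 2)"
    by (rule spec_top_less[of x "spec_top x + e / 2"]) (use e in auto)
  obtain s where s: "0 \<le> s" "norm (s *\<^sub>R 1 + y) < s + (spec_top y + e / 2)"
    by (rule spec_top_less[of y "spec_top y + e / 2"]) (use e in auto)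
  have "(r + s) *\<^sub>R 1 + (x + y) = (r *\<^sub>R 1 + x) + (s *\<^sub>R 1 + y)" by (simp add: algebra_simps)
  then have "norm ((r + s) *\<^sub>R 1 + (x + y)) \<le> norm (r *\<^sub>R 1 + x) + norm (s *\<^sub>R 1 + y)"
    by (metis norm_triangle_ineq)
  then show "spec_top (x + y) \<le> spec_top x + spec_top y + e"
    using r s by (intro spec_top_le[of "r + s"]) auto
qed

lemma spec_top_scaleR:
  fixes x :: 'a
  assumes "0 \<le> c"
  shows "spec_top (c *\<^sub>R x) = c * spec_top x"
proof -
  have le: "spec_top (c *\<^sub>R x) \<le> c * spec_top x" if c: "0 < c" for c and x :: 'a
  proof (rule field_le_epsilon)
    fix e :: real assume e: "0 < e"
    obtain r where r: "0 \<le> r" "norm (r *\<^sub>R 1 + x) < r + (spec_top x + e / c)"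
      by (rule spec_top_less[of x "spec_top x + e / c"]) (use e c in auto)
    have "norm ((c * r) *\<^sub>R 1 + c *\<^sub>R x) = c * norm (r *\<^sub>R 1 + x)"
      using c norm_scaleR[of c "r *\<^sub>R 1 + x"] by (simp add: scaleR_add_right)
    also have "\<dots> \<le> c * (r + (spec_top x + e / c))" using r c by simp
    finally show "spec_top (c *\<^sub>R x) \<le> c * spec_top x + e"
      using r c by (intro spec_top_le[of "c * r"]) (auto simp: algebra_simps)
  qed
  show ?thesis
  proof (cases "c = 0")
    case True
    have "spec_top (0::'a) = 0"
      unfolding spec_top_def by (simp add: norm_one_cstar nz cong: INF_cong_simp)
    with True show ?thesis by simp
  next
    case False
    then have c: "0 < c" using assms by simp
    have "spec_top x \<le> inverse c * spec_top (c *\<^sub>R x)"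
      using le[of "inverse c" "c *\<^sub>R x"] c by simp
    then have "c * spec_top x \<le> spec_top (c *\<^sub>R x)" using c by (simp add: field_simps)
    with le[OF c, of x] show ?thesis by simp
  qed
qed

lemma spec_top_zero: "spec_top (0::'a) = 0"
  using spec_top_scaleR[of 0 0] by simp

text \<open>\<open>1 - s x\<^sup>2\<close> is the real part of \<open>u = 1 + i t x - s x\<^sup>2\<close>, where \<open>s = t\<^sup>2 / 2\<close>, and
  \<open>u\<^sup>* u = 1 + s\<^sup>2 x\<^sup>4\<close>.\<close>

lemma spec_top_minus_square:
  fixes x :: 'a
  assumes x: "star x = x"
  shows "spec_top (- (x * x)) \<le> 0"
proof (rule field_le_epsilon)
  fix e :: real assume e: "0 < e"
  define K where "K = (norm x)^4"
  define s where "s = e / (K + 1)"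
  have K: "0 \<le> K" by (simp add: K_def)
  then have s: "0 < s" "s * K \<le> e" using e by (simp_all add: s_def field_simps)
  define t where "t = sqrt (2 * s)"
  have t: "t * t = 2 * s" using s by (simp add: t_def)
  define v where "v = 1 - s *\<^sub>R (x * x)"
  define u where "u = v + \<i> *\<^sub>C (t *\<^sub>R x)"
  have v: "star v = v" by (simp add: v_def star_diff star_scaleR star_mult x)
  have su: "star u = v - \<i> *\<^sub>C (t *\<^sub>R x)"
    by (simp add: u_def star_add v star_scaleC star_scaleR x)
  have vx: "v * x = x * v" by (simp add: v_def algebra_simps)
  have "star u * u = v * v + (t * t) *\<^sub>R (x * x)"
    unfolding su unfolding u_def
    by (simp add: algebra_simps scaleC_simps scaleR_scaleC vx scaleC_one)
  also have "\<dots> = 1 + (s * s) *\<^sub>R ((x * x) * (x * x))"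
    by (simp add: v_def t algebra_simps flip: scaleR_add_left)
  finally have "(norm u)\<^sup>2 \<le> 1 + norm ((s * s) *\<^sub>R ((x * x) * (x * x)))"
    using norm_triangle_ineq[of 1 "(s * s) *\<^sub>R ((x * x) * (x * x))"]
    by (simp add: norm_one_cstar nz flip: cstar_identity)
  also have "norm ((s * s) *\<^sub>R ((x * x) * (x * x))) = s * s * K"
    using norm_square_selfadjoint[OF x] norm_square_selfadjoint[of "x * x"] s
    by (simp add: star_mult x K_def mult.assoc flip: power_mult)
  also have "1 + s * s * K \<le> (1 + s * e)\<^sup>2"
  proof -
    have "s * s * K \<le> s * e" using s by (simp add: mult.assoc)
    also have "\<dots> \<le> 2 * (s * e)" using s e by simp
    finally show ?thesis by (simp add: power2_sum add_increasing)
  qed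
  finally have "norm u \<le> 1 + s * e" by (rule power2_le_imp_le) (use s e in auto)
  moreover have "norm (u + star u) \<le> 2 * norm u"
    using norm_triangle_ineq[of u "star u"] by simp
  moreover have "u + star u = 2 *\<^sub>R v" unfolding su by (simp add: u_def scaleR_2)
  ultimately have "norm v \<le> 1 + s * e" by simp
  \<comment> \<open>Multiplying by \<open>inverse s\<close> makes \<open>r = inverse s\<close> the
    witness for the infimum, and the error \<open>s * e\<close> becomes \<open>e\<close>.\<close>
  then have "norm ((inverse s) *\<^sub>R v) \<le> inverse s + e"
    using s by (simp add: field_simps)
  then show "spec_top (- (x * x)) \<le> 0 + e"
    using s by (intro spec_top_le[of "inverse s"]) (auto simp: v_def scaleR_diff_right)
qed

text \<open>The condition \<open>spec_top (- v) \<le> 0\<close> expresses that \<open>v\<close> is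
  positive. It provides \<open>r\<close> with \<open>norm (r *\<^sub>R 1 - v) < r + d\<close>, so
  \<open>v + d *\<^sub>R 1\<close> is \<open>r + d\<close> times some \<open>1 - c\<close> with
  \<open>norm c < 1\<close>, to which \<open>cstar_sqrt\<close> applies.\<close>

lemma spec_top_nonpos_sqrt:
  fixes v :: 'a
  assumes v: "star v = v" "spec_top (- v) \<le> 0" "v * x = x * v" and d: "0 < d"
  obtains w where "star w = w" "w * x = x * w" "w * w = v + d *\<^sub>R 1"
proof -
  obtain r where r: "0 \<le> r" "norm (r *\<^sub>R 1 + - v) < r + d"
    by (rule spec_top_less[of "- v" d]) (use v d in auto)
  define c where "c = inverse (r + d) *\<^sub>R (r *\<^sub>R 1 - v)"
  have rd: "0 < r + d" using r d by simp
  have "norm c = norm (r *\<^sub>R 1 - v) / (r + d)" using rd by (simp add: c_def divide_inverse)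
  then have "norm c < 1" using r rd by simp
  moreover have "star c = c" by (simp add: c_def star_scaleR star_diff v)
  moreover have "c * x = x * c" by (simp add: c_def algebra_simps v)
  ultimately obtain w where w: "star w = w" "w * x = x * w" "w * w = 1 - c" using cstar_sqrt by metis
  let ?k = "sqrt (r + d)"
  have "(?k *\<^sub>R w) * (?k *\<^sub>R w) = (r + d) *\<^sub>R (1 - c)"
    using rd by (simp add: w)
  also have "\<dots> = (r + d) *\<^sub>R 1 - (r *\<^sub>R 1 - v)"
    using rd by (simp add: c_def scaleR_diff_right[of "r + d" 1])
  also have "\<dots> = v + d *\<^sub>R 1" by (simp add: scaleR_add_left)
  finally show thesis using that[of "?k *\<^sub>R w"] w by (simp add: star_scaleR)
qed

text \<open>A root \<open>w\<close> of \<open>v + d *\<^sub>R 1\<close> that commutes with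
  \<open>g\<close> turns \<open>(v + d *\<^sub>R 1) * (g * g)\<close> into the square of
  \<open>w * g\<close>. The remaining term \<open>d *\<^sub>R (g * g)\<close> is as small as
  desired.\<close>

lemma spec_top_conj_nonpos:
  fixes v g :: 'a
  assumes v: "star v = v" "spec_top (- v) \<le> 0" and g: "star g = g" "v * g = g * v"
  shows "spec_top (- (v * (g * g))) \<le> 0"
proof (rule field_le_epsilon)
  fix e :: real assume e: "0 < e"
  define d where "d = e / ((norm g)\<^sup>2 + 1)"
  have d: "0 < d" "d * (norm g)\<^sup>2 \<le> e"
    using e by (auto simp: d_def divide_le_eq distrib_left add_nonneg_pos)
  obtain w where w: "star w = w" "w * g = g * w" "w * w = v + d *\<^sub>R 1"
    using spec_top_nonpos_sqrt[OF v g(2) d(1)] .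
  have "(w * g) * (w * g) = (w * w) * (g * g)" by (metis mult.assoc w(2))
  then have eq: "- (v * (g * g)) = - ((w * g) * (w * g)) + d *\<^sub>R (g * g)"
    by (simp add: w(3) algebra_simps)
  have "spec_top (- ((w * g) * (w * g))) \<le> 0"
    by (rule spec_top_minus_square) (simp add: star_mult w g)
  moreover have "spec_top (d *\<^sub>R (g * g)) \<le> d * (norm g)\<^sup>2"
    using spec_top_le_norm[of "d *\<^sub>R (g * g)"] d(1) norm_square_selfadjoint[OF g(1)] by simp
  ultimately show "spec_top (- (v * (g * g))) \<le> 0 + e"
    using spec_top_add[of "- ((w * g) * (w * g))" "d *\<^sub>R (g * g)"] d(2) unfolding eq by linarith
qed

text \<open>Let \<open>w\<close> be a root of \<open>(?m + e) *\<^sub>R 1 - a * a\<close> commuting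
  with \<open>a\<close>. Then \<open>u = a + \<i> *\<^sub>C w\<close> satisfies
  \<open>star u * u = (?m + e) *\<^sub>R 1\<close>, and \<open>a\<close> is the real part of
  \<open>u\<close>, hence no larger in norm.\<close>

lemma norm_le_spec_top_square:
  fixes a :: 'a
  assumes a: "star a = a"
  shows "(norm a)\<^sup>2 \<le> spec_top (a * a)"
proof (rule field_le_epsilon)
  fix e :: real assume e: "0 < e"
  let ?m = "spec_top (a * a)"
  define v where "v = (?m + e / 2) *\<^sub>R 1 - a * a"
  obtain r where r: "0 \<le> r" "norm (r *\<^sub>R 1 + a * a) < r + (?m + e / 2)"
    by (rule spec_top_less[of "a * a" "?m + e / 2"]) (use e in auto)
  \<comment> \<open>The witness \<open>r + (?m + e / 2)\<close> works because adding it to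
    \<open>- v\<close> gives back \<open>r *\<^sub>R 1 + a * a\<close>.\<close>
  have "spec_top (- v) \<le> 0"
  proof (rule spec_top_le)
    show "0 \<le> r + (?m + e / 2)" using r(2) norm_ge_zero[of "r *\<^sub>R 1 + a * a"] by linarith
    show "norm ((r + (?m + e / 2)) *\<^sub>R 1 + - v) \<le> r + (?m + e / 2) + 0"
      using r by (simp add: v_def scaleR_add_left)
  qed
  moreover have "star v = v" "v * a = a * v"
    by (simp_all add: v_def star_diff star_add star_scaleR star_mult a algebra_simps)
  ultimately obtain w where w: "star w = w" "w * a = a * w" "w * w = v + (e / 2) *\<^sub>R 1"
    using spec_top_nonpos_sqrt[of v a "e / 2"] e by auto
  define u where "u = a + \<i> *\<^sub>C w"
  have su: "star u = a - \<i> *\<^sub>C w" by (simp add: u_def star_add star_scaleC a w)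
  have "star u * u = a * a + w * w"
    unfolding su unfolding u_def by (simp add: algebra_simps scaleC_simps scaleC_one w(2))
  also have "\<dots> = (?m + e) *\<^sub>R 1" by (simp add: w(3) v_def flip: scaleR_add_left)
  finally have "(norm u)\<^sup>2 = \<bar>?m + e\<bar>" by (simp add: norm_one_cstar nz flip: cstar_identity)
  moreover have "norm a \<le> norm u"
  proof -
    have "2 *\<^sub>R a = u + star u" unfolding su by (simp add: u_def scaleR_2)
    then have "norm (2 *\<^sub>R a) \<le> norm u + norm (star u)" by (metis norm_triangle_ineq)
    then show ?thesis by simp
  qed
  then have "(norm a)\<^sup>2 \<le> (norm u)\<^sup>2" by (intro power_mono) auto
  \<comment> \<open>This removes the absolute value: \<open>a * a\<close> and
    \<open>- (a * a)\<close> add up to 0, and the second has nonpositive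
    \<open>spec_top\<close>.\<close>
  moreover have "0 \<le> ?m + e"
  proof -
    have "spec_top (0::'a) \<le> ?m + spec_top (- (a * a))"
      using spec_top_add[of "a * a" "- (a * a)"] by simp
    then show ?thesis using spec_top_minus_square[OF a] e spec_top_zero by linarith
  qed
  ultimately show "(norm a)\<^sup>2 \<le> ?m + e" by simp
qed

end

text \<open>For \<open>A = r + y y\<^sup>*\<close> and \<open>B = r + y\<^sup>* y\<close> the relation \<open>A\<^sup>n\<^sup>+\<^sup>1 = r A\<^sup>n + y B\<^sup>n y\<^sup>*\<close> shows that the
  powers of \<open>A\<close> exceed those of \<open>R\<close> by at most a linear factor.\<close>

lemma norm_shift_swap:
  fixes y :: "'a::cstar_algebra"
  assumes r: "0 \<le> r" "r \<le> R" "0 < R" and le: "norm (r *\<^sub>R 1 + star y * y) \<le> R"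
  shows "norm (r *\<^sub>R 1 + y * star y) \<le> R"
proof (rule ccontr)
  define A where "A = r *\<^sub>R 1 + y * star y"
  define B where "B = r *\<^sub>R 1 + star y * y"
  define D where "D = (norm y)\<^sup>2 / R"
  have AB: "A ^ n * y = y * B ^ n" for n
  proof (induction n)
    case (Suc n)
    have "A * y = y * B" by (simp add: A_def B_def algebra_simps)
    then show ?case by (metis Suc mult.assoc power_Suc)
  qed simp
  have B: "norm (B ^ n) \<le> R ^ n" for n
    using norm_pow_le[of B n] power_mono[OF le norm_ge_zero, of n] by (simp add: B_def)
  have A: "norm (A ^ n) \<le> R ^ n * (1 + n * D)" for n
  proof (induction n)
    case 0
    show ?case using norm_one_le by simp
  next
    case (Suc n)
    have "A ^ Suc n = r *\<^sub>R A ^ n + (A ^ n * y) * star y"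
      by (simp only: power_Suc2) (simp add: A_def algebra_simps)
    then have "norm (A ^ Suc n) \<le> r * norm (A ^ n) + norm (y * B ^ n * star y)"
      using norm_triangle_ineq[of "r *\<^sub>R A ^ n" "(A ^ n * y) * star y"] r by (simp add: AB)
    also have "norm (y * B ^ n * star y) \<le> norm y * R ^ n * norm y"
      using B[of n] r by (intro order_trans[OF norm_mult_ineq] mult_mono) auto
    also have "r * norm (A ^ n) \<le> R * (R ^ n * (1 + n * D))"
      using r Suc by (intro mult_mono) auto
    also have "R * (R ^ n * (1 + n * D)) + norm y * R ^ n * norm y = R ^ Suc n * (1 + Suc n * D)"
      using r by (simp add: D_def field_simps power2_eq_square)
    finally show ?case by simp
  qed
  define q where "q = norm A / R"
  have "star A = A" by (simp add: A_def star_add star_scaleR star_mult star_star)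
  \<comment> \<open>Along powers of 2 self-adjointness replaces \<open>norm (A ^ n)\<close> by
    \<open>norm A ^ n\<close>.\<close>
  then have q_le: "q ^ (2 ^ k) \<le> 1 + 2 ^ k * D" for k
    using A[of "2 ^ k"] r
    by (simp add: norm_power_two_power_selfadjoint q_def power_divide divide_le_eq mult.commute)
  assume "\<not> norm (r *\<^sub>R 1 + y * star y) \<le> R"
  then have q: "1 < q" using r by (simp add: q_def A_def)
  have D: "0 \<le> D" using r by (simp add: D_def)
  obtain k where k: "(1 + 2 * D) / (q - 1)\<^sup>2 < 2 ^ k" using real_arch_pow[of 2] by auto
  let ?m = "2 ^ k :: nat"
  \<comment> \<open>Bernoulli's inequality is squared to obtain quadratic growth in
    \<open>?m\<close>, which beats the linear bound \<open>q_le\<close> at exponent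
    \<open>2 * ?m\<close>.\<close>
  have "(?m * (q - 1))\<^sup>2 \<le> (q ^ ?m)\<^sup>2"
    using Bernoulli_inequality[of "q - 1" ?m] q by (intro power_mono) auto
  also have "\<dots> \<le> 1 + 2 * (?m * D)"
    using q_le[of "Suc k"] by (simp add: mult.commute flip: power_mult)
  also have "\<dots> \<le> ?m * (1 + 2 * D)"
    by (simp add: distrib_left)
  finally have "?m * (q - 1)\<^sup>2 \<le> 1 + 2 * D"
    by (simp add: power_mult_distrib power2_eq_square mult_ac)
  then show False using k q by (simp add: divide_less_eq)
qed

section \<open>Positivity of \<open>star y * y\<close>\<close>

context
  assumes nz: "(1::'a::cstar_algebra) \<noteq> 0"
begin

text \<open>The spectra of \<open>star y * y\<close> and \<open>y * star y\<close> agree away from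
  0. The norm comparison of their shifts, used with \<open>R = r + (e + d)\<close>, replaces that
  fact; \<open>0 \<le> e\<close> ensures \<open>r \<le> R\<close>.\<close>

lemma spec_top_swap:
  fixes y :: 'a
  assumes "spec_top (star y * y) \<le> e" "0 \<le> e"
  shows "spec_top (y * star y) \<le> e"
proof (rule field_le_epsilon)
  fix d :: real assume d: "0 < d"
  obtain r where r: "0 \<le> r" "norm (r *\<^sub>R 1 + star y * y) < r + (e + d)"
    by (rule spec_top_less[OF nz, of "star y * y" "e + d"]) (use assms d in auto)
  then have "norm (r *\<^sub>R 1 + y * star y) \<le> r + (e + d)"
    using assms d by (intro norm_shift_swap) auto
  then show "spec_top (y * star y) \<le> e + d" using r(1) by (intro spec_top_le[OF nz])
qed

text \<open>Write \<open>y = a + \<i> *\<^sub>C b\<close> with self-adjoint parts. Then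
  \<open>a * a + b * b\<close> is the mean of \<open>star y * y\<close> and
  \<open>y * star y\<close>, and dropping either square only increases \<open>spec_top\<close>, so
  \<open>a\<close> and \<open>b\<close> have norm at most \<open>sqrt e\<close>. The maximum with 0
  appears because positivity of \<open>star y * y\<close> is only derived from this estimate
  below.\<close>

lemma norm_le_spec_top:
  fixes y :: 'a
  shows "(norm y)\<^sup>2 \<le> 4 * max 0 (spec_top (star y * y))"
proof -
  define e where "e = max 0 (spec_top (star y * y))"
  define a where "a = (1/2) *\<^sub>R (y + star y)"
  define b where "b = (1/2) *\<^sub>R (\<i> *\<^sub>C (star y - y))"
  have sa: "star a = a" by (simp add: a_def star_scaleR star_add star_star add.commute)
  have sb: "star b = b"
    by (simp add: b_def star_scaleR star_scaleC star_diff star_star complex_vector.scale_right_diff_distrib)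
  have ab: "a * a + b * b = (1/2) *\<^sub>R (star y * y + y * star y)"
    unfolding a_def b_def scaleR_scaleC
    by (simp add: scaleC_simps algebra_simps complex_vector.scale_right_diff_distrib)
       (simp add: algebra_simps flip: scaleC_add_left)
  have "spec_top (star y * y + y * star y) \<le> 2 * e"
    using spec_top_add[OF nz, of "star y * y" "y * star y"] spec_top_swap[of y e] by (simp add: e_def)
  then have "spec_top (a * a + b * b) \<le> e"
    unfolding ab by (simp add: spec_top_scaleR[OF nz])
  moreover have "spec_top (a * a) \<le> spec_top (a * a + b * b) + spec_top (- (b * b))"
    using spec_top_add[OF nz, of "a * a + b * b" "- (b * b)"] by simp
  moreover have "spec_top (b * b) \<le> spec_top (a * a + b * b) + spec_top (- (a * a))"
    using spec_top_add[OF nz, of "a * a + b * b" "- (a * a)"] by simp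
  ultimately have "(norm a)\<^sup>2 \<le> e" "(norm b)\<^sup>2 \<le> e"
    using norm_le_spec_top_square[OF nz sa] norm_le_spec_top_square[OF nz sb]
      spec_top_minus_square[OF nz sa] spec_top_minus_square[OF nz sb] by linarith+
  then have "norm a \<le> sqrt e" "norm b \<le> sqrt e" by (auto intro: real_le_rsqrt)
  moreover have "y = a + \<i> *\<^sub>C b"
    unfolding a_def b_def scaleR_scaleC
    by (simp add: scaleC_simps algebra_simps complex_vector.scale_right_diff_distrib)
       (simp add: scaleC_one flip: scaleC_add_left)
  then have "norm y \<le> norm a + norm b"
    using norm_triangle_ineq[of a "\<i> *\<^sub>C b"] by (simp add: norm_scaleC)
  ultimately have "norm y \<le> 2 * sqrt e" by linarith
  then have "(norm y)\<^sup>2 \<le> (2 * sqrt e)\<^sup>2" by (intro power_mono) auto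
  then show ?thesis by (simp add: e_def power_mult_distrib)
qed

lemma spec_top_one: "spec_top (1::'a) \<le> 1"
  using spec_top_le_norm[OF nz, of 1] by (simp add: norm_one_cstar nz)

lemma spec_top_minus_one: "spec_top (- 1 :: 'a) \<le> - 1"
  by (rule spec_top_le[OF nz, of 1]) simp_all

text \<open>The Chebyshev polynomial \<open>T = 4 X\<^sup>3 - 3 X\<close> satisfies \<open>1 + T = (2 X - 1)(1 + X)(2 X - 1)\<close>
  and \<open>1 - T = (1 - X)(2 X + 1)\<^sup>2\<close>, so it preserves the hypotheses on \<open>X\<close>. They bound \<open>norm X\<close> by 9,
  while iterating \<open>T\<close> expels every norm greater than 1 to infinity.\<close>

lemma norm_le_one_if_one_add_positive:
  fixes X y :: 'a
  assumes "star X = X" "1 + X = star y * y" "spec_top X \<le> 1"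
  shows "norm X \<le> 1"
proof (rule ccontr)
  \<comment> \<open>Both \<open>X\<close> and \<open>y\<close> vary in the induction: a step
    replaces them by \<open>T\<close> and \<open>y * (2 *\<^sub>R X - 1)\<close>.\<close>
  have iter: "1 + 9 ^ n * (norm X - 1) \<le> 9"
    if "star X = X" "1 + X = star y * y" "spec_top X \<le> 1" "1 < norm X" for n and X y :: 'a
    using that
  proof (induction n arbitrary: X y)
    case (0 X y)
    have "spec_top (star y * y) \<le> 2"
      using spec_top_add[OF nz, of 1 X] spec_top_one 0 by simp
    then have "(norm y)\<^sup>2 \<le> 8" using norm_le_spec_top[of y] by simp
    then have "norm (1 + X) \<le> 8" unfolding 0(2) cstar_identity .
    then show ?case
      using norm_triangle_ineq4[of "1 + X" 1] by (simp add: norm_one_cstar nz)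
  next
    case (Suc n X y)
    define T where "T = 4 *\<^sub>R (X * X * X) - 3 *\<^sub>R X"
    define g where "g = 2 *\<^sub>R X + 1"
    have T: "star T = T"
      by (simp add: T_def star_diff star_scaleR star_mult Suc.prems mult.assoc)
    have numeral: "3 *\<^sub>R z = z + z + z" "4 *\<^sub>R z = z + z + z + z" for z :: 'a
      using scaleR_left_distrib[of 2 1 z] scaleR_left_distrib[of 2 2 z] by (simp_all add: scaleR_2 add.assoc)
    have "1 + T = star (2 *\<^sub>R X - 1) * (1 + X) * (2 *\<^sub>R X - 1)"
      by (simp add: T_def star_diff star_add Suc.prems(1) algebra_simps numeral scaleR_2)
    then have T1: "1 + T = star (y * (2 *\<^sub>R X - 1)) * (y * (2 *\<^sub>R X - 1))"
      by (simp only: Suc.prems(2) star_mult mult.assoc)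
    have "spec_top (- (1 - X)) \<le> 0"
      using spec_top_add[OF nz, of X "- 1"] spec_top_minus_one Suc.prems by simp
    then have "spec_top (- ((1 - X) * (g * g))) \<le> 0"
      by (intro spec_top_conj_nonpos[OF nz])
         (auto simp: g_def star_diff star_add star_scaleR Suc.prems algebra_simps)
    moreover have "- ((1 - X) * (g * g)) = T + - 1"
      by (simp add: T_def g_def algebra_simps numeral scaleR_2)
    ultimately have T2: "spec_top T \<le> 1"
      using spec_top_add[OF nz, of "T + - 1" 1] spec_top_one by simp
    have XX: "norm (X * X) = (norm X)\<^sup>2" using Suc.prems by (simp add: norm_square_selfadjoint)
    \<comment> \<open>The fourth power has norm \<open>norm X ^ 4\<close>; cancelling one factor
      \<open>norm X\<close> bounds the norm of the cube from below.\<close>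
    have "norm ((X * X) * (X * X)) = (norm (X * X))\<^sup>2"
      by (intro norm_square_selfadjoint) (simp add: star_mult Suc.prems)
    then have "norm X ^ 3 * norm X \<le> norm (X * X * X) * norm X"
      using norm_mult_ineq[of "X * X * X" X] by (simp add: XX mult.assoc power_numeral_reduce)
    then have cube: "norm X ^ 3 \<le> norm (X * X * X)"
      by (rule mult_right_le_imp_le) (use Suc.prems in linarith)
    define t where "t = norm X"
    have "4 * t ^ 3 - 3 * t \<le> norm T"
      using norm_triangle_ineq2[of "4 *\<^sub>R (X * X * X)" "3 *\<^sub>R X"] cube by (simp add: T_def t_def)
    \<comment> \<open>Since \<open>4 * t ^ 3 - 3 * t - 1 = (2 * t + 1)\<^sup>2 * (t - 1)\<close>,
      the excess of the norm over 1 grows at least ninefold when \<open>X\<close> becomes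
      \<open>T\<close>.\<close>
    moreover have "9 * (t - 1) \<le> (4 * t\<^sup>2 + 4 * t + 1) * (t - 1)"
    proof (rule mult_right_mono)
      have "1 \<le> t\<^sup>2" using Suc.prems by (simp add: t_def)
      moreover have "1 < t" using Suc.prems by (simp add: t_def)
      ultimately show "9 \<le> 4 * t\<^sup>2 + 4 * t + 1" by linarith
    qed (use Suc.prems in \<open>simp add: t_def\<close>)
    then have "9 * (t - 1) \<le> 4 * t ^ 3 - 3 * t - 1"
      by (simp add: algebra_simps power2_eq_square power3_eq_cube)
    ultimately have grow: "9 * (norm X - 1) \<le> norm T - 1" by (simp add: t_def)
    then have "1 + 9 ^ n * (norm T - 1) \<le> 9"
      using Suc.prems by (intro Suc.IH[OF T T1 T2]) simp
    moreover have "9 ^ n * (9 * (norm X - 1)) \<le> 9 ^ n * (norm T - 1)"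
      by (rule mult_left_mono[OF grow]) simp
    ultimately show ?case by (simp only: power_Suc2 mult.assoc)
  qed
  assume "\<not> norm X \<le> 1"
  then have X: "1 < norm X" by simp
  obtain n where "8 / (norm X - 1) < 9 ^ n" using real_arch_pow[of 9] by auto
  with iter[OF assms X, of n] X show False by (simp add: field_simps)
qed

text \<open>Scale \<open>star y * y\<close> to norm 2 and subtract 1. The resulting \<open>X\<close>
  meets the hypotheses of \<open>norm_le_one_if_one_add_positive\<close>, and
  \<open>norm X \<le> 1\<close> bounds \<open>- X\<close> by 1, so the scaled
  \<open>- (star y * y) = - 1 - X\<close> has nonpositive \<open>spec_top\<close>.\<close>

lemma spec_top_minus_star_mult:
  fixes y :: 'a
  shows "spec_top (- (star y * y)) \<le> 0"
proof (cases "y = 0")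
  case False
  define k where "k = 2 / (norm y)\<^sup>2"
  have k: "0 < k" using False by (simp add: k_def)
  define X where "X = k *\<^sub>R (star y * y) - 1"
  have X: "star X = X" by (simp add: X_def star_diff star_scaleR star_mult star_star)
  have "1 + X = star (sqrt k *\<^sub>R y) * (sqrt k *\<^sub>R y)"
    using k by (simp add: X_def star_scaleR)
  moreover have "spec_top (k *\<^sub>R (star y * y)) \<le> 2"
    using spec_top_le_norm[OF nz, of "k *\<^sub>R (star y * y)"] k False by (simp add: cstar_identity) (simp add: k_def)
  then have "spec_top X \<le> 1"
    using spec_top_add[OF nz, of "k *\<^sub>R (star y * y)" "- 1"] spec_top_minus_one by (simp add: X_def)
  ultimately have "norm X \<le> 1" by (rule norm_le_one_if_one_add_positive[OF X])
  then have "spec_top (- X) \<le> 1" using spec_top_le_norm[OF nz, of "- X"] by simp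
  then have "spec_top (- 1 + - X) \<le> 0"
    using spec_top_add[OF nz, of "- 1" "- X"] spec_top_minus_one by simp
  moreover have "- 1 + - X = k *\<^sub>R (- (star y * y))" by (simp add: X_def)
  ultimately show ?thesis using k spec_top_scaleR[OF nz, of k "- (star y * y)"] by (simp add: mult_le_0_iff)
qed (simp add: spec_top_zero[OF nz])

end

section \<open>Existence of states\<close>

definition sublinear :: "('v::real_vector \<Rightarrow> real) \<Rightarrow> bool"
  where "sublinear q \<longleftrightarrow> (\<forall>x y. q (x + y) \<le> q x + q y) \<and> (\<forall>c>0. \<forall>x. q (c *\<^sub>R x) \<le> c * q x)"

lemma
  assumes "sublinear q"
  shows sublinear_add: "q (x + y) \<le> q x + q y"
    and sublinear_scaleR_le: "0 < c \<Longrightarrow> q (c *\<^sub>R x) \<le> c * q x"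
  using assms by (simp_all add: sublinear_def)

text \<open>Applying the inequality to \<open>inverse c\<close> as well yields equality. At 0 the
  factors 2 and 1/2 force \<open>q 0 = 0\<close>.\<close>

lemma sublinear_scaleR:
  assumes "sublinear q" "0 \<le> c"
  shows "q (c *\<^sub>R x) = c * q x"
proof (cases "c = 0")
  case True
  have "q 0 \<le> 2 * q 0" "q 0 \<le> (1/2) * q 0"
    using sublinear_scaleR_le[OF assms(1), of 2 0] sublinear_scaleR_le[OF assms(1), of "1/2" 0] by simp_all
  then show ?thesis using True by simp
next
  case False
  then have c: "0 < c" using assms by simp
  then have "q (inverse c *\<^sub>R c *\<^sub>R x) \<le> inverse c * q (c *\<^sub>R x)"
    by (intro sublinear_scaleR_le[OF assms(1)]) simp
  then have "c * q x \<le> q (c *\<^sub>R x)" using c by (simp add: field_simps)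
  with sublinear_scaleR_le[OF assms(1) c, of x] show ?thesis by simp
qed

lemma sublinear_minus: "sublinear q \<Longrightarrow> - q (- x) \<le> q x"
  using sublinear_scaleR[of q 0 0] sublinear_add[of q x "- x"] by simp

text \<open>For sublinear \<open>q\<close> this is the largest sublinear function below
  \<open>q\<close> whose value at \<open>- y\<close> is at most \<open>- q y\<close>.\<close>

definition sublinear_shift :: "('v::real_vector \<Rightarrow> real) \<Rightarrow> 'v \<Rightarrow> 'v \<Rightarrow> real"
  where "sublinear_shift q y x = (INF t\<in>{0..}. q (x + t *\<^sub>R y) - t * q y)"

context
  fixes q :: "'v::real_vector \<Rightarrow> real"
  assumes q: "sublinear q"
begin

lemma sublinear_shift_le:
  assumes "0 \<le> t"
  shows "sublinear_shift q y x \<le> q (x + t *\<^sub>R y) - t * q y"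
  unfolding sublinear_shift_def
proof (rule cINF_lower)
  show "bdd_below ((\<lambda>t. q (x + t *\<^sub>R y) - t * q y) ` {0..})"
  proof (rule bdd_belowI2)
    fix t :: real assume "t \<in> {0..}"
    then have "t * q y = q ((x + t *\<^sub>R y) + - x)" by (simp add: sublinear_scaleR[OF q])
    also have "\<dots> \<le> q (x + t *\<^sub>R y) + q (- x)" by (rule sublinear_add[OF q])
    finally show "- q (- x) \<le> q (x + t *\<^sub>R y) - t * q y" by simp
  qed
qed (use assms in simp)

lemma sublinear_shift_less:
  assumes "sublinear_shift q y x < e"
  obtains t where "0 \<le> t" "q (x + t *\<^sub>R y) - t * q y < e"
  using assms cInf_lessD[of "(\<lambda>t. q (x + t *\<^sub>R y) - t * q y) ` {0..}" e] that
  unfolding sublinear_shift_def by auto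

lemma sublinear_shift: "sublinear (sublinear_shift q y)"
  unfolding sublinear_def
proof (intro conjI allI impI)
  fix x z
  show "sublinear_shift q y (x + z) \<le> sublinear_shift q y x + sublinear_shift q y z"
  proof (rule field_le_epsilon)
    fix e :: real assume e: "0 < e"
    obtain s where s: "0 \<le> s" "q (x + s *\<^sub>R y) - s * q y < sublinear_shift q y x + e / 2"
      by (rule sublinear_shift_less[of y x "sublinear_shift q y x + e / 2"]) (use e in auto)
    obtain t where t: "0 \<le> t" "q (z + t *\<^sub>R y) - t * q y < sublinear_shift q y z + e / 2"
      by (rule sublinear_shift_less[of y z "sublinear_shift q y z + e / 2"]) (use e in auto)
    have "sublinear_shift q y (x + z) \<le> q ((x + z) + (s + t) *\<^sub>R y) - (s + t) * q y"
      using s t by (intro sublinear_shift_le) simp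
    also have "(x + z) + (s + t) *\<^sub>R y = (x + s *\<^sub>R y) + (z + t *\<^sub>R y)" by (simp add: algebra_simps)
    also have "q ((x + s *\<^sub>R y) + (z + t *\<^sub>R y)) \<le> q (x + s *\<^sub>R y) + q (z + t *\<^sub>R y)"
      by (rule sublinear_add[OF q])
    finally show "sublinear_shift q y (x + z) \<le> sublinear_shift q y x + sublinear_shift q y z + e"
      using s t by (simp add: algebra_simps)
  qed
next
  fix c :: real and x assume c: "0 < c"
  show "sublinear_shift q y (c *\<^sub>R x) \<le> c * sublinear_shift q y x"
  proof (rule field_le_epsilon)
    fix e :: real assume e: "0 < e"
    obtain t where t: "0 \<le> t" "q (x + t *\<^sub>R y) - t * q y < sublinear_shift q y x + e / c"
      by (rule sublinear_shift_less[of y x "sublinear_shift q y x + e / c"]) (use e c in auto)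
    have "sublinear_shift q y (c *\<^sub>R x) \<le> q (c *\<^sub>R x + (c * t) *\<^sub>R y) - (c * t) * q y"
      using t c by (intro sublinear_shift_le) simp
    also have "c *\<^sub>R x + (c * t) *\<^sub>R y = c *\<^sub>R (x + t *\<^sub>R y)" by (simp add: algebra_simps)
    also have "q (c *\<^sub>R (x + t *\<^sub>R y)) - (c * t) * q y = c * (q (x + t *\<^sub>R y) - t * q y)"
      using c by (simp add: sublinear_scaleR[OF q] right_diff_distrib)
    also have "\<dots> \<le> c * (sublinear_shift q y x + e / c)" using t c by simp
    also have "\<dots> = c * sublinear_shift q y x + e" using c by (simp add: field_simps)
    finally show "sublinear_shift q y (c *\<^sub>R x) \<le> c * sublinear_shift q y x + e" .
  qed
qed

lemma sublinear_shift_le_self: "sublinear_shift q y \<le> q"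
  using sublinear_shift_le[of 0] by (auto simp: le_fun_def)

lemma sublinear_shift_minus: "sublinear_shift q y (- y) \<le> - q y"
  using sublinear_shift_le[of 1 y "- y"] sublinear_scaleR[OF q, of 0 0] by simp

end

text \<open>All members are at least \<open>- p (- x)\<close> at \<open>x\<close>, so the infimum is
  finite. For subadditivity take members nearly minimal at \<open>x\<close> and at \<open>y\<close>;
  by the chain condition the smaller one is nearly minimal at both.\<close>

lemma sublinear_INF_chain:
  assumes C: "C \<noteq> {}" "\<And>q. q \<in> C \<Longrightarrow> sublinear q \<and> q \<le> p"
    and chain: "\<And>q r. q \<in> C \<Longrightarrow> r \<in> C \<Longrightarrow> q \<le> r \<or> r \<le> q"
  shows "sublinear (\<lambda>x::'v::real_vector. INF q\<in>C. q x)" "\<And>q x. q \<in> C \<Longrightarrow> (INF q\<in>C. q x) \<le> q x"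
proof -
  let ?u = "\<lambda>x. INF q\<in>C. q x"
  show lower: "?u x \<le> q x" if "q \<in> C" for q x
  proof (rule cINF_lower[OF bdd_belowI2 that])
    fix r assume "r \<in> C"
    then have "sublinear r" "r (- x) \<le> p (- x)" using C(2) by (auto simp: le_fun_def)
    then show "- p (- x) \<le> r x" using sublinear_minus[of r x] by linarith
  qed
  have less: "\<exists>q\<in>C. q x < ?u x + e" if "0 < e" for x and e :: real
    using cInf_lessD[of "(\<lambda>q. q x) ` C" "?u x + e"] C(1) that by auto
  show "sublinear ?u"
    unfolding sublinear_def
  proof (intro conjI allI impI; rule field_le_epsilon)
    fix x y and e :: real assume "0 < e"
    then obtain q r where qr: "q \<in> C" "r \<in> C" "q x < ?u x + e / 2" "r y < ?u y + e / 2"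
      using less[of "e / 2"] by (metis half_gt_zero)
    then obtain s where s: "s \<in> C" "s x \<le> q x" "s y \<le> r y"
      using chain[of q r] by (auto simp: le_fun_def)
    have "?u (x + y) \<le> s (x + y)" by (rule lower[OF s(1)])
    also have "\<dots> \<le> s x + s y" using C(2)[OF s(1)] by (simp add: sublinear_def)
    finally show "?u (x + y) \<le> ?u x + ?u y + e" using qr s by linarith
  next
    fix c :: real and x and e :: real assume c: "0 < c" and "0 < e"
    then obtain q where q: "q \<in> C" "q x < ?u x + e / c" using less[of "e / c" x] by auto
    have "?u (c *\<^sub>R x) \<le> c * q x"
      using lower[OF q(1), of "c *\<^sub>R x"] C(2)[OF q(1)] c by (simp add: sublinear_scaleR)
    also have "\<dots> \<le> c * (?u x + e / c)" using q c by simp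
    also have "\<dots> = c * ?u x + e" using c by (simp add: distrib_left)
    finally show "?u (c *\<^sub>R x) \<le> c * ?u x + e" .
  qed
qed

text \<open>A minimal sublinear function \<open>m\<close> equals its own shifts, whence \<open>m (- y) = - m y\<close>.\<close>

theorem sublinear_ge_linear:
  fixes p :: "'v::real_vector \<Rightarrow> real"
  assumes p: "sublinear p"
  obtains f where "linear f" "\<And>x. f x \<le> p x" "f z = p z"
proof -
  \<comment> \<open>Starting below the shift by \<open>z\<close> instead of below \<open>p\<close>
    gives \<open>m (- z) \<le> - p z\<close> for the minimal \<open>m\<close>, and this forces
    \<open>m z = p z\<close> at the end.\<close>
  define F where "F = {q. sublinear q \<and> q \<le> sublinear_shift p z}"
  have "\<exists>m\<in>F. \<forall>q\<in>F. q \<le> m \<longrightarrow> q = m"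
  proof (rule predicate_Zorn[where P = "\<lambda>a b. b \<le> a"])
    show "partial_order_on F (relation_of (\<lambda>a b. b \<le> a) F)"
      by (rule partial_order_on_relation_ofI) auto
    fix C assume "C \<in> Chains (relation_of (\<lambda>a b. b \<le> a) F)"
    then have C: "C \<subseteq> F" "\<And>q r. q \<in> C \<Longrightarrow> r \<in> C \<Longrightarrow> q \<le> r \<or> r \<le> q"
      by (auto simp: Chains_def relation_of_def)
    show "\<exists>u\<in>F. \<forall>a\<in>C. u \<le> a"
    proof (cases "C = {}")
      case True
      have "sublinear_shift p z \<in> F" by (simp add: F_def sublinear_shift[OF p])
      with True show ?thesis by blast
    next
      case False
      note inf = sublinear_INF_chain[OF False, of "sublinear_shift p z"]
      have "sublinear (\<lambda>x. INF q\<in>C. q x)" "\<And>q x. q \<in> C \<Longrightarrow> (INF q\<in>C. q x) \<le> q x"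
        using inf C by (auto simp: F_def)
      moreover obtain q where "q \<in> C" "q \<le> sublinear_shift p z" using False C(1) by (auto simp: F_def)
      ultimately show ?thesis
        by (intro bexI[of _ "\<lambda>x. INF q\<in>C. q x"]) (auto simp: F_def le_fun_def intro: order_trans)
    qed
  qed
  then obtain m where m: "sublinear m" "m \<le> sublinear_shift p z"
    and min: "\<And>q. sublinear q \<Longrightarrow> q \<le> m \<Longrightarrow> q = m"
    unfolding F_def by (auto intro: order_trans)
  have neg: "m (- y) = - m y" for y
  proof -
    have "sublinear_shift m y = m" by (rule min[OF sublinear_shift[OF m(1)] sublinear_shift_le_self[OF m(1)]])
    then show ?thesis using sublinear_shift_minus[OF m(1), of y] sublinear_minus[OF m(1), of "- y"] by simp
  qed
  have sub: "m (x + y) \<le> m x + m y" for x y using m(1) by (simp add: sublinear_def)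
  have le: "m x \<le> p x" for x
    using m(2) sublinear_shift_le_self[OF p, of z] by (meson le_funD order_trans)
  show thesis
  proof (rule that[of m])
    show "linear m"
    proof (rule linearI)
      show "m (x + y) = m x + m y" for x y
        using sub[of x y] sub[of "x + y" "- y"] by (simp add: neg)
      show "m (c *\<^sub>R x) = c *\<^sub>R m x" for c x
        using sublinear_scaleR[OF m(1), of c x] sublinear_scaleR[OF m(1), of "- c" x]
        by (cases "0 \<le> c") (simp_all add: neg)
    qed
    show "m z = p z"
      using le_funD[OF m(2), of "- z"] sublinear_shift_minus[OF p, of z] le[of z] by (simp add: neg)
  qed (rule le)
qed

text \<open>A linear minorant of \<open>spec_top\<close> that attains it at
  \<open>star a * a\<close> is read on self-adjoint elements and extended complex-linearly through
  real and imaginary parts. The factor 4 comes from \<open>norm_le_spec_top\<close>.\<close>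

lemma exists_state_star_mult:
  fixes a :: "'a::cstar_algebra"
  assumes nz: "(1::'a) \<noteq> 0"
  obtains \<phi> :: "'a \<Rightarrow> complex" where "state \<phi>" "(norm a)\<^sup>2 \<le> 4 * Re (\<phi> (star a * a))"
proof -
  have "sublinear (spec_top :: 'a \<Rightarrow> real)"
    by (simp add: sublinear_def spec_top_add[OF nz] spec_top_scaleR[OF nz])
  then obtain f :: "'a \<Rightarrow> real" where f: "linear f" "\<And>x. f x \<le> spec_top x"
    "f (star a * a) = spec_top (star a * a)"
    using sublinear_ge_linear by blast
  define re where "re x = (1/2) *\<^sub>R (x + star x)" for x :: 'a
  define im where "im x = (1/2) *\<^sub>R ((- \<i>) *\<^sub>C (x - star x))" for x :: 'a
  define \<phi> where "\<phi> x = Complex (f (re x)) (f (im x))" for x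
  have add: "\<phi> (x + y) = \<phi> x + \<phi> y" for x y
  proof -
    have "re (x + y) = re x + re y" "im (x + y) = im x + im y"
      by (simp_all add: re_def im_def star_add scaleR_add_right scaleC_add_right
          complex_vector.scale_right_diff_distrib algebra_simps)
    then show ?thesis by (simp add: \<phi>_def linear_add[OF f(1)] complex_eq_iff)
  qed
  have scaleR: "\<phi> (r *\<^sub>R x) = complex_of_real r * \<phi> x" for r x
  proof -
    have "re (r *\<^sub>R x) = r *\<^sub>R re x" "im (r *\<^sub>R x) = r *\<^sub>R im x"
      by (simp_all add: re_def im_def star_scaleC scaleR_scaleC scaleC_simps
          complex_vector.scale_right_diff_distrib algebra_simps)
    then show ?thesis by (simp add: \<phi>_def linear_scale[OF f(1)] complex_eq_iff)
  qed
  have i: "\<phi> (\<i> *\<^sub>C x) = \<i> * \<phi> x" for x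
  proof -
    have "re (\<i> *\<^sub>C x) = - im x" "im (\<i> *\<^sub>C x) = re x"
      by (simp_all add: re_def im_def star_scaleC scaleR_scaleC scaleC_simps
          complex_vector.scale_right_diff_distrib algebra_simps)
    then show ?thesis by (simp add: \<phi>_def linear_neg[OF f(1)] complex_eq_iff)
  qed
  have lin: "clinear \<phi>"
  proof (rule clinearI)
    fix c and x :: 'a
    have "Re c *\<^sub>R x + Im c *\<^sub>R (\<i> *\<^sub>C x) = (complex_of_real (Re c) + complex_of_real (Im c) * \<i>) *\<^sub>C x"
      by (simp add: scaleR_scaleC scaleC_scaleC scaleC_add_left)
    also have "complex_of_real (Re c) + complex_of_real (Im c) * \<i> = c" by (simp add: complex_eq_iff)
    finally have "c *\<^sub>C x = Re c *\<^sub>R x + Im c *\<^sub>R (\<i> *\<^sub>C x)" by simp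
    then show "\<phi> (c *\<^sub>C x) = c *\<^sub>C \<phi> x"
      by (simp add: add scaleR i scaleC_complex_def complex_eq_iff)
  qed (rule add)
  have sa: "\<phi> x = complex_of_real (f x)" if "star x = x" for x
    using that by (simp add: \<phi>_def re_def im_def linear_0[OF f(1)] complex_eq_iff flip: scaleR_2)
  have star: "\<phi> (star x * x) = complex_of_real (f (star x * x))" for x
    by (rule sa) (simp add: star_mult star_star)
  have pos: "positive_functional \<phi>"
    unfolding positive_functional_def
  proof (intro conjI allI lin)
    fix x
    have "f (- (star x * x)) \<le> 0" using f(2) spec_top_minus_star_mult[OF nz] order_trans by blast
    then show "\<phi> (star x * x) \<in> \<real>\<^sub>\<ge>\<^sub>0" by (simp add: star linear_neg[OF f(1)])
  qed
  have "f 1 \<le> 1" "f (- 1) \<le> - 1"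
    using f(2) spec_top_one[OF nz] spec_top_minus_one[OF nz] order_trans by blast+
  then have one: "\<phi> 1 = 1" by (simp add: sa linear_neg[OF f(1)])
  have "cmod (\<phi> x) \<le> norm x" for x
  proof -
    have "cmod (\<phi> x) \<le> fnorm \<phi> x"
      using Cauchy_Schwarz[OF pos, of 1 x] by (simp add: fnorm_def one)
    moreover have "(fnorm \<phi> x)\<^sup>2 \<le> (norm x)\<^sup>2"
      using f(2)[of "star x * x"] spec_top_le_norm[OF nz, of "star x * x"]
      by (simp add: fnorm_sq[OF pos] star cstar_identity)
    ultimately show ?thesis by (meson norm_ge_zero order_trans power2_le_imp_le)
  qed
  then have "state \<phi>" by (simp add: state_def pos one)
  moreover have "(norm a)\<^sup>2 \<le> 4 * Re (\<phi> (star a * a))"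
  proof -
    \<comment> \<open>Positivity of \<phi> makes the \<open>max 0\<close> in
      \<open>norm_le_spec_top\<close> disappear.\<close>
    have "0 \<le> spec_top (star a * a)" using pos_real(2)[OF pos, of a] f(3) by (simp add: star)
    then show ?thesis using norm_le_spec_top[OF nz, of a] by (simp add: star f(3))
  qed
  ultimately show thesis by (rule that)
qed

section \<open>Bounded maps on the minimal tensor product\<close>

text \<open>This is the operator inequality between \<open>star a * a\<close> and
  \<open>(norm a)\<^sup>2 + e\<close> with the gap written as a square. In this form it can be
  pushed through positive functionals and homomorphisms.\<close>

lemma star_mult_add_square_eq:
  fixes a :: "'a::cstar_algebra"
  assumes "0 < e"
  obtains w where "star w = w" "star a * a + w * w = ((norm a)\<^sup>2 + e) *\<^sub>R 1"
proof -
  define k where "k = (norm a)\<^sup>2 + e"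
  have k: "0 < k" using assms by (simp add: k_def add_nonneg_pos)
  have "norm (inverse k *\<^sub>R (star a * a)) = (norm a)\<^sup>2 / k"
    using k by (simp add: cstar_identity divide_inverse mult.commute)
  also have "\<dots> < 1" using assms k by (simp add: k_def)
  finally obtain w where w: "star w = w" "w * w = 1 - inverse k *\<^sub>R (star a * a)"
    using cstar_sqrt[of "inverse k *\<^sub>R (star a * a)" 0] by (auto simp: star_scaleR star_mult star_star)
  have "(sqrt k *\<^sub>R w) * (sqrt k *\<^sub>R w) = k *\<^sub>R 1 - star a * a"
    using k by (simp add: w scaleR_diff_right flip: mult.assoc)
  then show thesis using that[of "sqrt k *\<^sub>R w"] w(1) by (simp add: star_scaleR k_def)
qed

section \<open>Automatic continuity of positive functionals and of homomorphisms\<close>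

context
  fixes g :: "'a::cstar_algebra \<Rightarrow> complex"
  assumes g: "positive_functional g"
begin

lemma positive_functional_one: "0 \<le> Re (g 1)" "g 1 = complex_of_real (Re (g 1))"
  using pos_real[OF g, of 1] by (simp_all add: complex_eq_iff)

text \<open>Applying \<open>g\<close> to \<open>star_mult_add_square_eq\<close> and dropping
  \<open>g (star w * w)\<close> bounds \<open>g (star a * a)\<close> by
  \<open>Re (g 1) * (norm a)\<^sup>2\<close>. Cauchy-Schwarz against 1 then gives the claim.\<close>

lemma positive_functional_bound: "cmod (g a) \<le> Re (g 1) * norm a"
proof -
  note lin = clinear_simps[OF pos_clinear[OF g]]
  have "Re (g (star a * a)) \<le> Re (g 1) * (norm a)\<^sup>2"
  proof (rule field_le_epsilon)
    fix e :: real assume e: "0 < e"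
    define d where "d = e / (Re (g 1) + 1)"
    have d: "0 < d" "d * Re (g 1) \<le> e"
      using e positive_functional_one(1) by (simp_all add: d_def divide_le_eq distrib_left add_nonneg_pos)
    obtain w where w: "star w = w" "star a * a + w * w = ((norm a)\<^sup>2 + d) *\<^sub>R 1"
      using star_mult_add_square_eq[OF d(1)] .
    have "g (star a * a) + g (star w * w) = complex_of_real ((norm a)\<^sup>2 + d) * g 1"
      using arg_cong[OF w(2), of g] by (simp add: lin w(1) scaleR_scaleC scaleC_complex_def)
    then have "Re (g (star a * a) + g (star w * w)) = Re (complex_of_real ((norm a)\<^sup>2 + d) * g 1)"
      by (rule arg_cong)
    then have "Re (g (star a * a)) + Re (g (star w * w)) = ((norm a)\<^sup>2 + d) * Re (g 1)"
      by (simp del: of_real_add of_real_power)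
    then show "Re (g (star a * a)) \<le> Re (g 1) * (norm a)\<^sup>2 + e"
      using pos_real(2)[OF g, of w] d(2) by (simp add: algebra_simps)
  qed
  then have "sqrt (Re (g (star a * a))) \<le> sqrt (Re (g 1) * (norm a)\<^sup>2)" by (rule real_sqrt_le_mono)
  then have "fnorm g a \<le> sqrt (Re (g 1)) * norm a" by (simp add: fnorm_def real_sqrt_mult)
  then have "sqrt (Re (g 1)) * fnorm g a \<le> sqrt (Re (g 1)) * (sqrt (Re (g 1)) * norm a)"
    using positive_functional_one(1) by (intro mult_left_mono) auto
  moreover have "cmod (g a) \<le> fnorm g 1 * fnorm g a" using Cauchy_Schwarz[OF g, of 1 a] by simp
  moreover have "fnorm g 1 = sqrt (Re (g 1))" by (simp add: fnorm_def)
  ultimately have "cmod (g a) \<le> sqrt (Re (g 1)) * (sqrt (Re (g 1)) * norm a)" by simp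
  then show ?thesis using positive_functional_one(1) by (simp flip: mult.assoc)
qed

lemma positive_functional_normalize:
  assumes "g 1 \<noteq> 0"
  shows "state (\<lambda>a. inverse (g 1) * g a)"
proof -
  note lin = clinear_simps[OF pos_clinear[OF g]]
  have r: "g 1 = complex_of_real (Re (g 1))" "0 < Re (g 1)"
    using positive_functional_one assms by (auto simp: less_le)
  have "g 1 \<in> \<real>\<^sub>\<ge>\<^sub>0" using g unfolding positive_functional_def by (metis mult_1 star_one)
  then have "inverse (g 1) * g (star a * a) \<in> \<real>\<^sub>\<ge>\<^sub>0" for a
    using g by (intro nonneg_Reals_mult_I nonneg_Reals_inverse_I) (simp_all add: positive_functional_def)
  moreover have "clinear (\<lambda>a. inverse (g 1) * g a)"
    by (rule clinearI) (simp_all add: lin scaleC_complex_def distrib_left)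
  ultimately have "positive_functional (\<lambda>a. inverse (g 1) * g a)"
    by (simp add: positive_functional_def)
  moreover have "cmod (inverse (g 1) * g a) \<le> norm a" for a
  proof -
    have "cmod (g 1) = Re (g 1)" using r by (metis norm_of_real abs_of_pos)
    then have "cmod (inverse (g 1) * g a) = cmod (g a) / Re (g 1)"
      by (simp add: norm_mult norm_inverse divide_inverse mult.commute)
    then show ?thesis
      using positive_functional_bound[of a] r(2) by (simp add: divide_le_eq mult.commute)
  qed
  ultimately show ?thesis using assms by (simp add: state_def)
qed

end

lemma
  assumes "unital_star_hom f"
  shows unital_star_hom_clinear: "clinear f"
    and unital_star_hom_mult: "f (x * y) = f x * f y"
    and unital_star_hom_star: "f (star x) = star (f x)"
    and unital_star_hom_one: "f 1 = 1"
  using assms by (auto simp: unital_star_hom_def)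

text \<open>The homomorphism carries \<open>star_mult_add_square_eq\<close> to the same identity for
  \<open>f x\<close>, which bounds \<open>spec_top (star (f x) * f x)\<close>. The factor 2 is the
  square root of the 4 in \<open>norm_le_spec_top\<close>; boundedness is the only purpose.\<close>

lemma unital_star_hom_bounded:
  fixes f :: "'a::cstar_algebra \<Rightarrow> 'b::cstar_algebra"
  assumes f: "unital_star_hom f"
  shows "norm (f x) \<le> 2 * norm x"
proof (cases "(1::'b) = 0")
  case True
  then have "f x = 0" by (metis mult_1 mult_zero_left)
  then show ?thesis by simp
next
  case nz: False
  note lin = clinear_simps[OF unital_star_hom_clinear[OF f]]
  have "(norm (f x))\<^sup>2 \<le> 4 * (norm x)\<^sup>2"
  proof (rule field_le_epsilon)
    fix e :: real assume e: "0 < e"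
    let ?k = "(norm x)\<^sup>2 + e / 4"
    obtain w where w: "star w = w" "star x * x + w * w = ?k *\<^sub>R 1"
      using star_mult_add_square_eq[of "e / 4"] e by auto
    have "star (f x) * f x + f w * f w = ?k *\<^sub>R 1"
      using arg_cong[OF w(2), of f] f by (simp add: lin scaleR_scaleC unital_star_hom_def)
    then have eq: "star (f x) * f x = ?k *\<^sub>R 1 + - (f w * f w)"
      by (simp add: eq_diff_eq)
    have "spec_top (- (f w * f w)) \<le> 0"
      by (rule spec_top_minus_square[OF nz]) (simp add: w(1) flip: unital_star_hom_star[OF f])
    moreover have "spec_top (?k *\<^sub>R (1::'b)) \<le> ?k"
      using e spec_top_le_norm[OF nz, of "?k *\<^sub>R 1"] by (simp add: norm_one_cstar nz)
    ultimately have "spec_top (star (f x) * f x) \<le> ?k"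
      using spec_top_add[OF nz, of "?k *\<^sub>R 1" "- (f w * f w)"] unfolding eq by linarith
    then show "(norm (f x))\<^sup>2 \<le> 4 * (norm x)\<^sup>2 + e"
      using norm_le_spec_top[OF nz, of "f x"] e zero_le_power2[of "norm x"] by (simp add: max_def split: if_splits)
  qed
  then have "(norm (f x))\<^sup>2 \<le> (2 * norm x)\<^sup>2" by (simp add: power_mult_distrib)
  then show ?thesis by (rule power2_le_imp_le) simp
qed

lemma unital_star_hom_bounded_clinear:
  "unital_star_hom f \<Longrightarrow> bounded_clinear (f :: 'a::cstar_algebra \<Rightarrow> 'b::cstar_algebra)"
  using unital_star_hom_bounded by (auto simp: bounded_clinear_def unital_star_hom_clinear)

lemma bounded_clinear_compose:
  assumes "bounded_clinear f" "bounded_clinear g"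
  shows "bounded_clinear (\<lambda>x. f (g x))"
proof -
  have "bounded_linear (\<lambda>x. f (g x))"
    by (intro bounded_linear_compose[of f g] bounded_clinear_bounded_linear assms)
  then obtain K where "\<And>x. norm (f (g x)) \<le> norm x * K"
    using bounded_linear.bounded[of "\<lambda>x. f (g x)"] by blast
  then have K: "\<And>x. norm (f (g x)) \<le> K * norm x" by (simp add: mult.commute)
  have lin: "clinear f" "clinear g" using assms by (simp_all add: bounded_clinear_def)
  have "clinear (\<lambda>x. f (g x))"
    by (rule clinearI) (simp_all add: clinear_simps[OF lin(1)] clinear_simps[OF lin(2)])
  with K show ?thesis by (auto simp: bounded_clinear_def)
qed

lemma state_bounded_clinear: "state \<phi> \<Longrightarrow> bounded_clinear \<phi>"
  unfolding bounded_clinear_def by (auto simp: state_clinear state_bound intro!: exI[of _ 1])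

section \<open>Extension of bounded bilinear maps to the completion\<close>

lemma embed_tensor_tendsto:
  assumes "spatial_Cauchy X"
  shows "(\<lambda>n. embed_tensor (X n)) \<longlonglongrightarrow> abs_tensor X"
proof (rule LIMSEQ_I)
  fix e :: real assume e: "0 < e"
  then obtain M where M: "\<And>m n. m \<ge> M \<Longrightarrow> n \<ge> M \<Longrightarrow> spatial_norm (X m - X n) < e / 2"
    using assms unfolding spatial_Cauchy_def by (meson half_gt_zero)
  have "norm (embed_tensor (X n) - abs_tensor X) < e" if "n \<ge> M" for n
  proof -
    have "norm (abs_tensor X - embed_tensor (X n)) \<le> e / 2"
      using M that by (intro norm_diff_embed[OF assms, of M]) (auto intro: less_imp_le)
    then show ?thesis using e by (simp add: norm_minus_commute)
  qed
  then show "\<exists>M. \<forall>n\<ge>M. norm (embed_tensor (X n) - abs_tensor X) < e" by blast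
qed

lemma clinear_embed_tensor: "clinear embed_tensor"
  by (rule clinearI) (simp_all add: embed_tensor_simps)

lemma clinear_eq_on_simple_tensor:
  assumes "clinear F" "clinear G" "\<And>a b. F (simple_tensor a b) = G (simple_tensor a b)"
  shows "F t = G t"
  by (induction t rule: alg_tensor_induct)
     (simp_all add: clinear_simps[OF assms(1)] clinear_simps[OF assms(2)] assms(3))

context
  fixes \<beta> :: "'a::cstar_algebra \<Rightarrow> 'b::cstar_algebra \<Rightarrow> 'c::cstar_algebra" and K :: real
  assumes \<beta>: "cbilinear \<beta>"
    and bound: "\<And>xs. norm (lsum \<beta> xs) \<le> K * spatial_norm (lsum simple_tensor xs)"
begin

text \<open>Equality in \<open>alg_tensor\<close> is tested by complex-valued forms only, so
  well-definedness for values in \<open>'c\<close> is drawn from \<open>bound\<close>, applied to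
  \<open>xs\<close> followed by the negatives of \<open>ys\<close>.\<close>

lemma lsum_cong_simple_tensor:
  assumes "lsum simple_tensor xs = lsum simple_tensor ys"
  shows "lsum \<beta> xs = lsum \<beta> ys"
proof -
  have neg: "lsum \<gamma> (map (\<lambda>(a, b). (- a, b)) ys) = - lsum \<gamma> ys" if "cbilinear \<gamma>"
    for \<gamma> :: "'a \<Rightarrow> 'b \<Rightarrow> 'd::star_algebra"
    using lsum_map[of \<gamma> uminus "\<lambda>b. b" ys] by (simp add: cbilinear_minus_left[OF that] lsum_uminus)
  have "norm (lsum \<beta> (xs @ map (\<lambda>(a, b). (- a, b)) ys)) \<le> 0"
    using bound[of "xs @ map (\<lambda>(a, b). (- a, b)) ys"] assms
    by (simp add: neg[OF cbilinear_simple_tensor])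
  then show ?thesis by (simp add: neg[OF \<beta>])
qed

text \<open>On algebraic tensors \<beta> induces a Lipschitz map \<open>g\<close>. Its limits along
  Cauchy sequences depend only on the class of the sequence and define an extension
  \<open>F\<close>, which \<open>tensor_lift_eq\<close> identifies with the description by
  \<open>THE\<close>.\<close>

lemma
  shows tensor_lift_bounded_clinear: "bounded_clinear (tensor_lift \<beta>)"
    and tensor_lift_apply: "tensor_lift \<beta> (a \<otimes> b) = \<beta> a b"
    and norm_tensor_lift_le: "norm (tensor_lift \<beta> x) \<le> K * norm x"
proof -
  obtain L where L: "\<And>t :: ('a, 'b) alg_tensor. lsum simple_tensor (L t) = t"
    using simple_tensor_sum by metis
  define g where "g t = lsum \<beta> (L t)" for t
  have g: "g (lsum simple_tensor xs) = lsum \<beta> xs" for xs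
    unfolding g_def by (rule lsum_cong_simple_tensor) (simp add: L)
  have lin: "clinear g"
  proof (rule clinearI)
    show "g (s + t) = g s + g t" for s t using g[of "L s @ L t"] by (simp add: L g_def)
    show "g (c *\<^sub>C t) = c *\<^sub>C g t" for c t
      using g[of "map (\<lambda>(a, b). (c *\<^sub>C a, id b)) (L t)"] unfolding lsum_map
      by (simp add: cbilinear_simps[OF \<beta>] cbilinear_simps[OF cbilinear_simple_tensor] lsum_scaleC L)
         (simp add: g_def)
  qed
  have norm_g: "norm (g t) \<le> K * spatial_norm t" for t using bound[of "L t"] by (simp add: L g_def)
  have diff: "norm (g s - g t) \<le> K * spatial_norm (s - t)" for s t
    using norm_g[of "s - t"] by (simp add: clinear_simps[OF lin])
  have conv: "convergent (\<lambda>n. g (X n))" if X: "spatial_Cauchy X" for X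
  proof (rule Cauchy_convergent, rule metric_CauchyI)
    fix e :: real assume e: "0 < e"
    then have "0 < e / (\<bar>K\<bar> + 1)" by simp
    then obtain M where M: "\<And>m n. m \<ge> M \<Longrightarrow> n \<ge> M \<Longrightarrow> spatial_norm (X m - X n) < e / (\<bar>K\<bar> + 1)"
      using X unfolding spatial_Cauchy_def by blast
    have "dist (g (X m)) (g (X n)) < e" if "m \<ge> M" "n \<ge> M" for m n
    proof -
      have "norm (g (X m) - g (X n)) \<le> (\<bar>K\<bar> + 1) * spatial_norm (X m - X n)"
        by (rule order_trans[OF diff]) (auto intro: mult_right_mono)
      also have "\<dots> < (\<bar>K\<bar> + 1) * (e / (\<bar>K\<bar> + 1))" by (intro mult_strict_left_mono M that) simp
      finally show ?thesis by (simp add: dist_norm)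
    qed
    then show "\<exists>M. \<forall>m\<ge>M. \<forall>n\<ge>M. dist (g (X m)) (g (X n)) < e" by blast
  qed
  define F where "F x = lim (\<lambda>n. g (rep_tensor x n))" for x
  have F: "(\<lambda>n. g (X n)) \<longlonglongrightarrow> F (abs_tensor X)" if X: "spatial_Cauchy X" for X
  proof -
    have "tensor_eq (rep_tensor (abs_tensor X)) X"
      using X by (intro Quotient_rep_abs[OF Quotient_tensor] tensor_eq_refl)
    then have "(\<lambda>n. spatial_norm (rep_tensor (abs_tensor X) n - X n)) \<longlonglongrightarrow> 0"
      by (simp add: tensor_eq_def)
    from tendsto_mult_left[OF this, of K]
    have "(\<lambda>n. K * spatial_norm (rep_tensor (abs_tensor X) n - X n)) \<longlonglongrightarrow> 0" by simp
    then have "(\<lambda>n. g (rep_tensor (abs_tensor X) n) - g (X n)) \<longlonglongrightarrow> 0"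
      by (rule Lim_null_comparison[OF always_eventually, rotated]) (rule allI, rule diff)
    moreover have "(\<lambda>n. g (rep_tensor (abs_tensor X) n)) \<longlonglongrightarrow> F (abs_tensor X)"
      unfolding F_def by (rule convergent_LIMSEQ_iff[THEN iffD1, OF conv[OF rep_tensor_Cauchy]])
    ultimately show ?thesis using tendsto_diff[of "\<lambda>n. g (rep_tensor (abs_tensor X) n)" "F (abs_tensor X)" sequentially
        "\<lambda>n. g (rep_tensor (abs_tensor X) n) - g (X n)" 0] by simp
  qed
  have F_rep: "(\<lambda>n. g (rep_tensor x n)) \<longlonglongrightarrow> F x" for x
    using F[OF rep_tensor_Cauchy[of x]] by (simp add: abs_rep_tensor)
  have F_le: "norm (F x) \<le> K * norm x" for x
  proof (rule LIMSEQ_le)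
    show "(\<lambda>n. norm (g (rep_tensor x n))) \<longlonglongrightarrow> norm (F x)" by (intro tendsto_norm F_rep)
    show "(\<lambda>n. K * spatial_norm (rep_tensor x n)) \<longlonglongrightarrow> K * norm x"
      by (intro tendsto_mult_left norm_rep_tensor)
  qed (use norm_g in blast)
  have "clinear F"
  proof (rule clinearI)
    fix x y c
    have "(\<lambda>n. g (rep_tensor x n + rep_tensor y n)) \<longlonglongrightarrow> F (x + y)"
      unfolding rep_tensor_eqs by (intro F spatial_Cauchy_add rep_tensor_Cauchy)
    moreover have "(\<lambda>n. g (rep_tensor x n) + g (rep_tensor y n)) \<longlonglongrightarrow> F x + F y"
      by (intro tendsto_add F_rep)
    ultimately show "F (x + y) = F x + F y"
      unfolding clinear_simps[OF lin] by (rule LIMSEQ_unique)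
    have "(\<lambda>n. g (c *\<^sub>C rep_tensor x n)) \<longlonglongrightarrow> F (c *\<^sub>C x)"
      unfolding rep_tensor_eqs by (intro F spatial_Cauchy_scaleC rep_tensor_Cauchy)
    moreover have "(\<lambda>n. c *\<^sub>C g (rep_tensor x n)) \<longlonglongrightarrow> c *\<^sub>C F x"
      by (intro bounded_linear.tendsto[OF bounded_linear_scaleC] F_rep)
    ultimately show "F (c *\<^sub>C x) = c *\<^sub>C F x"
      unfolding clinear_simps[OF lin] by (rule LIMSEQ_unique)
  qed
  then have F1: "bounded_clinear F" using F_le unfolding bounded_clinear_def by blast
  have F2: "F (a \<otimes> b) = \<beta> a b" for a b
  proof -
    have "g (simple_tensor a b) = F (a \<otimes> b)"
      using F[of "\<lambda>_. simple_tensor a b"]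
      by (simp only: spatial_Cauchy_const LIMSEQ_const_iff tensor_prod_def embed_tensor_def simp_thms)
    then show ?thesis using g[of "[(a, b)]"] by simp
  qed
  have eq: "tensor_lift \<beta> = F" by (rule tensor_lift_eq[OF F1 F2])
  show "bounded_clinear (tensor_lift \<beta>)" "tensor_lift \<beta> (a \<otimes> b) = \<beta> a b"
    "norm (tensor_lift \<beta> x) \<le> K * norm x"
    unfolding eq by (fact F1, fact F2, fact F_le)
qed

end

section \<open>Tensor products of homomorphisms are contractive for the spatial norm\<close>

lift_definition alg_map :: "('a::star_algebra \<Rightarrow> 'c::star_algebra) \<Rightarrow> ('b::star_algebra \<Rightarrow> 'd::star_algebra)
    \<Rightarrow> ('a, 'b) alg_tensor \<Rightarrow> ('c, 'd) alg_tensor"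
  is "\<lambda>f g xs. if clinear f \<and> clinear g then map (\<lambda>(a, b). (f a, g b)) xs else []"
proof -
  fix f :: "'a \<Rightarrow> 'c" and g :: "'b \<Rightarrow> 'd" and xs ys :: "('a \<times> 'b) list"
  assume eq: "alg_eq xs ys"
  have "lsum \<beta> (map (\<lambda>(a, b). (f a, g b)) xs) = lsum \<beta> (map (\<lambda>(a, b). (f a, g b)) ys)"
    if f: "clinear f" and g: "clinear g" and \<beta>: "cbilinear \<beta>" for \<beta> :: "'c \<Rightarrow> 'd \<Rightarrow> complex"
  proof -
    have "cbilinear (\<lambda>a b. \<beta> (f a) (g b))"
      by (rule cbilinearI) (simp_all add: clinear_simps[OF f] clinear_simps[OF g] cbilinear_simps[OF \<beta>])
    then show ?thesis unfolding lsum_map by (rule eq[unfolded alg_eq_def, rule_format])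
  qed
  then show "alg_eq (if clinear f \<and> clinear g then map (\<lambda>(a, b). (f a, g b)) xs else [])
      (if clinear f \<and> clinear g then map (\<lambda>(a, b). (f a, g b)) ys else [])"
    by (simp add: alg_eq_def)
qed

lemma alg_map_simple:
  "clinear f \<Longrightarrow> clinear g \<Longrightarrow> alg_map f g (simple_tensor a b) = simple_tensor (f a) (g b)"
  by (simp add: simple_tensor.abs_eq alg_map.abs_eq)

lemma clinear_alg_map:
  fixes f :: "'a::star_algebra \<Rightarrow> 'c::star_algebra" and g :: "'b::star_algebra \<Rightarrow> 'd::star_algebra"
  assumes f: "clinear f" and g: "clinear g"
  shows "clinear (alg_map f g)"
proof (rule clinearI)
  have abs: "\<exists>xs. t = abs_alg_tensor xs" for t :: "('a, 'b) alg_tensor"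
    by (rule exI[of _ "rep_alg_tensor t"]) (simp add: Quotient_abs_rep[OF Quotient_alg_tensor])
  fix s t :: "('a, 'b) alg_tensor" and c
  obtain xs ys where st: "s = abs_alg_tensor xs" "t = abs_alg_tensor ys" using abs by metis
  show "alg_map f g (s + t) = alg_map f g s + alg_map f g t"
    unfolding st alg_map.abs_eq plus_alg_tensor.abs_eq by (simp only: f g simp_thms if_True map_append)
  have "map (\<lambda>(a, b). (f a, g b)) (map (\<lambda>(a, b). (c *\<^sub>C a, b)) xs)
      = map (\<lambda>(a, b). (c *\<^sub>C a, b)) (map (\<lambda>(a, b). (f a, g b)) xs)"
    by (induction xs) (auto simp: clinear_scaleC[OF f])
  then show "alg_map f g (c *\<^sub>C s) = c *\<^sub>C alg_map f g s"
    unfolding st alg_map.abs_eq scaleC_alg_tensor.abs_eq by (simp only: f g simp_thms if_True id_apply)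
qed

lemma alg_map_lsum:
  "clinear f \<Longrightarrow> clinear g \<Longrightarrow> alg_map f g (lsum simple_tensor xs) = lsum (\<lambda>a b. simple_tensor (f a) (g b)) xs"
  by (simp add: clinear_lsum[OF clinear_alg_map] alg_map_simple)

context
  fixes f :: "'a::star_algebra \<Rightarrow> 'c::star_algebra" and g :: "'b::star_algebra \<Rightarrow> 'd::star_algebra"
  assumes f: "unital_star_hom f" and g: "unital_star_hom g"
begin

lemma alg_map_mult: "alg_map f g (s * t) = alg_map f g s * alg_map f g t"
proof -
  note lin = clinear_simps[OF clinear_alg_map[OF unital_star_hom_clinear[OF f] unital_star_hom_clinear[OF g]]]
  have *: "alg_map f g (simple_tensor a b * t) = alg_map f g (simple_tensor a b) * alg_map f g t" for a b
    by (induction t rule: alg_tensor_induct)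
       (use f g in \<open>simp_all add: unital_star_hom_def lin distrib_left simple_tensor_simps(1) alg_map_simple\<close>)
  show ?thesis
    by (induction s rule: alg_tensor_induct) (simp_all add: lin distrib_right *)
qed

lemma alg_map_star: "alg_map f g (star t) = star (alg_map f g t)"
  by (induction t rule: alg_tensor_induct)
     (use f g in \<open>simp_all add: unital_star_hom_def clinear_simps[OF clinear_alg_map[OF unital_star_hom_clinear[OF f] unital_star_hom_clinear[OF g]]]
       star_add simple_tensor_simps(2) alg_map_simple\<close>)

lemma alg_map_one: "alg_map f g 1 = 1"
  using f g by (simp add: unital_star_hom_def simple_tensor_simps(7) alg_map_simple)

lemma alg_map_power: "alg_map f g (t ^ n) = alg_map f g t ^ n"
  by (induction n) (simp_all add: alg_map_one alg_map_mult)

end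

text \<open>The complex linear span of \<open>S\<close>. The inductive form lets bounds, linearity
  and limits pass from \<open>S\<close> to its combinations by rule induction.\<close>

inductive functional_hull :: "('a \<Rightarrow> complex) set \<Rightarrow> ('a \<Rightarrow> complex) \<Rightarrow> bool"
  for S where
  zero: "functional_hull S (\<lambda>_. 0)"
| base: "\<phi> \<in> S \<Longrightarrow> functional_hull S \<phi>"
| add: "functional_hull S F \<Longrightarrow> functional_hull S G \<Longrightarrow> functional_hull S (\<lambda>a. F a + G a)"
| scale: "functional_hull S F \<Longrightarrow> functional_hull S (\<lambda>a. k * F a)"

abbreviation product_states :: "(('a::cstar_algebra, 'b::cstar_algebra) alg_tensor \<Rightarrow> complex) set"
  where "product_states \<equiv> {prod_functional \<phi> \<psi> | \<phi> \<psi>. state \<phi> \<and> state \<psi>}"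

lemma clinear_zero_functional: "clinear (\<lambda>_. 0 :: complex)"
  by (rule clinearI) (simp_all add: scaleC_complex_def)

lemma clinear_add_functional:
  assumes "clinear F" "clinear G"
  shows "clinear (\<lambda>a. F a + G a :: complex)"
  by (rule clinearI)
     (simp_all add: clinear_simps[OF assms(1)] clinear_simps[OF assms(2)] scaleC_complex_def distrib_left)

lemma clinear_scale_functional:
  assumes "clinear F"
  shows "clinear (\<lambda>a. k * F a :: complex)"
  by (rule clinearI) (simp_all add: clinear_simps[OF assms] scaleC_complex_def distrib_left)

lemma functional_hull_clinear:
  "functional_hull {\<phi>. state \<phi>} F \<Longrightarrow> clinear F"
  by (induction rule: functional_hull.induct)
     (auto intro: state_clinear clinear_zero_functional clinear_add_functional clinear_scale_functional)

text \<open>A positive functional is a multiple of a state, or vanishes by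
  \<open>positive_functional_bound\<close> when \<open>g 1 = 0\<close>.\<close>

lemma positive_functional_hull:
  assumes "positive_functional (g :: 'a::cstar_algebra \<Rightarrow> complex)"
  shows "functional_hull {\<phi>. state \<phi>} g"
proof (cases "g 1 = 0")
  case True
  then have "g = (\<lambda>_. 0)" using positive_functional_bound[OF assms] by (auto simp: fun_eq_iff)
  then show ?thesis by (simp add: functional_hull.zero)
next
  case False
  then have "functional_hull {\<phi>. state \<phi>} (\<lambda>a. g 1 * (inverse (g 1) * g a))"
    using positive_functional_normalize[OF assms] by (intro functional_hull.scale functional_hull.base) simp
  moreover have "(\<lambda>a. g 1 * (inverse (g 1) * g a)) = g" using False by (intro ext) simp
  ultimately show ?thesis by simp
qed

lemma prod_functional_eq:
  assumes "clinear F" "clinear G" "clinear H" "\<And>a b. H (simple_tensor a b) = F a * G b"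
  shows "prod_functional F G = H"
proof
  show "prod_functional F G t = H t" for t
    by (rule clinear_eq_on_simple_tensor[where F = "prod_functional F G"])
       (simp_all add: assms clinear_prod_functional prod_functional_simple)
qed

text \<open>This is bilinearity of \<open>prod_functional\<close>: induction on \<open>F\<close>
  and, once \<open>F\<close> is a state, on \<open>G\<close>.\<close>

lemma prod_functional_hull:
  fixes F :: "'a::cstar_algebra \<Rightarrow> complex" and G :: "'b::cstar_algebra \<Rightarrow> complex"
  assumes F: "functional_hull {\<phi>. state \<phi>} F" and G: "functional_hull {\<psi>. state \<psi>} G"
  shows "functional_hull product_states (prod_functional F G)"
proof -
  note clinear = functional_hull_clinear clinear_zero_functional clinear_add_functional
    clinear_scale_functional clinear_prod_functional state_clinear
  show ?thesis
    using F
  proof (induction rule: functional_hull.induct)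
    case zero
    have "prod_functional (\<lambda>_::'a. 0) G = (\<lambda>_. 0)"
      by (rule prod_functional_eq) (simp_all add: clinear G)
    then show ?case by (simp add: functional_hull.zero)
  next
    case (base \<phi>)
    then have \<phi>: "state \<phi>" by simp
    show ?case
      using G
    proof (induction rule: functional_hull.induct)
      case zero
      have "prod_functional \<phi> (\<lambda>_::'b. 0) = (\<lambda>_. 0)"
        by (rule prod_functional_eq) (simp_all add: clinear \<phi>)
      then show ?case by (simp add: functional_hull.zero)
    next
      case (base \<psi>)
      with \<phi> show ?case by (intro functional_hull.base) blast
    next
      case (add F G)
      have "prod_functional \<phi> (\<lambda>a. F a + G a) = (\<lambda>t. prod_functional \<phi> F t + prod_functional \<phi> G t)"
        by (rule prod_functional_eq)
           (simp_all add: clinear \<phi> add.hyps prod_functional_simple distrib_left)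
      then show ?case using functional_hull.add[OF add.IH] by simp
    next
      case (scale F k)
      have "prod_functional \<phi> (\<lambda>a. k * F a) = (\<lambda>t. k * prod_functional \<phi> F t)"
        by (rule prod_functional_eq) (simp_all add: clinear \<phi> scale.hyps prod_functional_simple)
      then show ?case using functional_hull.scale[OF scale.IH] by simp
    qed
  next
    case (add E F)
    have "prod_functional (\<lambda>a. E a + F a) G = (\<lambda>t. prod_functional E G t + prod_functional F G t)"
      by (rule prod_functional_eq)
         (simp_all add: clinear G add.hyps prod_functional_simple distrib_right)
    then show ?case using functional_hull.add[OF add.IH] by simp
  next
    case (scale F k)
    have "prod_functional (\<lambda>a. k * F a) G = (\<lambda>t. k * prod_functional F G t)"
      by (rule prod_functional_eq) (simp_all add: clinear G scale.hyps prod_functional_simple)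
    then show ?case using functional_hull.scale[OF scale.IH] by simp
  qed
qed

lemma positive_functional_compress:
  assumes \<phi>: "positive_functional \<phi>" and f: "unital_star_hom f"
  shows "positive_functional (\<lambda>a. \<phi> (star c * f a * c))"
proof -
  note lin = clinear_simps[OF pos_clinear[OF \<phi>]] clinear_simps[OF unital_star_hom_clinear[OF f]]
  have "star c * f (star a * a) * c = star (f a * c) * (f a * c)" for a
    by (simp add: unital_star_hom_mult[OF f] unital_star_hom_star[OF f] star_mult mult.assoc)
  moreover have "\<phi> (star (f a * c) * (f a * c)) \<in> \<real>\<^sub>\<ge>\<^sub>0" for a
    using \<phi> unfolding positive_functional_def by blast
  moreover have "clinear (\<lambda>a. \<phi> (star c * f a * c))"
    by (rule clinearI) (simp_all add: lin distrib_left distrib_right scaleC_simps)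
  ultimately show ?thesis unfolding positive_functional_def by simp
qed

text \<open>Polarisation: \<open>4 c\<^sup>* x d\<close> is the sum of \<open>cnj k (c + k d)\<^sup>* x (c + k d)\<close> over the fourth roots of
  unity \<open>k\<close>.\<close>

lemma functional_hull_compress:
  fixes \<phi> :: "'c::cstar_algebra \<Rightarrow> complex" and f :: "'a::cstar_algebra \<Rightarrow> 'c"
  assumes \<phi>: "positive_functional \<phi>" and f: "unital_star_hom f"
  shows "functional_hull {\<phi>. state \<phi>} (\<lambda>a. \<phi> (star c * f a * d))"
proof -
  note lin = clinear_simps[OF pos_clinear[OF \<phi>]]
  define P where "P k a = \<phi> (star (c + k *\<^sub>C d) * f a * (c + k *\<^sub>C d))" for k a
  have P: "functional_hull {\<phi>. state \<phi>} (P k)" for k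
    unfolding P_def by (intro positive_functional_hull positive_functional_compress \<phi> f)
  have "\<phi> (star c * f a * d) = 1/4 * P 1 a + (- 1/4 * P (- 1) a + (- \<i>/4 * P \<i> a + \<i>/4 * P (- \<i>) a))" for a
    by (simp add: P_def lin star_add star_diff star_scaleC left_diff_distrib right_diff_distrib distrib_left distrib_right
        scaleC_simps scaleC_complex_def field_simps)
  then show ?thesis
    by (simp only:) (intro functional_hull.add functional_hull.scale P)
qed

text \<open>For simple tensors \<open>z\<close> and \<open>y\<close> the functional factors into two
  compressed functionals, one on each leg, and polarisation puts each factor into the span of the
  states. Linearity in \<open>y\<close> and then in \<open>z\<close> gives the general case.\<close>

lemma functional_hull_product_compress:
  fixes \<phi> :: "'c::cstar_algebra \<Rightarrow> complex" and \<psi> :: "'d::cstar_algebra \<Rightarrow> complex"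
    and f :: "'a::cstar_algebra \<Rightarrow> 'c" and g :: "'b::cstar_algebra \<Rightarrow> 'd"
  assumes st: "state \<phi>" "state \<psi>" and fg: "unital_star_hom f" "unital_star_hom g"
  shows "functional_hull product_states (\<lambda>u. prod_functional \<phi> \<psi> (z * alg_map f g u * y))"
proof -
  note lin = clinear_simps[OF clinear_prod_functional[of \<phi> \<psi>]] clinear_simps[OF clinear_alg_map[OF unital_star_hom_clinear[OF fg(1)] unital_star_hom_clinear[OF fg(2)]]]
  have simple: "functional_hull product_states
      (\<lambda>u. prod_functional \<phi> \<psi> (simple_tensor a b * alg_map f g u * simple_tensor c d))" for a b c d
  proof -
    let ?F = "\<lambda>x. \<phi> (a * f x * c)" and ?G = "\<lambda>x. \<psi> (b * g x * d)"
    have F: "functional_hull {\<phi>. state \<phi>} ?F"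
      using functional_hull_compress[OF state_positive[OF st(1)] fg(1), of "star a" c] by (simp only: star_star)
    have G: "functional_hull {\<phi>. state \<phi>} ?G"
      using functional_hull_compress[OF state_positive[OF st(2)] fg(2), of "star b" d] by (simp only: star_star)
    have "prod_functional \<phi> \<psi> (simple_tensor a b * alg_map f g u * simple_tensor c d) = prod_functional ?F ?G u" for u
    proof (rule clinear_eq_on_simple_tensor[where G = "prod_functional ?F ?G"])
      show "clinear (\<lambda>u. prod_functional \<phi> \<psi> (simple_tensor a b * alg_map f g u * simple_tensor c d))"
        by (rule clinearI) (simp_all add: lin distrib_left distrib_right scaleC_simps)
    qed (use st fg in \<open>simp_all add: clinear_prod_functional alg_map_simple unital_star_hom_clinear
        simple_tensor_simps(1) prod_functional_simple state_clinear functional_hull_clinear F G\<close>)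
    then show ?thesis using prod_functional_hull[OF F G] by simp
  qed
  have "functional_hull product_states
      (\<lambda>u. prod_functional \<phi> \<psi> (simple_tensor a b * alg_map f g u * y))" for a b
    by (induction y rule: alg_tensor_induct)
       (simp_all add: lin distrib_left functional_hull.zero functional_hull.add simple)
  then show ?thesis
    by (induction z rule: alg_tensor_induct)
       (simp_all add: lin distrib_right functional_hull.zero functional_hull.add)
qed

lemma prod_functional_one:
  assumes "state \<phi>" "state \<psi>"
  shows "prod_functional \<phi> \<psi> 1 = 1"
  unfolding simple_tensor_simps(7) using assms by (simp add: prod_functional_simple state_clinear) (simp add: state_def)

lemma product_state_bound:
  assumes "state \<phi>" "state \<psi>"
  shows "cmod (prod_functional \<phi> \<psi> t) \<le> spatial_norm t"
proof -
  let ?\<omega> = "prod_functional \<phi> \<psi>"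
  have "fnorm ?\<omega> 1 = 1"
    by (simp add: fnorm_def prod_functional_one assms)
  then show ?thesis
    using Cauchy_Schwarz[OF positive_prod_state[OF assms], of 1 t] spatial_norm_mult[OF assms, of t 1] by simp
qed

lemma functional_hull_spatial_bound:
  assumes "functional_hull product_states G"
  shows "\<exists>C\<ge>0. \<forall>t. cmod (G t) \<le> C * spatial_norm t"
  using assms
proof (induction rule: functional_hull.induct)
  case (base G)
  then show ?case using product_state_bound by (intro exI[of _ 1]) auto
next
  case (add F G)
  then obtain C D where "0 \<le> C" "0 \<le> D" "\<And>t. cmod (F t) \<le> C * spatial_norm t" "\<And>t. cmod (G t) \<le> D * spatial_norm t"
    by blast
  then have "cmod (F t + G t) \<le> (C + D) * spatial_norm t" for t
    by (simp add: distrib_right norm_triangle_mono)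
  with \<open>0 \<le> C\<close> \<open>0 \<le> D\<close> show ?case by (intro exI[of _ "C + D"]) auto
next
  case (scale F k)
  then obtain C where "0 \<le> C" "\<And>t. cmod (F t) \<le> C * spatial_norm t" by blast
  then have "cmod (k * F t) \<le> (cmod k * C) * spatial_norm t" for t
    by (simp add: norm_mult mult.assoc mult_left_mono)
  with \<open>0 \<le> C\<close> show ?case by (intro exI[of _ "cmod k * C"]) auto
qed (intro exI[of _ 0], simp)

lemma spatial_norm_power_le: "spatial_norm (t ^ n) \<le> spatial_norm t ^ n"
proof (induction n)
  case 0
  have "spatial_norm (simple_tensor 1 1 :: ('a, 'b) alg_tensor) \<le> 1 * 1"
    by (rule order_trans[OF spatial_norm_simple]) (intro mult_mono norm_one_le; simp)
  then show ?case by (simp add: simple_tensor_simps(7))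
next
  case (Suc n)
  then show ?case
    using spatial_norm_mult_le[of t "t ^ n"] mult_left_mono[OF Suc, of "spatial_norm t"] by simp
qed

text \<open>Compression yields a bound with a constant \<open>C\<close> that depends on
  \<open>y\<close>. Used on all powers of \<open>u = star t * t\<close>, it becomes the hypothesis
  of \<open>positive_power_bound\<close>, whose conclusion is free of \<open>C\<close>.\<close>

lemma spatial_norm_alg_map_le:
  fixes f :: "'a::cstar_algebra \<Rightarrow> 'c::cstar_algebra" and g :: "'b::cstar_algebra \<Rightarrow> 'd::cstar_algebra"
  assumes fg: "unital_star_hom f" "unital_star_hom g"
  shows "spatial_norm (alg_map f g t) \<le> spatial_norm t"
proof (rule spatial_norm_le)
  fix \<phi> :: "'c \<Rightarrow> complex" and \<psi> :: "'d \<Rightarrow> complex" and y assume st: "state \<phi>" "state \<psi>"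
  let ?\<omega> = "prod_functional \<phi> \<psi>"
  have pos: "positive_functional ?\<omega>" by (rule positive_prod_state[OF st])
  define u where "u = star t * t"
  let ?U = "alg_map f g u" and ?K = "(spatial_norm t)\<^sup>2"
  have U: "?U = star (alg_map f g t) * alg_map f g t"
    by (simp add: u_def alg_map_mult fg alg_map_star)
  obtain C where C: "0 \<le> C" "\<And>v. cmod (?\<omega> (star y * alg_map f g v * y)) \<le> C * spatial_norm v"
    using functional_hull_spatial_bound[OF functional_hull_product_compress[OF st fg, of "star y" y]] by blast
  have "cmod (?\<omega> (star y * (?U ^ n * y))) \<le> C * ?K ^ n" for n
  proof -
    have "cmod (?\<omega> (star y * (?U ^ n * y))) \<le> C * spatial_norm (u ^ n)"
      using C(2)[of "u ^ n"] by (simp add: alg_map_power[OF fg] mult.assoc)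
    also have "\<dots> \<le> C * ?K ^ n"
      using spatial_norm_power_le[of u n] C(1) by (simp add: u_def spatial_norm_cstar mult_left_mono)
    finally show ?thesis .
  qed
  then have "cmod (?\<omega> (star y * (?U * y))) \<le> ?K * (fnorm ?\<omega> y)\<^sup>2"
    by (intro positive_power_bound[OF pos]) (auto simp: U star_mult star_star)
  moreover have "(fnorm ?\<omega> (alg_map f g t * y))\<^sup>2 = Re (?\<omega> (star y * (?U * y)))"
    by (simp add: fnorm_sq[OF pos] U star_mult mult.assoc)
  ultimately have "(fnorm ?\<omega> (alg_map f g t * y))\<^sup>2 \<le> (spatial_norm t * fnorm ?\<omega> y)\<^sup>2"
    using complex_Re_le_cmod[of "?\<omega> (star y * (?U * y))"] by (simp add: power_mult_distrib)
  then show "fnorm ?\<omega> (alg_map f g t * y) \<le> spatial_norm t * fnorm ?\<omega> y"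
    by (rule power2_le_imp_le) (simp add: fnorm_nonneg[OF pos])
qed simp

context
  fixes f :: "'a::cstar_algebra \<Rightarrow> 'c::cstar_algebra" and g :: "'b::cstar_algebra \<Rightarrow> 'd::cstar_algebra"
  assumes fg: "unital_star_hom f" "unital_star_hom g"
begin

lemma
  shows tensor_map_bounded_clinear: "bounded_clinear (tensor_map f g)"
    and tensor_map_apply: "tensor_map f g (a \<otimes> b) = f a \<otimes> g b"
proof -
  note lin = unital_star_hom_clinear[OF fg(1)] unital_star_hom_clinear[OF fg(2)]
  have \<beta>: "cbilinear (\<lambda>a b. f a \<otimes> g b)"
    by (rule cbilinearI)
       (simp_all add: clinear_simps[OF lin(1)] clinear_simps[OF lin(2)] cbilinear_simps[OF cbilinear_tensor_prod])
  have bound: "norm (lsum (\<lambda>a b. f a \<otimes> g b) xs) \<le> 1 * spatial_norm (lsum simple_tensor xs)" for xs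
  proof -
    have "lsum (\<lambda>a b. f a \<otimes> g b) xs = embed_tensor (alg_map f g (lsum simple_tensor xs))"
      by (simp add: alg_map_lsum[OF lin] clinear_lsum[OF clinear_embed_tensor] tensor_prod_def)
    then show ?thesis using spatial_norm_alg_map_le[OF fg] by simp
  qed
  show "bounded_clinear (tensor_map f g)" "tensor_map f g (a \<otimes> b) = f a \<otimes> g b"
    unfolding tensor_map_def
    by (rule tensor_lift_bounded_clinear[OF \<beta> bound], rule tensor_lift_apply[OF \<beta> bound])
qed

end

section \<open>Product functionals on the minimal tensor product\<close>

context
  fixes \<phi> :: "'a::cstar_algebra \<Rightarrow> complex" and \<psi> :: "'b::cstar_algebra \<Rightarrow> complex"
  assumes st: "state \<phi>" "state \<psi>"
begin

lemma
  shows tensor_functional_bounded_clinear: "bounded_clinear (tensor_functional \<phi> \<psi>)"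
    and tensor_functional_apply: "tensor_functional \<phi> \<psi> (a \<otimes> b) = \<phi> a * \<psi> b"
    and tensor_functional_le: "cmod (tensor_functional \<phi> \<psi> x) \<le> norm x"
proof -
  note lin = state_clinear[OF st(1)] state_clinear[OF st(2)]
  have \<beta>: "cbilinear (\<lambda>a b. \<phi> a * \<psi> b)" by (rule cbilinear_prod[OF lin])
  have bound: "cmod (lsum (\<lambda>a b. \<phi> a * \<psi> b) xs) \<le> 1 * spatial_norm (lsum simple_tensor xs)" for xs
    using product_state_bound[OF st, of "lsum simple_tensor xs"]
    by (simp add: clinear_lsum[OF clinear_prod_functional] prod_functional_simple lin)
  show "bounded_clinear (tensor_functional \<phi> \<psi>)" "tensor_functional \<phi> \<psi> (a \<otimes> b) = \<phi> a * \<psi> b"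
    "cmod (tensor_functional \<phi> \<psi> x) \<le> norm x"
    using norm_tensor_lift_le[OF \<beta> bound, of x] tensor_lift_bounded_clinear[OF \<beta> bound] tensor_lift_apply[OF \<beta> bound]
    by (simp_all add: tensor_functional_def)
qed

lemma tensor_functional_embed: "tensor_functional \<phi> \<psi> (embed_tensor t) = prod_functional \<phi> \<psi> t"
proof (rule clinear_eq_on_simple_tensor[where F = "\<lambda>t. tensor_functional \<phi> \<psi> (embed_tensor t)" and t = t])
  have "clinear (tensor_functional \<phi> \<psi>)"
    using tensor_functional_bounded_clinear by (simp add: bounded_clinear_def)
  from clinear_simps[OF this] show "clinear (\<lambda>t. tensor_functional \<phi> \<psi> (embed_tensor t))"
    by (intro clinearI) (simp_all add: embed_tensor_simps)
qed (use tensor_functional_apply in \<open>simp_all add: clinear_prod_functional prod_functional_simple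
  state_clinear st tensor_prod_def\<close>)

lemma tensor_functional_tendsto:
  assumes "spatial_Cauchy X"
  shows "(\<lambda>n. prod_functional \<phi> \<psi> (X n)) \<longlonglongrightarrow> tensor_functional \<phi> \<psi> (abs_tensor X)"
  using bounded_linear.tendsto[OF bounded_clinear_bounded_linear[OF tensor_functional_bounded_clinear]
      embed_tensor_tendsto[OF assms]]
  by (simp add: tensor_functional_embed)

text \<open>Functionals on triple tensor products are formed by iteration, which calls for a product
  of states to be a state again. Positivity survives the limit because the nonnegative reals are
  closed.\<close>

lemma state_tensor_functional: "state (tensor_functional \<phi> \<psi>)"
proof -
  have "tensor_functional \<phi> \<psi> (star x * x) \<in> \<real>\<^sub>\<ge>\<^sub>0" for x
  proof (rule closed_sequentially[OF closed_nonneg_Reals_complex])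
    show "(\<lambda>n. prod_functional \<phi> \<psi> (star (rep_tensor x n) * rep_tensor x n))
        \<longlonglongrightarrow> tensor_functional \<phi> \<psi> (star x * x)"
      unfolding rep_tensor_eqs(3)
      by (intro tensor_functional_tendsto spatial_Cauchy_mult spatial_Cauchy_star rep_tensor_Cauchy)
    show "prod_functional \<phi> \<psi> (star (rep_tensor x n) * rep_tensor x n) \<in> \<real>\<^sub>\<ge>\<^sub>0" for n
      using positive_prod_state[OF st] by (simp add: positive_functional_def)
  qed
  moreover have "tensor_functional \<phi> \<psi> 1 = 1"
    using tensor_functional_embed[of 1] by (simp add: embed_tensor_simps prod_functional_one st)
  ultimately show ?thesis
    using tensor_functional_bounded_clinear tensor_functional_le
    by (simp add: state_def positive_functional_def bounded_clinear_def)
qed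

end

lemma unital_star_hom_id: "unital_star_hom id"
  unfolding unital_star_hom_def by (simp add: clinearI)

lemma alg_map_id: "alg_map id id t = t"
proof (rule clinear_eq_on_simple_tensor[where F = "alg_map id id" and G = "\<lambda>t. t"])
  have id: "clinear (id :: 'e::star_algebra \<Rightarrow> 'e)" by (rule clinearI) simp_all
  show "clinear (alg_map id id)" by (rule clinear_alg_map[OF id id])
  show "clinear (\<lambda>t. t)" by (rule clinearI) simp_all
  show "alg_map id id (simple_tensor a b) = simple_tensor a b" for a b by (simp add: alg_map_simple[OF id id])
qed

text \<open>The functionals \<open>v \<mapsto> ?\<omega> (star z * v * y)\<close> lie in the span of
  the product states, so they tend to 0 along the sequence \<open>X\<close> that represents
  \<open>x\<close>. Together with the Cauchy property this bounds \<open>spatial_norm (X n)\<close>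
  by \<open>e\<close> for large \<open>n\<close>.\<close>

lemma product_states_separate:
  fixes x :: "('a::cstar_algebra, 'b::cstar_algebra) tensor"
  assumes zero: "\<And>\<phi> \<psi>. state \<phi> \<Longrightarrow> state \<psi> \<Longrightarrow> tensor_functional \<phi> \<psi> x = 0"
  shows "x = 0"
proof -
  define X where "X = rep_tensor x"
  have X: "spatial_Cauchy X" by (simp add: X_def rep_tensor_Cauchy)
  have hull: "(\<lambda>n. G (X n)) \<longlonglongrightarrow> 0" if "functional_hull product_states G" for G
    using that
  proof (induction rule: functional_hull.induct)
    case (base G)
    then obtain \<phi> \<psi> where G: "G = prod_functional \<phi> \<psi>" and st: "state \<phi>" "state \<psi>" by auto
    show ?case unfolding G using tensor_functional_tendsto[OF st X] zero[OF st] by (simp add: X_def abs_rep_tensor)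
  next
    case (add F G)
    then show ?case using tendsto_add[of "\<lambda>n. F (X n)" 0 sequentially "\<lambda>n. G (X n)" 0] by simp
  next
    case (scale F k)
    then show ?case using tendsto_mult_left[of "\<lambda>n. F (X n)" 0 sequentially k] by simp
  qed simp
  have "norm x \<le> e" if e: "0 < e" for e
  proof -
    obtain M where M: "\<And>m n. m \<ge> M \<Longrightarrow> n \<ge> M \<Longrightarrow> spatial_norm (X m - X n) < e"
      using X e unfolding spatial_Cauchy_def by blast
    have "spatial_norm (X n) \<le> e" if n: "n \<ge> M" for n
    proof (rule spatial_norm_le)
      fix \<phi> :: "'a \<Rightarrow> complex" and \<psi> :: "'b \<Rightarrow> complex" and y assume st: "state \<phi>" "state \<psi>"
      let ?\<omega> = "prod_functional \<phi> \<psi>"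
      note pos = positive_prod_state[OF st]
      \<comment> \<open>With this choice \<open>?\<omega> (star z * X n * y)\<close> is the square
        of \<open>fnorm ?\<omega> z\<close>.\<close>
      define z where "z = X n * y"
      have "(\<lambda>m. ?\<omega> (star z * alg_map id id (X m) * y)) \<longlonglongrightarrow> 0"
        by (rule hull[OF functional_hull_product_compress[OF st unital_star_hom_id unital_star_hom_id]])
      then have "(\<lambda>m. ?\<omega> (star z * z) - ?\<omega> (star z * X m * y)) \<longlonglongrightarrow> ?\<omega> (star z * z) - 0"
        unfolding alg_map_id by (intro tendsto_diff tendsto_const)
      from tendsto_norm[OF this]
      have lim: "(\<lambda>m. cmod (?\<omega> (star z * z) - ?\<omega> (star z * X m * y))) \<longlonglongrightarrow> cmod (?\<omega> (star z * z))"
        by simp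
      have "cmod (?\<omega> (star z * z) - ?\<omega> (star z * X m * y)) \<le> fnorm ?\<omega> z * (e * fnorm ?\<omega> y)" if m: "m \<ge> M" for m
      proof -
        have "?\<omega> (star z * z) - ?\<omega> (star z * X m * y) = ?\<omega> (star z * ((X n - X m) * y))"
          by (simp add: z_def left_diff_distrib right_diff_distrib mult.assoc clinear_simps[OF clinear_prod_functional])
        also have "cmod \<dots> \<le> fnorm ?\<omega> z * fnorm ?\<omega> ((X n - X m) * y)" by (rule Cauchy_Schwarz[OF pos])
        also have "fnorm ?\<omega> ((X n - X m) * y) \<le> e * fnorm ?\<omega> y"
          using M[OF n m]
          by (intro order_trans[OF spatial_norm_mult[OF st]] mult_right_mono) (auto simp: fnorm_nonneg[OF pos])
        finally show ?thesis by (simp add: mult_left_mono fnorm_nonneg[OF pos])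
      qed
      then have "cmod (?\<omega> (star z * z)) \<le> fnorm ?\<omega> z * (e * fnorm ?\<omega> y)"
        by (intro LIMSEQ_le_const2[OF lim]) blast
      moreover have "(fnorm ?\<omega> z)\<^sup>2 \<le> cmod (?\<omega> (star z * z))"
        by (simp add: fnorm_sq[OF pos] complex_Re_le_cmod)
      ultimately have "fnorm ?\<omega> z * fnorm ?\<omega> z \<le> fnorm ?\<omega> z * (e * fnorm ?\<omega> y)"
        by (simp add: power2_eq_square)
      then show "fnorm ?\<omega> (X n * y) \<le> e * fnorm ?\<omega> y"
        using e fnorm_nonneg[OF pos, of z] fnorm_nonneg[OF pos, of y]
        by (cases "fnorm ?\<omega> z = 0") (simp_all add: mult_le_cancel_left z_def)
    qed (use e in simp)
    then show ?thesis
      using norm_rep_tensor[of x] by (intro LIMSEQ_le_const2[of "\<lambda>n. spatial_norm (X n)"]) (auto simp: X_def)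
  qed
  then have "norm x \<le> 0" by (rule field_le_epsilon) simp
  then show ?thesis by simp
qed

lemma state_nonzero: "state (\<phi> :: 'a::cstar_algebra \<Rightarrow> complex) \<Longrightarrow> (1::'a) \<noteq> 0"
  using clinear_zero[OF state_clinear] by (metis state_def zero_neq_one)

section \<open>Slice maps\<close>

context
  fixes \<psi> :: "'b::cstar_algebra \<Rightarrow> complex"
  assumes \<psi>: "state \<psi>" and nz: "(1::'a::cstar_algebra) \<noteq> 0"
begin

text \<open>Let \<open>s\<close> be the slice of \<open>t\<close>. A state \<phi> that nearly
  attains the norm of \<open>s\<close> turns the estimate into one for product states:
  \<open>\<phi> (star s * s)\<close> is the pairing of \<open>s \<otimes> 1\<close> with
  \<open>t\<close>, and Cauchy-Schwarz bounds it by \<open>fnorm \<phi> s * spatial_norm t\<close>.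
  The factor 2 reflects the 4 in \<open>exists_state_star_mult\<close>.\<close>

lemma
  shows slice_right_bounded_clinear: "bounded_clinear (slice_right \<psi> :: ('a, 'b) tensor \<Rightarrow> 'a)"
    and slice_right_apply: "slice_right \<psi> ((a::'a) \<otimes> b) = \<psi> b *\<^sub>C a"
proof -
  let ?\<beta> = "\<lambda>(a::'a) b. \<psi> b *\<^sub>C a"
  note lin = clinear_simps[OF state_clinear[OF \<psi>]]
  have \<beta>: "cbilinear ?\<beta>"
    by (rule cbilinearI) (simp_all add: lin scaleC_simps scaleC_complex_def mult.commute)
  have bound: "norm (lsum ?\<beta> xs) \<le> 2 * spatial_norm (lsum simple_tensor xs)" for xs
  proof -
    define s where "s = lsum ?\<beta> xs"
    define t where "t = lsum simple_tensor xs"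
    obtain \<phi> :: "'a \<Rightarrow> complex" where \<phi>: "state \<phi>" "(norm s)\<^sup>2 \<le> 4 * Re (\<phi> (star s * s))"
      using exists_state_star_mult[OF nz] .
    let ?\<omega> = "prod_functional \<phi> \<psi>" and ?v = "simple_tensor s 1 :: ('a, 'b) alg_tensor"
    note pos = positive_prod_state[OF \<phi>(1) \<psi>]
    have one: "\<psi> 1 = 1" using \<psi> by (simp add: state_def)
    have "?\<omega> (star ?v * ?v) = \<phi> (star s * s)"
      by (simp add: simple_tensor_simps prod_functional_simple state_clinear \<phi> \<psi> one)
    then have v: "fnorm ?\<omega> ?v = fnorm \<phi> s" by (simp add: fnorm_def)
    have "?\<omega> (star ?v * t) = \<phi> (star s * s)"
    proof -
      have "clinear (\<lambda>t. ?\<omega> (star ?v * t))"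
        by (rule clinearI) (simp_all add: distrib_left scaleC_simps clinear_simps[OF clinear_prod_functional])
      then have "?\<omega> (star ?v * t) = lsum (\<lambda>a b. \<phi> (star s * a) * \<psi> b) xs"
        unfolding t_def by (subst clinear_lsum[where f = "\<lambda>t. ?\<omega> (star ?v * t)"])
          (simp_all add: simple_tensor_simps prod_functional_simple state_clinear \<phi> \<psi>)
      moreover have "clinear (\<lambda>a. \<phi> (star s * a))"
        by (rule clinearI) (simp_all add: distrib_left scaleC_simps clinear_simps[OF state_clinear[OF \<phi>(1)]])
      then have "\<phi> (star s * lsum ?\<beta> xs) = lsum (\<lambda>a b. \<phi> (star s * (\<psi> b *\<^sub>C a))) xs"
        by (rule clinear_lsum[where f = "\<lambda>a. \<phi> (star s * a)"])
      then have "\<phi> (star s * s) = lsum (\<lambda>a b. \<phi> (star s * a) * \<psi> b) xs"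
        by (simp add: s_def scaleC_simps clinear_simps[OF state_clinear[OF \<phi>(1)]] scaleC_complex_def mult.commute)
      ultimately show ?thesis by simp
    qed
    then have "cmod (\<phi> (star s * s)) \<le> fnorm \<phi> s * fnorm ?\<omega> t"
      using Cauchy_Schwarz[OF pos, of ?v t] by (simp add: v)
    also have "fnorm ?\<omega> t \<le> spatial_norm t"
      using spatial_norm_mult[OF \<phi>(1) \<psi>, of t 1] by (simp add: fnorm_def[of _ 1] prod_functional_one \<phi> \<psi>)
    finally have "fnorm \<phi> s * fnorm \<phi> s \<le> fnorm \<phi> s * spatial_norm t"
      using complex_Re_le_cmod[of "\<phi> (star s * s)"]
      by (simp add: mult_left_mono fnorm_nonneg[OF state_positive[OF \<phi>(1)]]
          flip: power2_eq_square fnorm_sq[OF state_positive[OF \<phi>(1)]])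
    then have le: "fnorm \<phi> s \<le> spatial_norm t"
      using fnorm_nonneg[OF state_positive[OF \<phi>(1)], of s]
      by (cases "fnorm \<phi> s = 0") (simp_all add: mult_le_cancel_left)
    have "(norm s)\<^sup>2 \<le> (2 * fnorm \<phi> s)\<^sup>2"
      using \<phi>(2) by (simp add: power_mult_distrib fnorm_sq[OF state_positive[OF \<phi>(1)]])
    then have "norm s \<le> 2 * fnorm \<phi> s"
      by (rule power2_le_imp_le) (simp add: fnorm_nonneg[OF state_positive[OF \<phi>(1)]])
    with le show ?thesis by (simp add: s_def t_def)
  qed
  show "bounded_clinear (slice_right \<psi> :: ('a, 'b) tensor \<Rightarrow> 'a)" "slice_right \<psi> (a \<otimes> b) = \<psi> b *\<^sub>C a"
    unfolding slice_right_def
    by (rule tensor_lift_bounded_clinear[OF \<beta> bound], rule tensor_lift_apply[OF \<beta> bound])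
qed

text \<open>A Fubini rule: both sides are bounded and agree on simple tensors. It converts
  statements about averages into statements about product functionals.\<close>

lemma state_slice_right:
  fixes x :: "('a, 'b) tensor"
  assumes \<phi>: "state \<phi>"
  shows "\<phi> (slice_right \<psi> x) = tensor_functional \<phi> \<psi> x"
proof -
  have "(\<lambda>x::('a, 'b) tensor. \<phi> (slice_right \<psi> x)) = tensor_functional \<phi> \<psi>"
    by (rule bounded_clinear_unique)
       (simp_all add: bounded_clinear_compose state_bounded_clinear slice_right_bounded_clinear
         tensor_functional_bounded_clinear tensor_functional_apply slice_right_apply \<phi> \<psi>
         clinear_scaleC[OF state_clinear[OF \<phi>]] scaleC_complex_def)
  then show ?thesis by (rule fun_cong)
qed

end

text \<open>The pairs on which the two triple products agree form a closed real subspace that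
  contains the generators in \<open>assoc_eq\<close>.\<close>

lemma assoc_eq_tensor_functional:
  assumes st: "state \<phi>" "state \<psi>" "state \<omega>" and "assoc_eq s t"
  shows "tensor_functional (tensor_functional \<phi> \<psi>) \<omega> s = tensor_functional \<phi> (tensor_functional \<psi> \<omega>) t"
proof -
  let ?L = "tensor_functional (tensor_functional \<phi> \<psi>) \<omega>" and ?R = "tensor_functional \<phi> (tensor_functional \<psi> \<omega>)"
  let ?S = "{p. ?L (fst p) = ?R (snd p)}"
  have L: "bounded_linear ?L" and R: "bounded_linear ?R"
    by (simp_all add: bounded_clinear_bounded_linear tensor_functional_bounded_clinear state_tensor_functional st)
  have "span {((a \<otimes> b) \<otimes> c, a \<otimes> (b \<otimes> c)) | a b c. True} \<subseteq> ?S"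
  proof (rule span_minimal)
    show "subspace ?S"
      by (auto simp: subspace_def linear_simps[OF L] linear_simps[OF R])
  qed (auto simp: tensor_functional_apply state_tensor_functional st)
  moreover have "closed ?S"
    by (intro closed_Collect_eq linear_continuous_on bounded_linear_compose[OF L bounded_linear_fst]
        bounded_linear_compose[OF R bounded_linear_snd])
  ultimately have "closure (span {((a \<otimes> b) \<otimes> c, a \<otimes> (b \<otimes> c)) | a b c. True}) \<subseteq> ?S"
    by (rule closure_minimal)
  then show ?thesis using assms(4) by (auto simp: assoc_eq_def)
qed

section \<open>Averaging over the quantum group\<close>

lemma state_ev: "state (ev (x :: 'x::topological_space))"
proof -
  have "clinear (ev x)"
    by (rule clinearI) (simp_all add: ev_def scaleC_complex_def)
  moreover have "cnj z * z \<in> \<real>\<^sub>\<ge>\<^sub>0" for z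
    by (simp add: complex_nonneg_Reals_iff algebra_simps)
  ultimately show ?thesis
    by (simp add: state_def positive_functional_def ev_def star_complex_def norm_bounded)
qed

context
  fixes \<Delta> :: "'a::cstar_algebra \<Rightarrow> ('a, 'a) tensor" and h :: "'a \<Rightarrow> complex"
    and \<alpha> :: "('x::topological_space \<Rightarrow>\<^sub>C complex) \<Rightarrow> ('x \<Rightarrow>\<^sub>C complex, 'a) tensor"
  assumes cqg: "compact_quantum_group \<Delta>" and haar: "haar_state \<Delta> h" and action: "cqg_action \<Delta> \<alpha>"
begin

lemma state_haar: "state h"
  and unital_star_hom_comult: "unital_star_hom \<Delta>"
  and unital_star_hom_action: "unital_star_hom \<alpha>"
  using cqg haar action by (auto simp: haar_state_def compact_quantum_group_def cqg_action_def)

lemma bcontfun_nonzero: "(1 :: 'x \<Rightarrow>\<^sub>C complex) \<noteq> 0"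
  by (rule state_nonzero[OF state_ev])

lemma ev_average: "apply_bcontfun (slice_right h (\<alpha> b)) x = tensor_functional (ev x) h (\<alpha> b)"
  using state_slice_right[OF state_haar bcontfun_nonzero state_ev, where x = "\<alpha> b"] by (simp add: ev_def)

text \<open>Product states separate, so both sides are compared under
  \<open>\<phi> \<otimes> \<psi>\<close>. The left side becomes \<open>((\<phi> \<otimes> \<psi>)
  \<otimes> h) (\<alpha> \<otimes> id) \<alpha> b\<close>, by coassociativity \<open>(\<phi>
  \<otimes> (\<psi> \<otimes> h)) (id \<otimes> \<Delta>) \<alpha> b\<close>, and by invariance
  \<open>(\<phi> \<otimes> h) \<alpha> b\<close>, which is \<phi> of the average.\<close>

lemma average_fixed: "\<alpha> (slice_right h (\<alpha> b)) = slice_right h (\<alpha> b) \<otimes> 1"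
proof -
  let ?E = "slice_right h :: ('x \<Rightarrow>\<^sub>C complex, 'a) tensor \<Rightarrow> _"
  note E = slice_right_bounded_clinear[OF state_haar bcontfun_nonzero] slice_right_apply[OF state_haar bcontfun_nonzero]
  have "tensor_functional \<phi> \<psi> (\<alpha> (?E (\<alpha> b)) - ?E (\<alpha> b) \<otimes> 1) = 0" if st: "state \<phi>" "state \<psi>" for \<phi> \<psi>
  proof -
    let ?T = "tensor_functional \<phi> \<psi>"
    have T: "state ?T" by (rule state_tensor_functional[OF st])
    \<comment> \<open>Slicing the last leg commutes with applying \<alpha> to the first; by
      boundedness simple tensors decide.\<close>
    have 1: "(\<lambda>u. ?T (\<alpha> (?E u))) = (\<lambda>u. tensor_functional ?T h (tensor_map \<alpha> id u))"
    proof (rule bounded_clinear_unique)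
      show "bounded_clinear (\<lambda>u. ?T (\<alpha> (?E u)))"
        by (rule bounded_clinear_compose[OF state_bounded_clinear[OF T]
              bounded_clinear_compose[OF unital_star_hom_bounded_clinear[OF unital_star_hom_action] E(1)]])
      show "bounded_clinear (\<lambda>u. tensor_functional ?T h (tensor_map \<alpha> id u))"
        by (rule bounded_clinear_compose[OF tensor_functional_bounded_clinear[OF T state_haar]
              tensor_map_bounded_clinear[OF unital_star_hom_action unital_star_hom_id]])
      show "?T (\<alpha> (?E (a \<otimes> c))) = tensor_functional ?T h (tensor_map \<alpha> id (a \<otimes> c))" for a c
        by (simp add: E tensor_map_apply[OF unital_star_hom_action unital_star_hom_id] tensor_functional_apply[OF T state_haar]
            clinear_scaleC[OF unital_star_hom_clinear[OF unital_star_hom_action]] clinear_scaleC[OF state_clinear[OF T]]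
            scaleC_complex_def)
    qed
    \<comment> \<open>The invariance \<open>(id \<otimes> h) \<Delta> c = h c *\<^sub>C 1\<close>,
      evaluated under \<psi>.\<close>
    have inv: "tensor_functional \<psi> h (\<Delta> c) = h c" for c
    proof -
      have "tensor_functional \<psi> h (\<Delta> c) = \<psi> (slice_right h (\<Delta> c))"
        by (simp add: state_slice_right[OF state_haar state_nonzero[OF state_haar] st(2)])
      also have "\<dots> = h c"
        using haar st(2) by (simp add: haar_state_def state_def scaleC_complex_def
            clinear_scaleC[OF state_clinear[OF st(2)]])
      finally show ?thesis .
    qed
    have \<psi>h: "state (tensor_functional \<psi> h)" by (rule state_tensor_functional[OF st(2) state_haar])
    have 2: "(\<lambda>u. tensor_functional \<phi> (tensor_functional \<psi> h) (tensor_map id \<Delta> u)) = tensor_functional \<phi> h"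
    proof (rule bounded_clinear_unique)
      show "bounded_clinear (\<lambda>u. tensor_functional \<phi> (tensor_functional \<psi> h) (tensor_map id \<Delta> u))"
        by (rule bounded_clinear_compose[OF tensor_functional_bounded_clinear[OF st(1) \<psi>h]
              tensor_map_bounded_clinear[OF unital_star_hom_id unital_star_hom_comult]])
    qed (simp_all add: tensor_functional_bounded_clinear tensor_map_apply[OF unital_star_hom_id unital_star_hom_comult]
        tensor_functional_apply \<psi>h st state_haar inv)
    have "?T (\<alpha> (?E (\<alpha> b))) = tensor_functional ?T h (tensor_map \<alpha> id (\<alpha> b))"
      by (rule fun_cong[OF 1])
    also have "\<dots> = tensor_functional \<phi> (tensor_functional \<psi> h) (tensor_map id \<Delta> (\<alpha> b))"
      using action by (intro assoc_eq_tensor_functional st state_haar) (simp add: cqg_action_def)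
    also have "\<dots> = tensor_functional \<phi> h (\<alpha> b)" by (rule fun_cong[OF 2])
    also have "\<dots> = \<phi> (?E (\<alpha> b))" by (simp add: state_slice_right[OF state_haar bcontfun_nonzero st(1)])
    also have "\<dots> = ?T (?E (\<alpha> b) \<otimes> 1)"
      using st by (simp add: tensor_functional_apply) (simp add: state_def)
    finally show ?thesis by (simp add: clinear_diff[OF state_clinear[OF T]])
  qed
  then have "\<alpha> (?E (\<alpha> b)) - ?E (\<alpha> b) \<otimes> 1 = 0" by (rule product_states_separate)
  then show ?thesis by simp
qed

lemma average_eq_if_fixed: "\<alpha> b = b \<otimes> 1 \<Longrightarrow> slice_right h (\<alpha> b) = b"
  using state_haar by (simp add: slice_right_apply[OF state_haar bcontfun_nonzero] state_def scaleC_one)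

text \<open>This is the inclusion in the definition of \<open>ergodic\<close> that holds for every
  action.\<close>

lemma scalars_fixed: "\<alpha> (c *\<^sub>C 1) = (c *\<^sub>C 1) \<otimes> 1"
  by (simp add: clinear_scaleC[OF unital_star_hom_clinear[OF unital_star_hom_action]] unital_star_hom_one[OF unital_star_hom_action]
      cbilinear_scaleC_left[OF cbilinear_tensor_prod] tensor_prod_one)

lemma mem_orbit_iff:
  "y \<in> orbit h \<alpha> x \<longleftrightarrow>
    (\<forall>b. apply_bcontfun (slice_right h (\<alpha> b)) x = apply_bcontfun (slice_right h (\<alpha> b)) y)"
  by (simp add: orbit_def fun_eq_iff ev_average)

lemma ergodic_iff_orbit: "ergodic \<alpha> \<longleftrightarrow> (\<forall>x. orbit h \<alpha> x = UNIV)"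
proof
  assume erg: "ergodic \<alpha>"
  have "\<exists>c. slice_right h (\<alpha> b) = c *\<^sub>C 1" for b
    using erg average_fixed[of b] unfolding ergodic_def by blast
  then have "apply_bcontfun (slice_right h (\<alpha> b)) x = apply_bcontfun (slice_right h (\<alpha> b)) y" for b x y
    by (metis one_bcontfun.rep_eq scaleC_bcontfun.rep_eq)
  then show "\<forall>x. orbit h \<alpha> x = UNIV" by (auto simp: mem_orbit_iff)
next
  assume orb: "\<forall>x. orbit h \<alpha> x = UNIV"
  have "\<exists>c. b = c *\<^sub>C 1" if b: "\<alpha> b = b \<otimes> 1" for b
  proof -
    have "apply_bcontfun b x = apply_bcontfun b y" for x y
      by (metis UNIV_I average_eq_if_fixed[OF b] mem_orbit_iff orb)
    \<comment> \<open>Here \<open>undefined\<close> is just some point of the space, a type being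
      nonempty.\<close>
    then have "b = apply_bcontfun b undefined *\<^sub>C 1"
      by (intro bcontfun_eqI) (simp add: scaleC_complex_def)
    then show ?thesis by blast
  qed
  then show "ergodic \<alpha>" unfolding ergodic_def by (auto simp: scalars_fixed)
qed

end

theorem theorem4p15:
  fixes \<Delta> :: "'a::cstar_algebra \<Rightarrow> ('a, 'a) tensor"
    and h :: "'a \<Rightarrow> complex"
    and \<alpha> :: "('x::t2_space \<Rightarrow>\<^sub>C complex) \<Rightarrow> ('x \<Rightarrow>\<^sub>C complex, 'a) tensor"
  assumes "compact (UNIV :: 'x set)"
    and "compact_quantum_group \<Delta>"
    and "haar_state \<Delta> h"
    and "cqg_action \<Delta> \<alpha>"
  shows "(ergodic \<alpha> \<longleftrightarrow> (\<forall>x. orbit h \<alpha> x = UNIV))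
    \<and> ((\<forall>x. orbit h \<alpha> x = UNIV) \<longleftrightarrow> (\<exists>x\<^sub>0. orbit h \<alpha> x\<^sub>0 = UNIV))"
proof (intro conjI)
  show "ergodic \<alpha> \<longleftrightarrow> (\<forall>x. orbit h \<alpha> x = UNIV)" by (rule ergodic_iff_orbit[OF assms(2-4)])
  \<comment> \<open>Orbits are the classes of an equivalence relation, equality of functionals, so
    one full class makes every class full.\<close>
  show "(\<forall>x. orbit h \<alpha> x = UNIV) \<longleftrightarrow> (\<exists>x\<^sub>0. orbit h \<alpha> x\<^sub>0 = UNIV)"
    unfolding orbit_def set_eq_iff by (simp only: mem_Collect_eq UNIV_I simp_thms) metis
qed

end
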